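(* Let $\mathfrak g=\mathfrak{sl}_2$ and $s\in\mathbf Z_+$. The module $D(2,s\omega)$ has a flag by level three Demazure modules. For $r\in\mathbf Z_+$ write $r=6r_0+r_1$ with $r_0\in\mathbf Z_+$, $0\le r_1<6$. If $s\equiv r\pmod 2$, then the numerical multiplicity is $$[D(2,s\omega):D(3,r\omega)]=\text{coefficient of } u^{\lceil s/2\rceil}\text{ in }\ \frac{u^{3r_0}P_{r_1}(u)}{(1-u)^{r_0}(1-u^2)^{r_0}},$$ where $$P_0=\frac1{1-u^2},\quad P_1=\frac u{1-u},\quad P_2=\frac u{1-u^2},\quad P_3=P_4=\frac{u^2}{(1-u)(1-u^2)},\quad P_5=\frac{u^3}{(1-u)(1-u^2)};$$ if $s\not\equiv r\pmod 2$ the multiplicity is $0$.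
   Context: $\mathbf Z_+$ and $\mathbf N$ are the non-negative and positive integers; the base field is $\mathbf C$. $\{x,y,h\}$ is the standard basis of $\mathfrak{sl}_2$, $\omega$ is the fundamental weight ($\omega(h)=1$), and $\mathfrak{sl}_2[t]=\mathfrak{sl}_2\otimes\mathbf C[t]$ is the current algebra with bracket $[a\otimes f,b\otimes g]=[a,b]\otimes fg$, graded by degree in $t$. A graded module is a $\mathbf Z$-graded module $V=\bigoplus_rV[r]$ with $(\mathfrak{sl}_2\otimes t^s)V[r]\subset V[r+s]$; $\tau_rV$ is $V$ with grading shifted uniformly by $r$. $W_{\mathrm{loc}}(s\omega)$ is the $\mathfrak{sl}_2[t]$-module generated by $w_s$ (in grade $0$) with relations $(x\otimes\mathbf C[t])w_s=0$, $(h\otimes t^p)w_s=s\,\delta_{p,0}w_s$ for $p\in\mathbf Z_+$, $(y\otimes1)^{s+1}w_s=0$. For $\ell\in\mathbf N$, $D(\ell,s\omega)$ (the Demazure module of level $\ell$) is the quotient of $W_{\mathrm{loc}}(s\omega)$ by the submodule generated by all $(y\otimes t^p)^{a+1}w_s$ with $p\in\mathbf Z_+$, $a\ge\max\{0,s-\ell p\}$. A flag of $V$ by level $\ell$ Demazure modules is a finite decreasing sequence of graded submodules $V=V_0\supseteq V_1\supseteq\cdots\supseteq V_{k+1}=0$ with $V_j/V_{j+1}\cong\tau_{s_j}D(\ell,r_j\omega)$ for some $r_j,s_j\in\mathbf Z_+$. The numerical multiplicity $[V:D(\ell,r\omega)]$ is the number of $j$ with $r_j=r$ (independent of the choice of flag).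 Rational functions in $u$ are expanded as power series at $u=0$. *)

theory Defs
  imports
    "HOL-Analysis.Determinants"
    "HOL-Algebra.Algebraic_Closure_Type"
    "HOL-Computational_Algebra.Formal_Power_Series"
    "HOL-Library.Poly_Mapping"
begin

definition sl2 :: "(complex^2^2) set" where
  "sl2 = {a. trace a = 0}"

definition sl2_x :: "complex^2^2" where
  "sl2_x = vector [vector [0, 1], vector [0, 0]]"

definition sl2_y :: "complex^2^2" where
  "sl2_y = vector [vector [0, 0], vector [1, 0]]"

definition sl2_h :: "complex^2^2" where
  "sl2_h = vector [vector [1, 0], vector [0, -1]]"

text \<open>The tensor product of \<open>sl2\<close> with \<open>\<complex>[t]\<close> is identified with the traceless matrices over
  \<open>\<complex>[t]\<close>; the pure tensor of \<open>a\<close> and \<open>f\<close> is the matrix \<open>f a\<close>.  Lemma \<open>bracket_tens\<close> below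
  says that the commutator is the bracket of the current algebra.\<close>

type_synonym current = "complex poly^2^2"

definition sl2t :: "current set" where
  "sl2t = {A. trace A = 0}"

definition tens :: "complex^2^2 \<Rightarrow> complex poly \<Rightarrow> current" where
  "tens a f = (\<chi> i j. Polynomial.smult (a $ i $ j) f)"

definition scale_current :: "complex \<Rightarrow> current \<Rightarrow> current" where
  "scale_current c A = (\<chi> i j. Polynomial.smult c (A $ i $ j))"

definition bracket :: "'a::comm_ring_1^2^2 \<Rightarrow> 'a^2^2 \<Rightarrow> 'a^2^2" where
  "bracket A B = A ** B - B ** A"

lemma tens_in_sl2t: "a \<in> sl2 \<Longrightarrow> tens a f \<in> sl2t"
  by (simp add: sl2_def sl2t_def tens_def trace_def sum_2 flip: smult_add_left)

lemma bracket_tens: "bracket (tens a f) (tens b g) = tens (bracket a b) (f * g)"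
  by (simp add: vec_eq_iff bracket_def tens_def matrix_matrix_mult_def sum_2
      forall_2 smult_diff_left smult_add_left mult.commute)

abbreviation complex_ring :: "complex ring" where
  "complex_ring \<equiv> ring_of_type_algebra"

text \<open>The fields \<open>mult\<close> and \<open>one\<close>, which the library's record of modules inherits from its record
  of rings, play no role.\<close>

record 'v gr_module = "(complex, 'v) module" +
  act :: "current \<Rightarrow> 'v \<Rightarrow> 'v"
  grade :: "int \<Rightarrow> 'v set"

locale graded_module = module complex_ring M for M :: "'v gr_module" (structure) +
  assumes act_closed: "A \<in> sl2t \<Longrightarrow> v \<in> carrier M \<Longrightarrow> act M A v \<in> carrier M"
    and act_add_left: "A \<in> sl2t \<Longrightarrow> B \<in> sl2t \<Longrightarrow> v \<in> carrier M \<Longrightarrow>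
      act M (A + B) v = act M A v \<oplus> act M B v"
    and act_scale_left: "A \<in> sl2t \<Longrightarrow> v \<in> carrier M \<Longrightarrow>
      act M (scale_current c A) v = c \<odot> act M A v"
    and act_add_right: "A \<in> sl2t \<Longrightarrow> v \<in> carrier M \<Longrightarrow> w \<in> carrier M \<Longrightarrow>
      act M A (v \<oplus> w) = act M A v \<oplus> act M A w"
    and act_smult_right: "A \<in> sl2t \<Longrightarrow> v \<in> carrier M \<Longrightarrow>
      act M A (c \<odot> v) = c \<odot> act M A v"
    and act_bracket: "A \<in> sl2t \<Longrightarrow> B \<in> sl2t \<Longrightarrow> v \<in> carrier M \<Longrightarrow>
      act M (bracket A B) v = act M A (act M B v) \<ominus> act M B (act M A v)"
    and grade_subspace: "submodule (grade M r) complex_ring M"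
    and grade_direct_sum: "v \<in> carrier M \<Longrightarrow>
      \<exists>!f. (\<forall>r. f r \<in> grade M r) \<and> finite {r. f r \<noteq> \<zero>} \<and> v = (\<Oplus>r\<in>{r. f r \<noteq> \<zero>}. f r)"
    and act_grade: "a \<in> sl2 \<Longrightarrow> v \<in> grade M r \<Longrightarrow>
      act M (tens a (Polynomial.monom 1 p)) v \<in> grade M (r + int p)"

definition act_submodule :: "'v set \<Rightarrow> 'v gr_module \<Rightarrow> bool" where
  "act_submodule N M \<longleftrightarrow> submodule N complex_ring M \<and> (\<forall>A\<in>sl2t. \<forall>v\<in>N. act M A v \<in> N)"

definition generated_submodule :: "'v gr_module \<Rightarrow> 'v set \<Rightarrow> 'v set" where
  "generated_submodule M S = \<Inter>{N. act_submodule N M \<and> S \<subseteq> N}"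

definition restrict_module :: "'v gr_module \<Rightarrow> 'v set \<Rightarrow> 'v gr_module" where
  "restrict_module M N = M\<lparr>carrier := N, grade := (\<lambda>r. N \<inter> grade M r)\<rparr>"

definition graded_submodule :: "'v set \<Rightarrow> 'v gr_module \<Rightarrow> bool" where
  "graded_submodule N M \<longleftrightarrow> N \<subseteq> carrier M \<and> graded_module (restrict_module M N)"

definition quotient_module :: "'v gr_module \<Rightarrow> 'v set \<Rightarrow> 'v set gr_module" where
  "quotient_module M N =
    \<lparr>carrier = a_rcosets\<^bsub>M\<^esub> N, monoid.mult = undefined, monoid.one = undefined,
     ring.zero = N, ring.add = set_add M,
     module.smult = (\<lambda>c C. \<Union>v\<in>C. N +>\<^bsub>M\<^esub> (c \<odot>\<^bsub>M\<^esub> v)),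
     act = (\<lambda>A C. \<Union>v\<in>C. N +>\<^bsub>M\<^esub> act M A v),
     grade = (\<lambda>r. (\<lambda>v. N +>\<^bsub>M\<^esub> v) ` grade M r)\<rparr>"

definition shift :: "int \<Rightarrow> 'v gr_module \<Rightarrow> 'v gr_module" where
  "shift k M = M\<lparr>grade := (\<lambda>r. grade M (r - k))\<rparr>"

definition graded_iso :: "'v gr_module \<Rightarrow> 'w gr_module \<Rightarrow> bool" where
  "graded_iso M N \<longleftrightarrow> (\<exists>\<phi>. bij_betw \<phi> (carrier M) (carrier N) \<and>
     (\<forall>v\<in>carrier M. \<forall>w\<in>carrier M. \<phi> (v \<oplus>\<^bsub>M\<^esub> w) = \<phi> v \<oplus>\<^bsub>N\<^esub> \<phi> w) \<and>
     (\<forall>c. \<forall>v\<in>carrier M. \<phi> (c \<odot>\<^bsub>M\<^esub> v) = c \<odot>\<^bsub>N\<^esub> \<phi> v) \<and>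
     (\<forall>A\<in>sl2t. \<forall>v\<in>carrier M. \<phi> (act M A v) = act N A (\<phi> v)) \<and>
     (\<forall>r. \<phi> ` grade M r = grade N r))"

text \<open>A letter \<open>(b, p)\<close> stands for the basis element \<open>b t\<^sup>p\<close> of the current algebra, so the space
  spanned by the words in these letters is its tensor algebra, graded by total degree in \<open>t\<close>.
  The current algebra acts by left multiplication.  This is not yet a Lie algebra action: dividing
  by the left ideal generated by all \<open>([A, B] - A B + B A) v\<close>, which is two-sided, gives the
  universal enveloping algebra.\<close>

datatype sl2_basis = BX | BY | BH

fun coord :: "sl2_basis \<Rightarrow> current \<Rightarrow> complex poly" where
  "coord BX A = A $ 1 $ 2"
| "coord BY A = A $ 2 $ 1"
| "coord BH A = A $ 1 $ 1"

type_synonym tensor = "(sl2_basis \<times> nat) list \<Rightarrow>\<^sub>0 complex"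

definition left_mult :: "current \<Rightarrow> tensor \<Rightarrow> tensor" where
  "left_mult A v = (\<Sum>w\<in>Poly_Mapping.keys v. \<Sum>b\<in>{BX, BY, BH}. \<Sum>p\<le>Polynomial.degree (coord b A).
     Poly_Mapping.single ((b, p) # w) (Polynomial.coeff (coord b A) p * Poly_Mapping.lookup v w))"

definition tensor_module :: "tensor gr_module" where
  "tensor_module =
    \<lparr>carrier = UNIV, monoid.mult = undefined, monoid.one = undefined, ring.zero = 0, ring.add = (+),
     module.smult = (\<lambda>c. Poly_Mapping.map ((*) c)), act = left_mult,
     grade = (\<lambda>r. {v. \<forall>w\<in>Poly_Mapping.keys v. int (sum_list (map snd w)) = r})\<rparr>"

definition bracket_relations :: "tensor set" where
  "bracket_relations = {left_mult (bracket A B) v -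
     (left_mult A (left_mult B v) - left_mult B (left_mult A v)) | A B v. A \<in> sl2t \<and> B \<in> sl2t}"

definition env_ideal :: "tensor set" where
  "env_ideal = generated_submodule tensor_module bracket_relations"

definition env_module :: "tensor set gr_module" where
  "env_module = quotient_module tensor_module env_ideal"

definition env_gen :: "tensor set" where
  "env_gen = env_ideal +>\<^bsub>tensor_module\<^esub> Poly_Mapping.single [] 1"

definition weyl_relations :: "nat \<Rightarrow> tensor set set" where
  "weyl_relations s =
     {act env_module (tens sl2_x f) env_gen | f. True} \<union>
     {act env_module (tens sl2_h (Polynomial.monom 1 p)) env_gen \<ominus>\<^bsub>env_module\<^esub>
        ((if p = 0 then of_nat s else 0) \<odot>\<^bsub>env_module\<^esub> env_gen) | p. True} \<union>
     {(act env_module (tens sl2_y 1) ^^ (s + 1)) env_gen}"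

definition weyl_ideal :: "nat \<Rightarrow> tensor set set" where
  "weyl_ideal s = generated_submodule env_module (weyl_relations s)"

definition local_weyl :: "nat \<Rightarrow> tensor set set gr_module" where
  "local_weyl s = quotient_module env_module (weyl_ideal s)"

definition weyl_gen :: "nat \<Rightarrow> tensor set set" where
  "weyl_gen s = weyl_ideal s +>\<^bsub>env_module\<^esub> env_gen"

definition demazure_relations :: "nat \<Rightarrow> nat \<Rightarrow> tensor set set set" where
  "demazure_relations l s =
     {(act (local_weyl s) (tens sl2_y (Polynomial.monom 1 p)) ^^ (a + 1)) (weyl_gen s) | p a.
        int a \<ge> max 0 (int s - int l * int p)}"

definition demazure :: "nat \<Rightarrow> nat \<Rightarrow> tensor set set set gr_module" where
  "demazure l s =
     quotient_module (local_weyl s) (generated_submodule (local_weyl s) (demazure_relations l s))"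

text \<open>The flag is \<open>F 0 \<supseteq> F 1 \<supseteq> \<dots> \<supseteq> F (k + 1)\<close>; the factor \<open>F j / F (j + 1)\<close> is the level \<open>l\<close>
  Demazure module of highest weight \<open>\<rho> j\<close>, shifted by \<open>\<sigma> j\<close>.\<close>

definition demazure_flag ::
  "nat \<Rightarrow> 'v gr_module \<Rightarrow> nat \<Rightarrow> (nat \<Rightarrow> 'v set) \<Rightarrow> (nat \<Rightarrow> nat) \<Rightarrow> (nat \<Rightarrow> nat) \<Rightarrow> bool" where
  "demazure_flag l V k F \<rho> \<sigma> \<longleftrightarrow>
     F 0 = carrier V \<and> F (k + 1) = {\<zero>\<^bsub>V\<^esub>} \<and>
     (\<forall>j\<le>k + 1. graded_submodule (F j) V) \<and>
     (\<forall>j\<le>k. F (j + 1) \<subseteq> F j \<and>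
        graded_iso (quotient_module (restrict_module V (F j)) (F (j + 1)))
          (shift (int (\<sigma> j)) (demazure l (\<rho> j))))"

text \<open>\<open>has_multiplicity l V r m\<close> says that the numerical multiplicity \<open>[V : D(l, r \<omega>)]\<close> is defined
  and equal to \<open>m\<close>: a flag exists, and every flag has exactly \<open>m\<close> factors of highest weight \<open>r\<close>.\<close>

definition has_multiplicity :: "nat \<Rightarrow> 'v gr_module \<Rightarrow> nat \<Rightarrow> nat \<Rightarrow> bool" where
  "has_multiplicity l V r m \<longleftrightarrow>
     (\<exists>k F \<rho> \<sigma>. demazure_flag l V k F \<rho> \<sigma>) \<and>
     (\<forall>k F \<rho> \<sigma>. demazure_flag l V k F \<rho> \<sigma> \<longrightarrow> card {j. j \<le> k \<and> \<rho> j = r} = m)"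

definition series_P :: "nat \<Rightarrow> rat fps" where
  "series_P i = (let u = fps_X in
     [1 / (1 - u\<^sup>2), u / (1 - u), u / (1 - u\<^sup>2),
      u\<^sup>2 / ((1 - u) * (1 - u\<^sup>2)), u\<^sup>2 / ((1 - u) * (1 - u\<^sup>2)),
      u ^ 3 / ((1 - u) * (1 - u\<^sup>2))] ! i)"

end

theory Submission
  imports Defs
begin

text \<open>A quotient of the universal highest weight module is \<open>\<C>[y]\<close> modulo an ideal, where the
  variable \<open>y\<^sub>p\<close> is the operator \<open>y t\<^sup>p\<close>.  To a multiset of parts \<open>\<xi>\<close> one attaches the ideal generated by
  the coefficients of \<open>z\<^sup>s\<close> in \<open>y(z)\<^sup>r\<close> with \<open>s + r > \<Sum>\<^sub>i min \<xi>\<^sub>i r\<close>, where \<open>y(z) = \<Sum>\<^sub>p y\<^sub>p z\<^sup>p\<close>;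
  the ideal of a Demazure module of level \<open>l\<close> is the one of \<open>(l, \<dots>, l, s mod l)\<close>.  If \<open>a \<ge> b > 0\<close> are the
  two smallest of \<open>m\<close> parts, adding \<open>y\<^sub>m\<^sub>-\<^sub>1\<^sup>b\<close> to the ideal of \<open>\<xi>\<close> turns \<open>(a, b)\<close> into \<open>(a + 1, b - 1)\<close>,
  and the annihilator of \<open>y\<^sub>m\<^sub>-\<^sub>1\<^sup>b\<close> contains the ideal in which they are replaced by \<open>a - b\<close>.  By induction
  the quotient has dimension at most \<open>\<Prod>\<^sub>i (\<xi>\<^sub>i + 1)\<close>.  It degenerates a semisimple algebra of exactly that
  dimension, so equality holds and the sequences are exact.  Starting from parts two, they lead to parts
  three, which gives the flag and a recursion for the multiplicities.  These do not depend on the flag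
  because the weight \<open>r\<close> occurs once in \<open>D(3, r)\<close> and all its other weights are smaller.\<close>

section \<open>Linear algebra on finitely supported functions\<close>

text \<open>For each end of an exact sequence a list of relations can be verified, but not that the
  list is complete. Hence the detour through dimensions: the upper bounds add up because
  \<open>(a + 1)(b + 1) = (a + 2) b + (a - b + 1)\<close>, and one lower bound, valid for every
  multiset of parts, forces equality everywhere.

  The relations of the annihilator have two sources. Since all higher variables vanish,
  \<open>y_(m-1)^b\<close> generates a highest weight submodule of weight \<open>n - 2 b\<close>,
  where n is the sum of the parts. Nilpotency of \<open>y_0\<close> then yields Garland's relations,
  but these only see the total weight. Relations that see the large parts come from the substitution
  \<open>y_p -> y_(p+k)\<close>, which adds k parts.

  The Demazure module is defined by three nested quotients of the tensor algebra. Explicit operators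
  on C[y], together with reordering of words, identify it with a quotient of C[y]; this does the
  work of a basis theorem for the enveloping algebra. For uniqueness, flags with arbitrary
  generators have to be treated; the eigenvalues of h single out the component of a generator that
  has the right weight.\<close>

definition smul :: "complex \<Rightarrow> ('k \<Rightarrow>\<^sub>0 complex) \<Rightarrow> 'k \<Rightarrow>\<^sub>0 complex" where
  "smul c = Poly_Mapping.map ((*) c)"

lemma lookup_smul [simp]: "Poly_Mapping.lookup (smul c u) k = c * Poly_Mapping.lookup u k"
  unfolding smul_def by transfer (auto simp: when_def)

lemma smul_single [simp]: "smul c (Poly_Mapping.single k a) = Poly_Mapping.single k (c * a)"
  by (rule poly_mapping_eqI) (simp add: lookup_single when_def)

global_interpretation pm: vector_space "smul :: complex \<Rightarrow> ('k \<Rightarrow>\<^sub>0 complex) \<Rightarrow> _"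
  by standard (auto intro!: poly_mapping_eqI simp: lookup_add algebra_simps)

global_interpretation pm2: vector_space_pair
  "smul :: complex \<Rightarrow> ('k \<Rightarrow>\<^sub>0 complex) \<Rightarrow> _" "smul :: complex \<Rightarrow> ('l \<Rightarrow>\<^sub>0 complex) \<Rightarrow> _"
  ..

abbreviation plinear :: "(('k \<Rightarrow>\<^sub>0 complex) \<Rightarrow> ('l \<Rightarrow>\<^sub>0 complex)) \<Rightarrow> bool" where
  "plinear \<equiv> Vector_Spaces.linear smul smul"

lemma plinearI:
  assumes "\<And>u v. f (u + v) = f u + f v" "\<And>c u. f (smul c u) = smul c (f u)"
  shows "plinear f"
  using assms by unfold_locales auto

lemmas plinear_add = pm2.linear_add
  and plinear_scale = pm2.linear_scale
  and plinear_0 = pm2.linear_0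
  and plinear_diff = pm2.linear_diff
  and plinear_neg = pm2.linear_neg
  and plinear_sum = pm2.linear_sum

definition mon :: "'k \<Rightarrow> 'k \<Rightarrow>\<^sub>0 complex" where
  "mon k = Poly_Mapping.single k 1"

definition lin :: "('k \<Rightarrow> 'l \<Rightarrow>\<^sub>0 complex) \<Rightarrow> ('k \<Rightarrow>\<^sub>0 complex) \<Rightarrow> 'l \<Rightarrow>\<^sub>0 complex" where
  "lin f u = (\<Sum>k\<in>Poly_Mapping.keys u. smul (Poly_Mapping.lookup u k) (f k))"

lemma lin_superset:
  assumes "finite K" "Poly_Mapping.keys u \<subseteq> K"
  shows "lin f u = (\<Sum>k\<in>K. smul (Poly_Mapping.lookup u k) (f k))"
  unfolding lin_def by (rule sum.mono_neutral_left) (use assms in \<open>auto simp: in_keys_iff\<close>)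

lemma plinear_lin: "plinear (lin f)"
proof (rule plinearI)
  fix u v :: "'a \<Rightarrow>\<^sub>0 complex" and c
  let ?K = "Poly_Mapping.keys u \<union> Poly_Mapping.keys v"
  have "lin f (u + v) = (\<Sum>k\<in>?K. smul (Poly_Mapping.lookup (u + v) k) (f k))"
    by (rule lin_superset) (auto simp: in_keys_iff lookup_add)
  also have "\<dots> = (\<Sum>k\<in>?K. smul (Poly_Mapping.lookup u k) (f k)) +
      (\<Sum>k\<in>?K. smul (Poly_Mapping.lookup v k) (f k))"
    by (simp add: lookup_add pm.scale_left_distrib sum.distrib)
  also have "\<dots> = lin f u + lin f v" by (simp add: lin_superset[of ?K])
  finally show "lin f (u + v) = lin f u + lin f v" .
  have "lin f (smul c u) = (\<Sum>k\<in>Poly_Mapping.keys u. smul (Poly_Mapping.lookup (smul c u) k) (f k))"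
    by (rule lin_superset) (auto simp: in_keys_iff)
  then show "lin f (smul c u) = smul c (lin f u)"
    by (simp add: lin_def pm.scale_sum_right)
qed

lemma lin_single [simp]: "lin f (Poly_Mapping.single k c) = smul c (f k)"
  by (cases "c = 0") (simp_all add: lin_def)

lemma lin_mon [simp]: "lin f (mon k) = f k"
  by (simp add: mon_def)

lemmas lin_add = plinear_add[OF plinear_lin]
  and lin_smul = plinear_scale[OF plinear_lin]

lemma lin_mon_id [simp]: "lin mon = (\<lambda>u. u)"
proof
  fix u :: "'a \<Rightarrow>\<^sub>0 complex"
  show "lin mon u = u"
    by (rule poly_mapping_eqI)
      (simp add: lin_def lookup_sum mon_def lookup_single when_def in_keys_iff if_distrib
        sum.delta' cong: if_cong)
qed

lemma pm_expand: "u = (\<Sum>k\<in>Poly_Mapping.keys u. smul (Poly_Mapping.lookup u k) (mon k))"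
  using fun_cong[OF lin_mon_id, of u] unfolding lin_def by (rule sym)

lemma pm_induct [case_names mon add smul]:
  assumes "\<And>k. P (mon k)" "\<And>u v. P u \<Longrightarrow> P v \<Longrightarrow> P (u + v)" "\<And>c u. P u \<Longrightarrow> P (smul c u)"
  shows "P (u :: 'k \<Rightarrow>\<^sub>0 complex)"
proof -
  have z: "P 0" using assms(3)[OF assms(1), of 0] by simp
  have "P (\<Sum>k\<in>K. smul (Poly_Mapping.lookup u k) (mon k))" if "finite K" for K
    using that by induction (auto intro: z assms)
  then show ?thesis by (subst pm_expand) simp
qed

lemma plinear_eqI:
  assumes "plinear f" "plinear g" "\<And>k. f (mon k) = g (mon k)"
  shows "f u = g u"
  by (induction u rule: pm_induct)
    (auto simp: assms(3) plinear_add[OF assms(1)] plinear_add[OF assms(2)]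
      plinear_scale[OF assms(1)] plinear_scale[OF assms(2)])

lemma mon_in_subspaceD:
  assumes "pm.subspace A" "\<And>k. k \<in> Poly_Mapping.keys u \<Longrightarrow> mon k \<in> A"
  shows "u \<in> A"
  using assms by (subst pm_expand) (auto intro!: pm.subspace_sum pm.subspace_scale)

text \<open>The degree function is a parameter because several gradings occur: on monomials
  \<open>size\<close> measures the weight and \<open>sum_mset\<close> the degree in t; words carry a
  degree in t as well.\<close>

definition component :: "('k \<Rightarrow> nat) \<Rightarrow> nat \<Rightarrow> ('k \<Rightarrow>\<^sub>0 complex) \<Rightarrow> 'k \<Rightarrow>\<^sub>0 complex" where
  "component dg d = lin (\<lambda>k. if dg k = d then mon k else 0)"

definition homog :: "('k \<Rightarrow> nat) \<Rightarrow> nat \<Rightarrow> ('k \<Rightarrow>\<^sub>0 complex) set" where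
  "homog dg d = {u. \<forall>k\<in>Poly_Mapping.keys u. dg k = d}"

lemma component_mon [simp]: "component dg d (mon k) = (if dg k = d then mon k else 0)"
  by (simp add: component_def)

lemma plinear_component: "plinear (component dg d)"
  unfolding component_def by (rule plinear_lin)

lemmas component_add = plinear_add[OF plinear_component]
  and component_smul = plinear_scale[OF plinear_component]
  and component_0 [simp] = plinear_0[OF plinear_component]
  and component_diff = plinear_diff[OF plinear_component]
  and component_sum = plinear_sum[OF plinear_component]

lemma lookup_component: "Poly_Mapping.lookup (component dg d u) k = (if dg k = d then Poly_Mapping.lookup u k else 0)"
proof (induction u rule: pm_induct)
  case (mon l)
  then show ?case by (auto simp: mon_def lookup_single when_def component_def)
qed (auto simp: component_add component_smul lookup_add)

lemma subspace_homog: "pm.subspace (homog dg d)"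
  by (auto simp: pm.subspace_def homog_def in_keys_iff lookup_add)

lemma homog_add: "u \<in> homog dg d \<Longrightarrow> v \<in> homog dg d \<Longrightarrow> u + v \<in> homog dg d"
  and homog_smul: "u \<in> homog dg d \<Longrightarrow> smul c u \<in> homog dg d"
  and homog_0 [simp]: "0 \<in> homog dg d"
  and homog_diff: "u \<in> homog dg d \<Longrightarrow> v \<in> homog dg d \<Longrightarrow> u - v \<in> homog dg d"
  and homog_sum: "(\<And>i. i \<in> I \<Longrightarrow> f i \<in> homog dg d) \<Longrightarrow> sum f I \<in> homog dg d"
  using subspace_homog[of dg d]
  by (auto intro: pm.subspace_add pm.subspace_scale pm.subspace_0 pm.subspace_diff pm.subspace_sum)

lemma homog_mon [simp]: "mon k \<in> homog dg d \<longleftrightarrow> dg k = d"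
  by (simp add: homog_def mon_def)

lemma component_homog: "component dg d u \<in> homog dg d"
  by (auto simp: homog_def in_keys_iff lookup_component split: if_splits)

lemma component_of_homog: "u \<in> homog dg e \<Longrightarrow> component dg d u = (if d = e then u else 0)"
  by (rule poly_mapping_eqI) (auto simp: lookup_component homog_def in_keys_iff)

lemma component_sum_eq:
  assumes "finite D" "dg ` Poly_Mapping.keys u \<subseteq> D"
  shows "(\<Sum>d\<in>D. component dg d u) = u"
  by (rule poly_mapping_eqI)
    (use assms in \<open>force simp: lookup_sum lookup_component in_keys_iff sum.delta\<close>)

lemma component_eq_0: "d \<notin> dg ` Poly_Mapping.keys u \<Longrightarrow> component dg d u = 0"
  by (rule poly_mapping_eqI) (auto simp: lookup_component in_keys_iff)

section \<open>The polynomial ring as a highest weight module\<close>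

type_synonym ypoly = "nat multiset \<Rightarrow>\<^sub>0 complex"

definition yv :: "nat \<Rightarrow> ypoly" where
  "yv p = mon {#p#}"

lemma mon_mult: "mon M * mon N = (mon (M + N) :: ypoly)"
  by (simp add: mon_def mult_single)

lemma mon_empty [simp]: "mon {#} = (1 :: ypoly)"
  by (simp add: mon_def flip: zero_multiset_def)

lemma yv_mult_mon: "yv p * mon M = mon (add_mset p M)"
  by (simp add: yv_def mon_mult)

lemma smul_eq_mult: "smul c u = Poly_Mapping.single {#} c * (u :: ypoly)"
  by (simp add: smul_def mult_map_scale_conv_mult flip: zero_multiset_def)

lemma smul_mult_left [simp]: "smul c u * v = smul c (u * v :: ypoly)"
  by (simp add: smul_eq_mult mult.assoc)

lemma smul_mult_right [simp]: "u * smul c v = smul c (u * v :: ypoly)"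
  by (simp add: smul_eq_mult mult.left_commute)

lemma smul_of_nat: "smul (of_nat k) u = of_nat k * (u :: ypoly)"
  by (simp add: smul_eq_mult flip: zero_multiset_def)

lemma ypoly_induct [case_names one var add smul]:
  assumes "P 1" "\<And>q u. P u \<Longrightarrow> P (yv q * u)" "\<And>u v. P u \<Longrightarrow> P v \<Longrightarrow> P (u + v)"
    "\<And>c u. P u \<Longrightarrow> P (smul c u)"
  shows "P (u :: ypoly)"
proof (induction u rule: pm_induct)
  case (mon M)
  show ?case
    by (induction M) (auto simp: assms simp flip: yv_mult_mon)
qed (use assms in auto)

lemma plinear_mult_left: "plinear (\<lambda>u :: ypoly. v * u)"
  by (rule plinearI) (simp_all add: distrib_left)

text \<open>The variable \<open>yv p\<close> stands for \<open>y t\<^sup>p\<close>.  Together with multiplication by the variables, the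
  operators \<open>hop n j\<close> and \<open>xop n j\<close> for \<open>h t\<^sup>j\<close> and \<open>x t\<^sup>j\<close> make \<open>\<C>[y]\<close> the universal module with a
  generator killed by all \<open>x t\<^sup>j\<close> on which \<open>h t\<^sup>j\<close> acts by \<open>n \<delta>\<^sub>j\<^sub>0\<close>.\<close>

definition sderiv :: "nat \<Rightarrow> ypoly \<Rightarrow> ypoly" where
  "sderiv j = lin (\<lambda>M. \<Sum>p\<in>#M. mon (add_mset (p + j) (M - {#p#})))"

definition hop :: "nat \<Rightarrow> nat \<Rightarrow> ypoly \<Rightarrow> ypoly" where
  "hop n j u = (if j = 0 then of_nat n * u else 0) - 2 * sderiv j u"

text \<open>Moving \<open>x t^j\<close> to the right past a factor \<open>y_p\<close> creates
  \<open>h t^(p+j)\<close>, which acts on the factors to its right through the scalar and minus 2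
  \<open>sderiv (p + j)\<close>. Each unordered pair of factors is thus met once with coefficient 2;
  spread over ordered pairs, this becomes the coefficient 1 here, and no order of the factors is
  left in the formula.\<close>

definition xop :: "nat \<Rightarrow> nat \<Rightarrow> ypoly \<Rightarrow> ypoly" where
  "xop n j = lin (\<lambda>M. \<Sum>p\<in>#M. (if p + j = 0 then of_nat n * mon (M - {#p#}) else 0) -
     sderiv (p + j) (mon (M - {#p#})))"

lemma plinear_sderiv: "plinear (sderiv j)"
  unfolding sderiv_def by (rule plinear_lin)

lemmas sderiv_add [simp] = plinear_add[OF plinear_sderiv]
  and sderiv_smul [simp] = plinear_scale[OF plinear_sderiv]
  and sderiv_0 [simp] = plinear_0[OF plinear_sderiv]
  and sderiv_diff [simp] = plinear_diff[OF plinear_sderiv]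
  and sderiv_sum = plinear_sum[OF plinear_sderiv]

lemma plinear_xop: "plinear (xop n j)"
  unfolding xop_def by (rule plinear_lin)

lemmas xop_add [simp] = plinear_add[OF plinear_xop]
  and xop_smul [simp] = plinear_scale[OF plinear_xop]
  and xop_0 [simp] = plinear_0[OF plinear_xop]
  and xop_diff [simp] = plinear_diff[OF plinear_xop]
  and xop_sum = plinear_sum[OF plinear_xop]

lemma two_eq_smul: "2 * u = smul 2 (u :: ypoly)"
  using smul_of_nat[of 2 u] by simp

lemma plinear_hop: "plinear (hop n j)"
  by (rule plinearI) (simp_all add: hop_def algebra_simps two_eq_smul pm.scale_left_commute
      pm.scale_right_diff_distrib)

lemmas hop_add [simp] = plinear_add[OF plinear_hop]
  and hop_smul [simp] = plinear_scale[OF plinear_hop]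
  and hop_0 [simp] = plinear_0[OF plinear_hop]
  and hop_diff [simp] = plinear_diff[OF plinear_hop]
  and hop_sum = plinear_sum[OF plinear_hop]

lemma plinear_of_nat: "plinear f \<Longrightarrow> f (of_nat k * u) = of_nat k * (f u :: ypoly)"
  for u :: ypoly
  by (metis plinear_scale smul_of_nat)

lemma plinear_two: "plinear f \<Longrightarrow> f (2 * u) = 2 * (f u :: ypoly)" for u :: ypoly
  by (simp add: two_eq_smul plinear_scale)

lemmas op_numeral [simp] =
  plinear_of_nat[OF plinear_sderiv] plinear_of_nat[OF plinear_hop] plinear_of_nat[OF plinear_xop]
  plinear_two[OF plinear_sderiv] plinear_two[OF plinear_hop] plinear_two[OF plinear_xop]

lemma sderiv_1 [simp]: "sderiv j 1 = 0"
  by (simp add: sderiv_def flip: mon_empty)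

lemma hop_1: "hop n j 1 = (if j = 0 then of_nat n else 0)"
  by (simp add: hop_def)

lemma xop_1 [simp]: "xop n j 1 = 0"
  by (simp add: xop_def flip: mon_empty)

lemma sum_mset_plinear: "plinear f \<Longrightarrow> f (\<Sum>p\<in>#M. g p) = (\<Sum>p\<in>#M. f (g p))"
  by (induction M) (simp_all add: plinear_0 plinear_add)

lemma sderiv_var [simp]: "sderiv j (yv q * u) = yv (q + j) * u + yv q * sderiv j u"
proof -
  have "plinear (\<lambda>u. sderiv j (yv q * u))" "plinear (\<lambda>u. yv (q + j) * u + yv q * sderiv j u)"
    by (auto intro!: plinearI simp: algebra_simps pm.scale_right_distrib)
  then show ?thesis
  proof (rule plinear_eqI)
    fix M
    have "sderiv j (yv q * mon M) = mon (add_mset (q + j) M) +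
        (\<Sum>p\<in>#M. mon (add_mset (p + j) (add_mset q M - {#p#})))"
      by (simp add: yv_mult_mon sderiv_def)
    also have "(\<Sum>p\<in>#M. mon (add_mset (p + j) (add_mset q M - {#p#}))) =
        (\<Sum>p\<in>#M. yv q * mon (add_mset (p + j) (M - {#p#})))"
    proof (intro arg_cong[of _ _ sum_mset] image_mset_cong)
      fix p assume "p \<in># M"
      then have "add_mset q M - {#p#} = add_mset q (M - {#p#})"
        by simp
      then show "mon (add_mset (p + j) (add_mset q M - {#p#})) =
          yv q * mon (add_mset (p + j) (M - {#p#}))"
        by (simp add: yv_mult_mon add_mset_commute)
    qed
    also have "\<dots> = yv q * sderiv j (mon M)"
      by (simp add: sderiv_def sum_mset_plinear[OF plinear_mult_left])
    finally show "sderiv j (yv q * mon M) = yv (q + j) * mon M + yv q * sderiv j (mon M)"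
      by (simp add: yv_mult_mon)
  qed
qed

lemma hop_var: "hop n j (yv q * u) = yv q * hop n j u - 2 * (yv (q + j) * u)"
  by (simp add: hop_def ring_distribs)

text \<open>The relation \<open>[x t^j, y t^q] = h t^(q+j)\<close>. Together with
  \<open>xop_1\<close> it determines the operator, and the commutators below follow from it by
  \<open>ypoly_induct\<close>.\<close>

lemma xop_var: "xop n j (yv q * u) = yv q * xop n j u + hop n (q + j) u"
proof -
  define g :: "nat \<Rightarrow> nat multiset \<Rightarrow> ypoly" where
    "g p M = (if p + j = 0 then of_nat n * mon M else 0) - sderiv (p + j) (mon M)" for p M
  have "plinear (\<lambda>u. xop n j (yv q * u))" "plinear (\<lambda>u. yv q * xop n j u + hop n (q + j) u)"
    by (auto intro!: plinearI simp: algebra_simps pm.scale_right_distrib)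
  then show ?thesis
  proof (rule plinear_eqI)
    fix M
    have x: "xop n j (mon M) = (\<Sum>p\<in>#M. g p (M - {#p#}))" for M
      by (simp add: xop_def g_def)
    have step: "g p (add_mset q M) = yv q * g p M - mon (add_mset (q + (p + j)) M)" for p M
      by (simp add: g_def yv_mult_mon[symmetric] ring_distribs mult.assoc)
    have "xop n j (yv q * mon M) = g q M + (\<Sum>p\<in>#M. g p (add_mset q M - {#p#}))"
      by (simp add: yv_mult_mon x)
    also have "(\<Sum>p\<in>#M. g p (add_mset q M - {#p#})) = (\<Sum>p\<in>#M. yv q * g p (M - {#p#}) -
        mon (add_mset (p + (q + j)) (M - {#p#})))"
    proof (intro arg_cong[of _ _ sum_mset] image_mset_cong)
      fix p assume "p \<in># M"
      then have "add_mset q M - {#p#} = add_mset q (M - {#p#})"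
        by simp
      then show "g p (add_mset q M - {#p#}) =
          yv q * g p (M - {#p#}) - mon (add_mset (p + (q + j)) (M - {#p#}))"
        by (simp add: step add_ac)
    qed
    \<comment> \<open>A second copy of \<open>sderiv (q + j)\<close> besides the one inside
      \<open>g q M\<close>: together they give the factor 2 of \<open>hop\<close>.\<close>
    also have "\<dots> = yv q * xop n j (mon M) - sderiv (q + j) (mon M)"
    proof -
      have "(\<Sum>p\<in>#N. f p - h p) = (\<Sum>p\<in>#N. f p) - (\<Sum>p\<in>#N. (h p :: ypoly))" for N :: "nat multiset" and f h
        by (induction N) auto
      then show ?thesis
        by (simp add: x sderiv_def sum_mset_plinear[OF plinear_mult_left])
    qed
    finally show "xop n j (yv q * mon M) = yv q * xop n j (mon M) + hop n (q + j) (mon M)"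
      by (simp add: g_def hop_def algebra_simps)
  qed
qed

lemma sderiv_mult: "sderiv j (u * v) = sderiv j u * v + u * sderiv j v"
  by (induction u rule: ypoly_induct)
    (simp_all add: mult.assoc ring_distribs pm.scale_right_distrib)

lemma sderiv_comm: "sderiv i (sderiv j u) = sderiv j (sderiv i u)"
  by (induction u rule: ypoly_induct) (simp_all add: add_ac)

lemma hop_comm: "hop n i (hop n j u) = hop n j (hop n i u)"
  by (simp add: hop_def sderiv_comm[of i j] ring_distribs)

lemma hop_xop: "hop n i (xop n j u) = xop n j (hop n i u) + 2 * xop n (i + j) u"
proof (induction u rule: ypoly_induct)
  case one
  then show ?case by (simp add: hop_1 plinear_of_nat[OF plinear_xop, of _ _ _ 1, simplified])
next
  case (var q u)
  have "hop n i (xop n j (yv q * u)) =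
      yv q * hop n i (xop n j u) - 2 * (yv (q + i) * xop n j u) + hop n i (hop n (q + j) u)"
    by (simp add: xop_var hop_var)
  also have "\<dots> = xop n j (hop n i (yv q * u)) + 2 * xop n (i + j) (yv q * u)"
    by (simp add: xop_var hop_var var ring_distribs add_ac hop_comm[of n i "j + q"])
  finally show ?case .
qed (simp_all add: algebra_simps pm.scale_right_distrib two_eq_smul pm.scale_left_commute)

lemma xop_comm: "xop n i (xop n j u) = xop n j (xop n i u)"
proof (induction u rule: ypoly_induct)
  case (var q u)
  then show ?case
    by (simp add: xop_var hop_xop add_ac)
qed simp_all

section \<open>Powers of the generating function of the variables\<close>

definition ys :: "ypoly fps" where
  "ys = Abs_fps yv"

lemma ys_nth [simp]: "fps_nth ys p = yv p"
  by (simp add: ys_def)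

definition fmap :: "('a::zero \<Rightarrow> 'b::zero) \<Rightarrow> 'a fps \<Rightarrow> 'b fps" where
  "fmap f F = Abs_fps (\<lambda>n. f (fps_nth F n))"

lemma fmap_nth [simp]: "fps_nth (fmap f F) n = f (fps_nth F n)"
  by (simp add: fmap_def)

lemma fmap_sderiv_mult: "fmap (sderiv j) (F * G) = fmap (sderiv j) F * G + F * fmap (sderiv j) G"
  by (rule fps_ext) (simp add: fps_mult_nth sderiv_sum sderiv_mult sum.distrib)

lemma fmap_sderiv_ys: "fmap (sderiv j) ys = fps_shift j ys"
  by (rule fps_ext) (use sderiv_var[of j _ 1] in \<open>simp\<close>)

lemma fmap_sderiv_ys_pow: "fmap (sderiv j) (ys ^ r) = of_nat r * ys ^ (r - 1) * fps_shift j ys"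
proof (induction r)
  case 0
  show ?case by (rule fps_ext) (simp add: fps_one_nth)
next
  case (Suc r)
  then show ?case
    by (cases r) (simp_all add: fmap_sderiv_mult fmap_sderiv_ys algebra_simps)
qed

lemma sderiv_ys_pow: "sderiv j (fps_nth (ys ^ r) s) = of_nat r * fps_nth (ys ^ (r - 1) * fps_shift j ys) s"
proof -
  have "of_nat r * ys ^ (r - 1) * fps_shift j ys =
      fps_const (of_nat r :: ypoly) * (ys ^ (r - 1) * fps_shift j ys)"
    by (simp add: fps_of_nat mult.assoc)
  then show ?thesis
    using arg_cong[OF fmap_sderiv_ys_pow[of j r], of "\<lambda>F. fps_nth F s"] by simp
qed

lemma X_pow_mult_fps_shift:
  "fps_X ^ j * fps_shift j (F :: 'a::comm_ring_1 fps) = F - fps_cutoff j F"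
  by (rule fps_ext) (simp add: fps_X_power_mult_nth)

text \<open>The sum over q of \<open>z^q\<close> times \<open>fps_shift (q + j) ys\<close>: the
  index \<open>N\<close> is split into q and a remainder in \<open>N + 1\<close> ways. It collects
  the terms \<open>h t^(q+j)\<close> that \<open>x t^j\<close> produces.\<close>

definition gser :: "nat \<Rightarrow> ypoly fps" where
  "gser j = Abs_fps (\<lambda>N. of_nat (N + 1) * yv (N + j))"

lemma convolution_shift_sum:
  fixes V :: "ypoly fps"
  shows "(\<Sum>q\<le>k. fps_nth (V * fps_shift (q + j) ys) (k - q)) = fps_nth (V * gser j) k"
proof -
  have "(\<Sum>q\<le>k. fps_nth (V * fps_shift (q + j) ys) (k - q)) =
      (\<Sum>q\<le>k. \<Sum>i\<le>k - q. fps_nth V i * yv (k - i + j))"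
    unfolding fps_mult_nth atLeast0AtMost
    by (intro sum.cong refl) (auto intro!: arg_cong[of _ _ yv])
  also have "\<dots> = (\<Sum>i\<le>k. \<Sum>q\<le>k - i. fps_nth V i * yv (k - i + j))"
    unfolding sum.Sigma[OF finite_atMost ballI, OF finite_atMost]
    by (rule sum.reindex_bij_witness[of _ "\<lambda>(i, q). (q, i)" "\<lambda>(q, i). (i, q)"]) auto
  also have "\<dots> = fps_nth (V * gser j) k"
    unfolding fps_mult_nth atLeast0AtMost
    by (intro sum.cong refl) (simp add: gser_def algebra_simps)
  finally show ?thesis .
qed

lemma xop_ys_mult:
  "fps_nth (fmap (xop n j) (ys * U)) k = fps_nth (ys * fmap (xop n j) U) k +
     (\<Sum>q\<le>k. hop n (q + j) (fps_nth U (k - q)))"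
  by (simp add: fps_mult_nth xop_sum xop_var sum.distrib atLeast0AtMost)

lemma hop_ys_pow_sum:
  "(\<Sum>q\<le>k. hop n (q + j) (fps_nth (ys ^ r) (k - q))) =
     (if j = 0 then of_nat n * fps_nth (ys ^ r) k else 0) -
     2 * of_nat r * fps_nth (ys ^ (r - 1) * gser j) k"
proof -
  have "(\<Sum>q\<le>k. hop n (q + j) (fps_nth (ys ^ r) (k - q))) =
    (\<Sum>q\<le>k. if q + j = 0 then of_nat n * fps_nth (ys ^ r) (k - q) else 0) -
    2 * of_nat r * (\<Sum>q\<le>k. fps_nth (ys ^ (r - 1) * fps_shift (q + j) ys) (k - q))"
    by (simp add: hop_def sum_subtractf sum_distrib_left sderiv_ys_pow mult.assoc)
  also have "(\<Sum>q\<le>k. if q + j = 0 then of_nat n * fps_nth (ys ^ r) (k - q) else 0) =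
      (\<Sum>q\<in>{0}. if j = 0 then of_nat n * fps_nth (ys ^ r) (k - q) else 0)"
    by (rule sum.mono_neutral_cong_right) auto
  finally show ?thesis
    by (simp add: convolution_shift_sum)
qed

text \<open>Each factor contributes \<open>n\<close> if \<open>j = 0\<close>, and twice the number
  of factors to its right. This accounts for \<open>(r + 1) n\<close> and for
  \<open>0 + 2 + ... + 2 r = (r + 1) r\<close>.\<close>

lemma xop_ys_pow_Suc:
  "fmap (xop n j) (ys ^ Suc r) =
     (if j = 0 then of_nat (Suc r * n) * ys ^ r else 0) - of_nat (Suc r * r) * (ys ^ (r - 1) * gser j)"
proof (induction r)
  case 0
  show ?case
    by (rule fps_ext) (use xop_var[of n j _ 1] in \<open>simp add: hop_1 fps_of_nat[symmetric]\<close>)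
next
  case (Suc r)
  \<comment> \<open>As constant series the scalars pass through \<open>fps_nth\<close>.\<close>
  define c where "c = (\<lambda>k. fps_const (of_nat k :: ypoly))"
  have c: "of_nat k = c k" for k by (simp add: c_def fps_of_nat)
  have "fmap (xop n j) (ys * ys ^ Suc r) = ys * fmap (xop n j) (ys ^ Suc r) +
      ((if j = 0 then c n * ys ^ Suc r else 0) - c 2 * c (Suc r) * (ys ^ (Suc r - 1) * gser j))"
  proof (rule fps_ext)
    fix k
    show "fps_nth (fmap (xop n j) (ys * ys ^ Suc r)) k = fps_nth (ys * fmap (xop n j) (ys ^ Suc r) +
      ((if j = 0 then c n * ys ^ Suc r else 0) - c 2 * c (Suc r) * (ys ^ (Suc r - 1) * gser j))) k"
      unfolding xop_ys_mult hop_ys_pow_sum by (simp add: c_def mult.assoc del: of_nat_Suc power_Suc)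
  qed
  also have "ys * fmap (xop n j) (ys ^ Suc r) = (if j = 0 then of_nat (Suc r * n) * ys ^ Suc r else 0) -
      of_nat (Suc r * r) * (ys ^ r * gser j)"
    by (subst Suc) (cases r; simp add: algebra_simps)
  finally show ?case
    by (simp add: c[symmetric] algebra_simps)
qed

text \<open>On the left the coefficient of \<open>z^p\<close> is \<open>(p + 1 - j) y_p\<close>, so
  the series is \<open>z d/dz + 1 - j\<close> applied to \<open>y(z)\<close>, freed of the terms
  with \<open>p < j\<close>.\<close>

lemma gser_shift:
  "fps_X ^ j * gser j = fps_X * fps_deriv ys + (1 - of_nat j) * ys -
     fps_cutoff j (fps_X * fps_deriv ys + (1 - of_nat j) * ys)"
  by (rule fps_ext) (auto simp: gser_def fps_X_power_mult_nth of_nat_diff algebra_simps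
      fps_of_nat[symmetric] not_less le_Suc_eq)

text \<open>The coefficient at \<open>p = j - 1\<close> vanishes, so this error series already stops
  below \<open>j - 1\<close>; for \<open>j = 1\<close> it is zero. The extra degree is what
  \<open>xop_gen_fusion_ideal\<close> lives on.\<close>

definition rser :: "nat \<Rightarrow> ypoly fps" where
  "rser j = fps_cutoff j (fps_X * fps_deriv ys + (1 - of_nat j) * ys)"

lemma rser_nth: "fps_nth (rser j) p = (if p < j then (of_nat p + 1 - of_nat j) * yv p else 0)"
  by (cases p) (auto simp: rser_def algebra_simps fps_of_nat[symmetric])

lemma X_deriv_pow: "of_nat r * (ys ^ (r - 1) * (fps_X * fps_deriv ys)) = fps_X * fps_deriv (ys ^ r)"
  by (simp add: fps_deriv_power fps_of_nat algebra_simps)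

text \<open>The key formula: at the level of generating functions the raising operators act on powers of
  \<open>y(z)\<close> by first-order differential operators in \<open>z\<close>, up to terms of index below \<open>j\<close>.\<close>

lemma xop_ys_pow:
  "xop n j (fps_nth (ys ^ Suc r) s) = of_nat (Suc r) *
     ((if j = 0 then of_nat n * fps_nth (ys ^ r) s else 0) -
      (of_nat (s + j) + of_nat r * (1 - of_nat j)) * fps_nth (ys ^ r) (s + j) +
      of_nat r * fps_nth (ys ^ (r - 1) * rser j) (s + j))"
proof -
  define c where "c = (\<lambda>k. fps_const (of_nat k :: ypoly))"
  have c: "of_nat k = c k" for k by (simp add: c_def fps_of_nat)
  have cn: "fps_nth (c k * F) i = of_nat k * fps_nth F i" for k i F by (simp add: c_def)
  have "xop n j (fps_nth (ys ^ Suc r) s) = fps_nth (fmap (xop n j) (ys ^ Suc r)) s"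
    by simp
  also have "\<dots> = of_nat (Suc r) * ((if j = 0 then of_nat n * fps_nth (ys ^ r) s else 0) -
      of_nat r * fps_nth (ys ^ (r - 1) * gser j) s)"
  proof -
    have e: "fps_nth (of_nat k * F) i = of_nat k * fps_nth F i" for k i and F :: "ypoly fps"
      by (simp add: c cn)
    show ?thesis
      unfolding xop_ys_pow_Suc of_nat_mult mult.assoc
      by (cases "j = 0") (simp_all only: fps_sub_nth e if_True if_False, simp_all add: algebra_simps)
  qed
  \<comment> \<open>Multiplication by \<open>z^j\<close> moves the index from \<open>s\<close> to
    \<open>s + j\<close> and makes \<open>gser_shift\<close> applicable.\<close>
  also have "of_nat r * fps_nth (ys ^ (r - 1) * gser j) s =
      fps_nth (fps_X ^ j * (of_nat r * (ys ^ (r - 1) * gser j))) (s + j)"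
    by (simp add: fps_X_power_mult_nth c cn)
  also have "fps_X ^ j * (of_nat r * (ys ^ (r - 1) * gser j)) =
      of_nat r * ys ^ (r - 1) * (fps_X ^ j * gser j)"
    by (simp add: algebra_simps)
  also have "\<dots> = of_nat r * (ys ^ (r - 1) * (fps_X * fps_deriv ys)) +
      (1 - of_nat j) * (of_nat r * (ys ^ (r - 1) * ys)) - of_nat r * (ys ^ (r - 1) * rser j)"
    unfolding gser_shift rser_def by (simp add: algebra_simps)
  also have "of_nat r * (ys ^ (r - 1) * ys) = of_nat r * ys ^ r"
    by (cases r) (simp_all add: mult.commute)
  also have "fps_nth (of_nat r * (ys ^ (r - 1) * (fps_X * fps_deriv ys)) +
      (1 - of_nat j) * (of_nat r * ys ^ r) - of_nat r * (ys ^ (r - 1) * rser j)) (s + j) =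
      (of_nat (s + j) + of_nat r * (1 - of_nat j)) * fps_nth (ys ^ r) (s + j) -
      of_nat r * fps_nth (ys ^ (r - 1) * rser j) (s + j)"
  proof -
    have 1: "fps_nth (fps_X * fps_deriv (ys ^ r)) k = of_nat k * fps_nth (ys ^ r) k" for k
      by (cases k) (simp_all add: fps_of_nat[symmetric])
    have 2: "fps_nth ((1 - of_nat j) * F) k = (1 - of_nat j) * fps_nth F k" for F :: "ypoly fps" and k
      by (simp add: left_diff_distrib c cn)
    have 3: "fps_nth (of_nat r * F) k = of_nat r * fps_nth F k" for F :: "ypoly fps" and k
      by (simp add: c cn)
    show ?thesis
      unfolding X_deriv_pow fps_add_nth fps_sub_nth 1 2 3 by (simp add: algebra_simps)
  qed
  finally show ?thesis by (simp add: algebra_simps)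
qed

text \<open>Up to a nonzero scalar, \<open>x t\<close> trades one factor \<open>y(z)\<close> for one
  unit of the index. This drives Garland's identity.\<close>

lemma xop1_ys_pow:
  "xop n 1 (fps_nth (ys ^ Suc r) s) = - of_nat (Suc r * Suc s) * fps_nth (ys ^ r) (Suc s)"
proof -
  have "rser 1 = 0" by (rule fps_ext) (simp add: rser_nth)
  then show ?thesis unfolding xop_ys_pow by (simp add: algebra_simps)
qed

lemma keys_ys_pow: "M \<in> Poly_Mapping.keys (fps_nth (ys ^ r) s) \<Longrightarrow> size M = r \<and> sum_mset M = s"
proof (induction r arbitrary: M s)
  case 0
  then show ?case by (auto simp: fps_one_nth split: if_splits simp flip: zero_multiset_def)
next
  case (Suc r)
  from Suc.prems have "M \<in> Poly_Mapping.keys (\<Sum>i\<le>s. yv i * fps_nth (ys ^ r) (s - i))"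
    by (simp add: fps_mult_nth atLeast0AtMost)
  then obtain i where i: "i \<le> s" "M \<in> Poly_Mapping.keys (yv i * fps_nth (ys ^ r) (s - i))"
    by (metis (no_types, lifting) Poly_Mapping.keys_sum UN_E atMost_iff subsetD)
  then obtain N where "M = {#i#} + N" "N \<in> Poly_Mapping.keys (fps_nth (ys ^ r) (s - i))"
    using keys_mult[of "yv i" "fps_nth (ys ^ r) (s - i)"] by (auto simp: yv_def mon_def)
  with Suc.IH[of N "s - i"] i show ?case by auto
qed

section \<open>The ideals of relations\<close>

definition is_ideal :: "ypoly set \<Rightarrow> bool" where
  "is_ideal A \<longleftrightarrow> pm.subspace A \<and> (\<forall>u\<in>A. \<forall>j. yv j * u \<in> A)"

definition submod :: "nat \<Rightarrow> ypoly set \<Rightarrow> bool" where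
  "submod n A \<longleftrightarrow> is_ideal A \<and> (\<forall>u\<in>A. \<forall>j. hop n j u \<in> A \<and> xop n j u \<in> A)"

lemma ideal_subspace: "is_ideal A \<Longrightarrow> pm.subspace A"
  by (simp add: is_ideal_def)

lemma submod_ideal: "submod n A \<Longrightarrow> is_ideal A"
  by (simp add: submod_def)

lemma submod_subspace: "submod n A \<Longrightarrow> pm.subspace A"
  by (simp add: submod_def is_ideal_def)

lemma ideal_mult: "is_ideal A \<Longrightarrow> u \<in> A \<Longrightarrow> v * u \<in> A"
  by (induction v rule: ypoly_induct)
    (auto simp: is_ideal_def distrib_right mult.assoc intro: pm.subspace_add pm.subspace_scale)

lemma ideal_mult_right: "is_ideal A \<Longrightarrow> u \<in> A \<Longrightarrow> u * v \<in> A"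
  by (metis ideal_mult mult.commute)

lemma ideal_ops:
  assumes "is_ideal A"
  shows "0 \<in> A" "u \<in> A \<Longrightarrow> v \<in> A \<Longrightarrow> u + v \<in> A" "u \<in> A \<Longrightarrow> v \<in> A \<Longrightarrow> u - v \<in> A"
    "u \<in> A \<Longrightarrow> - u \<in> A" "(\<And>i. i \<in> I \<Longrightarrow> f i \<in> A) \<Longrightarrow> sum f I \<in> A"
    "u \<in> A \<Longrightarrow> smul c u \<in> A"
  using assms
  by (auto simp: is_ideal_def intro: pm.subspace_0 pm.subspace_add pm.subspace_diff pm.subspace_sum
      pm.subspace_neg pm.subspace_scale)

lemma ideal_cong:
  assumes "is_ideal A" "u - v \<in> A"
  shows "u \<in> A \<longleftrightarrow> v \<in> A"
  using ideal_ops(2)[OF assms(1) assms(2), of v] ideal_ops(3)[OF assms(1) _ assms(2), of u] by auto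

lemma ideal_of_nat_cancel:
  assumes "is_ideal A" "of_nat k * u \<in> A" "k > 0"
  shows "u \<in> A"
proof -
  have "smul (inverse (of_nat k)) (of_nat k * u) = u"
    using \<open>k > 0\<close> by (simp flip: smul_of_nat)
  then show ?thesis using ideal_ops(6)[OF assms(1,2)] by metis
qed

lemma mon_replicate: "mon (replicate_mset b K) = yv K ^ b"
  by (induction b) (simp_all flip: yv_mult_mon)

lemma ideal_mon: "is_ideal A \<Longrightarrow> mon N \<in> A \<Longrightarrow> N \<subseteq># M \<Longrightarrow> mon M \<in> A"
  by (metis ideal_mult_right mon_mult mset_subset_eq_exists_conv)

lemma ideal_var_mon: "is_ideal A \<Longrightarrow> yv p \<in> A \<Longrightarrow> p \<in># M \<Longrightarrow> mon M \<in> A"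
  by (simp add: ideal_mon yv_def)

lemma ideal_colon: "is_ideal A \<Longrightarrow> is_ideal {u. u * v \<in> A}"
  by (auto simp: is_ideal_def pm.subspace_def distrib_right mult.assoc)

inductive_set idl :: "ypoly set \<Rightarrow> ypoly set" for G where
  idl_0: "0 \<in> idl G"
| idl_gen: "g \<in> G \<Longrightarrow> g \<in> idl G"
| idl_add: "u \<in> idl G \<Longrightarrow> v \<in> idl G \<Longrightarrow> u + v \<in> idl G"
| idl_smul: "u \<in> idl G \<Longrightarrow> smul c u \<in> idl G"
| idl_var: "u \<in> idl G \<Longrightarrow> yv q * u \<in> idl G"

lemma ideal_idl: "is_ideal (idl G)"
  by (auto simp: is_ideal_def pm.subspace_def intro: idl.intros)

lemma idl_least: "is_ideal A \<Longrightarrow> G \<subseteq> A \<Longrightarrow> idl G \<subseteq> A"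
proof
  fix u assume A: "is_ideal A" "G \<subseteq> A" "u \<in> idl G"
  from A(3) show "u \<in> A"
    by induction (use A in \<open>auto simp: ideal_ops ideal_mult\<close>)
qed

text \<open>The number of boxes in the first \<open>r\<close> columns of the diagram with rows
  \<open>M\<close>; equivalently the minimum over k of \<open>r k\<close> plus the sum of all but
  the k largest parts.\<close>

definition minsum :: "nat multiset \<Rightarrow> nat \<Rightarrow> nat" where
  "minsum M r = (\<Sum>x\<in>#M. min x r)"

lemma minsum_simps [simp]:
  "minsum {#} r = 0" "minsum (add_mset x M) r = min x r + minsum M r"
  "minsum (M + N) r = minsum M r + minsum N r"
  by (simp_all add: minsum_def)

lemma minsum_mono: "r \<le> r' \<Longrightarrow> minsum M r \<le> minsum M r'"
  by (induction M) (auto simp: min_def)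

lemma minsum_le_size: "minsum M r \<le> size M * r"
  by (induction M) (auto simp: min_def)

lemma minsum_le_sum: "minsum M r \<le> sum_mset M"
  by (induction M) (auto simp: min_def)

lemma minsum_ge: "(\<And>x. x \<in># M \<Longrightarrow> r \<le> x) \<Longrightarrow> minsum M r = size M * r"
  by (induction M) auto

lemma minsum_le: "(\<And>x. x \<in># M \<Longrightarrow> x \<le> r) \<Longrightarrow> minsum M r = sum_mset M"
  by (induction M) auto

text \<open>With \<open>\<C>[y]\<close> acting on the generator, this is the annihilator in the module \<open>V(\<xi>)\<close> of
  Chari and Venkatesh whose partition \<open>\<xi>\<close> has parts \<open>M\<close>; zero parts are allowed.\<close>

definition fusion_ideal :: "nat multiset \<Rightarrow> ypoly set" where
  "fusion_ideal M = idl {fps_nth (ys ^ r) s | r s. minsum M r < s + r}"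

lemma ideal_fusion_ideal: "is_ideal (fusion_ideal M)"
  by (simp add: fusion_ideal_def ideal_idl)

lemma fusion_ideal_gen: "minsum M r < s + r \<Longrightarrow> fps_nth (ys ^ r) s \<in> fusion_ideal M"
  unfolding fusion_ideal_def by (rule idl_gen) auto

lemma fusion_ideal_least:
  assumes "is_ideal A" "\<And>r s. minsum M r < s + r \<Longrightarrow> fps_nth (ys ^ r) s \<in> A"
  shows "fusion_ideal M \<subseteq> A"
  unfolding fusion_ideal_def using assms by (intro idl_least) auto

text \<open>If \<open>W\<close> uses an index below \<open>j\<close>, then \<open>V\<close> has to
  use an index above \<open>s\<close> to reach \<open>s + j\<close>.\<close>

lemma ideal_cutoff_coeff:
  assumes "is_ideal A" "\<And>i. s < i \<Longrightarrow> fps_nth V i \<in> A" "\<And>p. j \<le> p \<Longrightarrow> fps_nth W p = 0"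
  shows "fps_nth (V * W) (s + j) \<in> A"
  unfolding fps_mult_nth
proof (rule ideal_ops(5)[OF assms(1)])
  fix i
  show "fps_nth V i * fps_nth W (s + j - i) \<in> A"
  proof (cases "s < i")
    case True
    then show ?thesis by (simp add: assms ideal_mult_right)
  next
    case False
    then have "fps_nth W (s + j - i) = 0" by (intro assms) auto
    then show ?thesis by (simp add: ideal_ops(1)[OF assms(1)])
  qed
qed

text \<open>Up to \<open>z^j\<close> the shifted series is \<open>y(z)\<close> minus its first j
  terms. The main part just raises the index to \<open>s + j\<close>. In the other part one factor
  \<open>y(z)\<close> is lost, but the index exceeds \<open>s\<close>, and \<open>minsum\<close>
  does not grow when \<open>r\<close> decreases.\<close>

lemma sderiv_gen_fusion_ideal:
  assumes "minsum M r < s + r"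
  shows "sderiv j (fps_nth (ys ^ r) s) \<in> fusion_ideal M"
proof (cases r)
  case 0
  then show ?thesis by (simp add: sderiv_ys_pow ideal_ops(1)[OF ideal_fusion_ideal])
next
  case (Suc r')
  have "fps_nth (ys ^ r' * fps_shift j ys) s = fps_nth (ys ^ r' * (fps_X ^ j * fps_shift j ys)) (s + j)"
    by (simp add: fps_X_power_mult_nth mult.left_commute)
  also have "\<dots> = fps_nth (ys ^ r) (s + j) - fps_nth (ys ^ r' * fps_cutoff j ys) (s + j)"
    unfolding X_pow_mult_fps_shift Suc right_diff_distrib by (simp add: mult.commute)
  also have "\<dots> \<in> fusion_ideal M"
  proof (intro ideal_ops[OF ideal_fusion_ideal] ideal_cutoff_coeff[OF ideal_fusion_ideal] fusion_ideal_gen)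
    show "minsum M r < s + j + r" using assms by simp
    fix i assume "s < i"
    then show "minsum M r' < i + r'"
      using assms Suc minsum_mono[of r' r M] by simp
  qed auto
  finally show ?thesis
    unfolding sderiv_ys_pow by (simp add: Suc ideal_mult[OF ideal_fusion_ideal] del: of_nat_Suc)
qed

text \<open>Serves the case \<open>j = 0\<close> of the next lemma, where \<open>r\<close> drops by
  one at fixed \<open>s\<close>: either the bound drops too, or it has already reached the total
  weight.\<close>

lemma minsum_Suc_cases: "minsum M r < minsum M (Suc r) \<or> minsum M (Suc r) = sum_mset M"
proof (cases "\<forall>x\<in>#M. x \<le> Suc r")
  case True
  then show ?thesis by (simp add: minsum_le)
next
  case False
  then obtain x N where "M = add_mset x N" "Suc r < x"
    by (metis mset_add not_le)
  then show ?thesis using minsum_mono[of r "Suc r" N] by simp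
qed

text \<open>For \<open>j = 0\<close> the result is a multiple of the coefficient for
  \<open>r - 1\<close> by \<open>n - s - (r - 1)\<close>, n being the sum of the parts; either that
  coefficient is again a generator or the scalar vanishes. For \<open>j > 0\<close> the gain in the
  index compensates for the lost factors.\<close>

lemma xop_gen_fusion_ideal:
  assumes "minsum M r < s + r"
  shows "xop (sum_mset M) j (fps_nth (ys ^ r) s) \<in> fusion_ideal M"
proof (cases r)
  case 0
  then show ?thesis using assms
    by (cases "s = 0") (simp_all add: fps_one_nth ideal_ops(1)[OF ideal_fusion_ideal])
next
  case (Suc r')
  have mono: "minsum M r' < i + r'" if "s < i" for i
    using assms Suc minsum_mono[of r' r M] that by simp
  show ?thesis
  proof (cases "j = 0")
    case True
    have "rser 0 = 0" by (rule fps_ext) (simp add: rser_nth)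
    then have eq: "xop (sum_mset M) j (fps_nth (ys ^ r) s) =
        of_nat r * ((of_nat (sum_mset M) - of_nat (s + r')) * fps_nth (ys ^ r') s)"
      unfolding Suc xop_ys_pow True by (simp add: algebra_simps)
    consider "minsum M r' < s + r'" | "s + r' = sum_mset M"
      using minsum_Suc_cases[of M r'] minsum_le_sum[of M r'] assms unfolding Suc by linarith
    then show ?thesis
    proof cases
      case 1
      then show ?thesis unfolding eq by (intro ideal_mult[OF ideal_fusion_ideal] fusion_ideal_gen)
    next
      case 2
      then show ?thesis unfolding eq by (simp add: ideal_ops(1)[OF ideal_fusion_ideal])
    qed
  next
    case False
    \<comment> \<open>Two factors \<open>y(z)\<close> are gone, so the index must exceed
      \<open>s + 1\<close>; it does because \<open>rser j\<close> stops below \<open>j - 1\<close>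
      and not merely below \<open>j\<close>.\<close>
    have "fps_nth (ys ^ (r' - 1) * rser j) (s + 1 + (j - 1)) \<in> fusion_ideal M" if "r' \<noteq> 0"
    proof (rule ideal_cutoff_coeff[OF ideal_fusion_ideal])
      fix i assume "s + 1 < i"
      then show "fps_nth (ys ^ (r' - 1)) i \<in> fusion_ideal M"
        using that Suc assms minsum_mono[of "r' - 1" r M] by (intro fusion_ideal_gen) linarith
    next
      fix p assume "j - 1 \<le> p"
      then show "fps_nth (rser j) p = 0"
        using False by (cases "p = j - 1") (auto simp: rser_nth of_nat_diff)
    qed
    then have 1: "of_nat r' * fps_nth (ys ^ (r' - 1) * rser j) (s + j) \<in> fusion_ideal M"
      using False by (cases "r' = 0") (simp_all add: ideal_mult[OF ideal_fusion_ideal] ideal_ops(1)[OF ideal_fusion_ideal])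
    have 2: "fps_nth (ys ^ r') (s + j) \<in> fusion_ideal M"
      using False by (intro fusion_ideal_gen mono) simp
    show ?thesis unfolding Suc xop_ys_pow
      by (intro ideal_ops[OF ideal_fusion_ideal] ideal_mult[OF ideal_fusion_ideal] 1 2)
        (simp add: False ideal_ops(1)[OF ideal_fusion_ideal])
  qed
qed

text \<open>It is enough to look at generators, since commutators with the variables stay inside.
  For \<open>x\<close> the commutator is \<open>h\<close>, which is why both closures are proved in
  one induction.\<close>

lemma submod_fusion_ideal: "submod (sum_mset M) (fusion_ideal M)"
proof -
  have "hop (sum_mset M) j u \<in> fusion_ideal M" "xop (sum_mset M) j u \<in> fusion_ideal M"
    if "u \<in> fusion_ideal M" for j u
  proof -
    have "\<forall>j. sderiv j u \<in> fusion_ideal M \<and> xop (sum_mset M) j u \<in> fusion_ideal M"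
      using that[unfolded fusion_ideal_def]
    proof (induction rule: idl.induct)
      case (idl_var u q)
      then have "u \<in> fusion_ideal M" by (simp add: fusion_ideal_def)
      with idl_var show ?case
        by (auto simp: xop_var hop_def intro!: ideal_ops[OF ideal_fusion_ideal] ideal_mult[OF ideal_fusion_ideal])
    qed (auto simp: ideal_ops[OF ideal_fusion_ideal] sderiv_gen_fusion_ideal xop_gen_fusion_ideal)
    with that show "hop (sum_mset M) j u \<in> fusion_ideal M" "xop (sum_mset M) j u \<in> fusion_ideal M"
      by (auto simp: hop_def intro!: ideal_ops[OF ideal_fusion_ideal] ideal_mult[OF ideal_fusion_ideal])
  qed
  then show ?thesis by (auto simp: submod_def ideal_fusion_ideal)
qed

lemma var_fusion_ideal: "size M \<le> p \<Longrightarrow> yv p \<in> fusion_ideal M"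
  using fusion_ideal_gen[of M 1 p] minsum_le_size[of M 1] by simp

lemma sum_mset_le_count:
  "(\<And>p. p \<in># M \<Longrightarrow> p \<le> Suc k) \<Longrightarrow> sum_mset M \<le> k * size M + count M (Suc k)"
proof (induction M)
  case (add x M)
  then have "sum_mset M \<le> k * size M + count M (Suc k)" "x \<le> Suc k" by auto
  then show ?case by (cases "x = Suc k") auto
qed simp

text \<open>A monomial with \<open>r\<close> factors, all of index at most \<open>k + 1\<close>, and
  total index at least \<open>k r + j\<close> contains at least \<open>j\<close> factors of index
  \<open>k + 1\<close>.\<close>

lemma ys_pow_in_ideal:
  assumes A: "is_ideal A" and "\<And>p. Suc k < p \<Longrightarrow> yv p \<in> A" "yv (Suc k) ^ j \<in> A" "k * r + j \<le> t"
  shows "fps_nth (ys ^ r) t \<in> A"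
proof (rule mon_in_subspaceD[OF ideal_subspace[OF A]])
  fix M assume "M \<in> Poly_Mapping.keys (fps_nth (ys ^ r) t)"
  then have M: "size M = r" "sum_mset M = t" using keys_ys_pow by auto
  show "mon M \<in> A"
  proof (cases "\<exists>p\<in>#M. Suc k < p")
    case True
    then show ?thesis using assms ideal_var_mon by blast
  next
    case False
    then have "t \<le> k * r + count M (Suc k)"
      using sum_mset_le_count[of M k] M by (auto simp: not_less)
    with assms(4) have "replicate_mset j (Suc k) \<subseteq># M"
      by (simp flip: count_le_replicate_mset_subset_eq)
    then show ?thesis using assms(3) ideal_mon[OF A, of "replicate_mset j (Suc k)"]
      by (simp add: mon_replicate)
  qed
qed

text \<open>Modulo the variables above \<open>K\<close>, a product of \<open>j\<close> variables has
  total index at most \<open>K j\<close>, attained only by the power of \<open>y_K\<close>.\<close>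

lemma ys_pow_top_coeff:
  assumes A: "is_ideal A" and hi: "\<And>p. K < p \<Longrightarrow> yv p \<in> A"
  shows "fps_nth (ys ^ j) (K * j) - yv K ^ j \<in> A"
proof (induction j)
  case 0
  then show ?case by (simp add: ideal_ops[OF A])
next
  case (Suc j)
  let ?f = "\<lambda>i. yv i * fps_nth (ys ^ j) (K * Suc j - i)"
  have "fps_nth (ys ^ Suc j) (K * Suc j) = (\<Sum>i\<in>{0..K * Suc j}. ?f i)"
    by (simp add: fps_mult_nth)
  also have "\<dots> = ?f K + (\<Sum>i\<in>{0..K * Suc j} - {K}. ?f i)"
    by (intro sum.remove) auto
  finally have eq: "fps_nth (ys ^ Suc j) (K * Suc j) - yv K ^ Suc j =
      yv K * (fps_nth (ys ^ j) (K * j) - yv K ^ j) + (\<Sum>i\<in>{0..K * Suc j} - {K}. ?f i)"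
    by (simp add: algebra_simps)
  have "?f i \<in> A" if "i \<noteq> K" "i \<le> K * Suc j" for i
  proof (cases "K < i")
    case True
    then show ?thesis by (simp add: A hi ideal_mult_right)
  next
    case False
    have "fps_nth (ys ^ j) (K * Suc j - i) \<in> A"
      by (rule ys_pow_in_ideal[OF A, of K 1]) (use False that in \<open>auto simp: hi\<close>)
    then show ?thesis by (simp add: A ideal_mult)
  qed
  then have "(\<Sum>i\<in>{0..K * Suc j} - {K}. ?f i) \<in> A"
    by (intro ideal_ops(5)[OF A]) auto
  then show ?case unfolding eq by (rule ideal_ops(2)[OF A ideal_mult[OF A Suc]])
qed

section \<open>Highest weight vectors modulo an ideal\<close>

definition highest_weight_mod :: "nat \<Rightarrow> nat \<Rightarrow> ypoly set \<Rightarrow> ypoly \<Rightarrow> bool" where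
  "highest_weight_mod n w A v \<longleftrightarrow>
     (\<forall>j. hop n j v - (if j = 0 then of_nat w * v else 0) \<in> A \<and> xop n j v \<in> A)"

text \<open>Modulo \<open>A\<close>, multiplication by \<open>v\<close> intertwines the universal
  actions of weights \<open>w\<close> and \<open>n\<close>. The rules \<open>hop_var\<close> and
  \<open>xop_var\<close> look alike for both weights, so a discrepancy that lies in \<open>A\<close>
  at the generator stays in \<open>A\<close>.\<close>

lemma highest_weight_mod_mult:
  assumes "is_ideal A" "highest_weight_mod n w A v"
  shows "hop n j (u * v) - hop w j u * v \<in> A" "xop n j (u * v) - xop w j u * v \<in> A"
proof (induction u arbitrary: j rule: ypoly_induct)
  case one
  {
    case 1
    show ?case using assms(2)[unfolded highest_weight_mod_def, rule_format, of j]
      by (cases "j = 0") (simp_all add: hop_1)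
  next
    case 2
    show ?case using assms by (simp add: highest_weight_mod_def)
  }
next
  case (var q u)
  {
    case 1
    have "hop n j (yv q * u * v) - hop w j (yv q * u) * v =
        yv q * (hop n j (u * v) - hop w j u * v)"
      by (simp add: hop_var mult.assoc) (simp add: algebra_simps)
    then show ?case using var by (simp add: ideal_mult assms)
  next
    case 2
    have "xop n j (yv q * u * v) - xop w j (yv q * u) * v =
        yv q * (xop n j (u * v) - xop w j u * v) + (hop n (q + j) (u * v) - hop w (q + j) u * v)"
      by (simp add: xop_var mult.assoc) (simp add: algebra_simps)
    then show ?case using var by (simp add: ideal_mult ideal_ops assms)
  }
next
  case (add u u')
  {
    case 1
    show ?case using ideal_ops(2)[OF assms(1) add(1)[of j] add(3)[of j]]
      by (simp add: algebra_simps)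
  next
    case 2
    show ?case using ideal_ops(2)[OF assms(1) add(2)[of j] add(4)[of j]]
      by (simp add: algebra_simps)
  }
next
  case (smul c u)
  {
    case 1
    show ?case using ideal_ops(6)[OF assms(1) smul(1)[of j], of c]
      by (simp add: pm.scale_right_diff_distrib)
  next
    case 2
    show ?case using ideal_ops(6)[OF assms(1) smul(2)[of j], of c]
      by (simp add: pm.scale_right_diff_distrib)
  }
qed

text \<open>The kernel of this intertwining map.\<close>

lemma submod_colon:
  assumes "submod n A" "highest_weight_mod n w A v"
  shows "submod w {u. u * v \<in> A}"
proof -
  note A = submod_ideal[OF assms(1)]
  have "hop w j u * v \<in> A \<and> xop w j u * v \<in> A" if "u * v \<in> A" for u j
    using that assms(1) highest_weight_mod_mult[OF A assms(2)]
    by (metis A ideal_cong submod_def)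
  then show ?thesis by (simp add: submod_def ideal_colon[OF A])
qed

lemma sderiv_yv [simp]: "sderiv j (yv q) = yv (q + j)"
  using sderiv_var[of j q 1] by simp

lemma sderiv_var_pow: "sderiv j (yv K ^ b) = of_nat b * (yv (K + j) * yv K ^ (b - 1))"
proof (induction b)
  case (Suc b)
  then show ?case by (cases b) (simp_all add: ring_distribs mult.left_commute)
qed simp

text \<open>For \<open>j > 0\<close> the operator \<open>h t^j\<close> pushes an index beyond
  \<open>K\<close>, and \<open>x t^j\<close> creates \<open>h t^(K+j)\<close>, whose scalar part is
  excluded by \<open>K > 0\<close>. What remains is \<open>h\<close>, with its eigenvalue lowered by
  2 for each factor.\<close>

lemma highest_weight_mod_top_power:
  assumes A: "is_ideal A" and "\<And>p. K < p \<Longrightarrow> yv p \<in> A" "K > 0"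
  shows "highest_weight_mod (w + 2 * b) w A (yv K ^ b)"
proof -
  have hi: "yv p * u \<in> A" if "K < p" for p u
    using that assms ideal_mult_right by blast
  have sderiv: "sderiv j (yv K ^ b) - (if j = 0 then of_nat b * yv K ^ b else 0) \<in> A" for j b
  proof (cases "j = 0")
    case True
    have "sderiv 0 (yv K ^ b) = of_nat b * yv K ^ b"
      unfolding sderiv_var_pow by (cases b) simp_all
    with True show ?thesis by (simp add: ideal_ops(1)[OF A])
  next
    case False
    then show ?thesis
      using ideal_mult[OF A hi[of "K + j"]] by (simp add: sderiv_var_pow)
  qed
  have dr': "sderiv j (yv K ^ b) \<in> A" if "j > 0" for j b
    using sderiv[of j b] that by simp
  have "hop (w + 2 * b) j (yv K ^ b) - (if j = 0 then of_nat w * yv K ^ b else 0) \<in> A" for j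
    using ideal_mult[OF A sderiv[of j b], of "-2"]
    by (cases "j = 0") (simp_all add: hop_def algebra_simps)
  moreover have "xop n j (yv K ^ b) \<in> A" for n j
  proof (induction b)
    case 0
    then show ?case by (simp add: ideal_ops[OF A])
  next
    case (Suc b)
    have "hop n (K + j) (yv K ^ b) \<in> A"
      using assms(3) dr'[of "K + j" b] by (simp add: hop_def ideal_ops[OF A] ideal_mult[OF A])
    with Suc show ?case by (simp add: xop_var ideal_ops[OF A] ideal_mult[OF A])
  qed
  ultimately show ?thesis by (simp add: highest_weight_mod_def)
qed

text \<open>Garland's identity, together with the fact that a nilpotent lowering operator on a highest
  weight vector of weight \<open>w\<close> vanishes to the power \<open>w + 1\<close>.\<close>

lemma garland:
  assumes C: "submod w C" "yv 0 ^ N \<in> C" and "w < s + r"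
  shows "fps_nth (ys ^ r) s \<in> C"
proof -
  note I = submod_ideal[OF C(1)]
  have xop: "u \<in> C \<Longrightarrow> xop w j u \<in> C" for j u using C(1) by (simp add: submod_def)
  \<comment> \<open>Applying x to the power \<open>m + 1\<close> of \<open>y_0\<close> gives
    \<open>(m + 1)(w - m)\<close> times the power \<open>m\<close>, and the scalar is nonzero as
    long as \<open>m > w\<close>.\<close>
  have down: "yv 0 ^ (Suc w + i) \<in> C \<Longrightarrow> yv 0 ^ Suc w \<in> C" for i
  proof (induction i)
    case (Suc i)
    have "rser 0 = 0" by (rule fps_ext) (simp add: rser_nth)
    then have "xop w 0 (fps_nth (ys ^ Suc (Suc w + i)) 0) =
        - (of_nat (Suc (Suc w + i)) * (of_nat (Suc i) * yv 0 ^ (Suc w + i)))"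
      unfolding xop_ys_pow by (simp add: algebra_simps fps_power_zeroth)
    moreover have "xop w 0 (fps_nth (ys ^ Suc (Suc w + i)) 0) \<in> C"
      using xop Suc.prems by (simp add: fps_power_zeroth)
    ultimately have "of_nat (Suc (Suc w + i)) * (of_nat (Suc i) * yv 0 ^ (Suc w + i)) \<in> C"
      using ideal_ops(4)[OF I] by (metis minus_minus)
    then show ?case using ideal_of_nat_cancel[OF I] Suc.IH zero_less_Suc by metis
  qed simp
  have up: "u ^ i \<in> C \<Longrightarrow> i \<le> l \<Longrightarrow> u ^ l \<in> C" for u i l
    by (metis I ideal_mult_right le_add_diff_inverse power_add)
  have "yv 0 ^ (Suc w + N) \<in> C" by (rule up[OF C(2)]) simp
  then have "yv 0 ^ Suc w \<in> C" by (rule down)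
  then have 0: "yv 0 ^ (s + r) \<in> C" by (rule up) (use assms in simp)
  \<comment> \<open>Starting from \<open>y_0^(s+r)\<close>, each application of \<open>x t\<close>
    removes one factor and raises the index by one.\<close>
  have "fps_nth (ys ^ (s + r - i)) i \<in> C" if "i \<le> s + r" for i
    using that
  proof (induction i)
    case 0
    show ?case using \<open>yv 0 ^ (s + r) \<in> C\<close> by (simp add: fps_power_zeroth)
  next
    case (Suc i)
    then have "s + r - i = Suc (s + r - Suc i)" by simp
    with Suc have "xop w 1 (fps_nth (ys ^ Suc (s + r - Suc i)) i) \<in> C"
      by (intro xop) auto
    then have "of_nat (Suc (s + r - Suc i) * Suc i) * fps_nth (ys ^ (s + r - Suc i)) (Suc i) \<in> C"
      unfolding xop1_ys_pow using ideal_ops(4)[OF I] by (metis minus_minus minus_mult_left)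
    then show ?case by (rule ideal_of_nat_cancel[OF I]) simp
  qed
  from this[of s] show ?thesis by simp
qed

section \<open>The exact sequences and the upper bound for the dimension\<close>

definition index_shift :: "nat \<Rightarrow> ypoly \<Rightarrow> ypoly" where
  "index_shift k = lin (\<lambda>M. mon (image_mset (\<lambda>p. p + k) M))"

lemma plinear_index_shift: "plinear (index_shift k)"
  unfolding index_shift_def by (rule plinear_lin)

lemmas index_shift_add [simp] = plinear_add[OF plinear_index_shift]
  and index_shift_smul [simp] = plinear_scale[OF plinear_index_shift]
  and index_shift_0 [simp] = plinear_0[OF plinear_index_shift]
  and index_shift_sum = plinear_sum[OF plinear_index_shift]

lemma index_shift_1 [simp]: "index_shift k 1 = 1"
  by (simp add: index_shift_def flip: mon_empty)

lemma index_shift_var: "index_shift k (yv q * u) = yv (q + k) * index_shift k u"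
proof -
  have "plinear (\<lambda>u. index_shift k (yv q * u))" "plinear (\<lambda>u. yv (q + k) * index_shift k u)"
    by (auto intro!: plinearI simp: algebra_simps)
  then show ?thesis
    by (rule plinear_eqI) (simp add: index_shift_def yv_mult_mon)
qed

lemma index_shift_mult: "index_shift k (u * v) = index_shift k u * index_shift k v"
  by (induction u rule: ypoly_induct) (simp_all add: index_shift_var mult.assoc distrib_right)

lemma index_shift_var_pow: "index_shift k (yv q ^ b) = yv (q + k) ^ b"
  by (induction b) (simp_all add: index_shift_var)

lemma index_shift_ys_pow: "index_shift k (fps_nth (ys ^ r) s) = fps_nth (fps_shift k ys ^ r) s"
proof (induction r arbitrary: s)
  case (Suc r)
  then show ?case by (simp add: fps_mult_nth index_shift_sum index_shift_var)
qed (simp add: fps_one_nth)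

lemma low_pow_nth:
  fixes W :: "'a::comm_ring_1 fps"
  assumes "\<And>p. k \<le> p \<Longrightarrow> fps_nth W p = 0" "fps_nth (W ^ j) t \<noteq> 0"
  shows "t + j \<le> k * j"
  using assms(2)
proof (induction j arbitrary: t)
  case 0
  then show ?case by (simp add: fps_one_nth split: if_splits)
next
  case (Suc j)
  from Suc.prems have "(\<Sum>i = 0..t. fps_nth W i * fps_nth (W ^ j) (t - i)) \<noteq> 0"
    by (simp add: fps_mult_nth)
  then obtain i where "i \<in> {0..t}" and i: "fps_nth W i * fps_nth (W ^ j) (t - i) \<noteq> 0"
    by (rule sum.not_neutral_contains_not_neutral)
  then have "i \<le> t" by simp
  from i have nz: "fps_nth W i \<noteq> 0" "fps_nth (W ^ j) (t - i) \<noteq> 0" by auto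
  have "i < k" using nz(1) assms(1)[of i] by (metis not_le)
  moreover have "t - i + j \<le> k * j" using nz(2) by (rule Suc.IH)
  moreover have "k * Suc j = k + k * j" by simp
  ultimately show ?case using \<open>i \<le> t\<close> by linarith
qed

lemma ideal_mult_nth:
  assumes "is_ideal A" "\<And>a. a \<le> t \<Longrightarrow> fps_nth W (t - a) \<noteq> 0 \<Longrightarrow> fps_nth V a \<in> A"
  shows "fps_nth (V * W) t \<in> A"
  unfolding fps_mult_nth
proof (rule ideal_ops(5)[OF assms(1)])
  fix a assume "a \<in> {0..t}"
  then show "fps_nth V a * fps_nth W (t - a) \<in> A"
    using assms by (cases "fps_nth W (t - a) = 0") (auto simp: ideal_ops(1) ideal_mult_right)
qed

lemma ideal_binomial:
  assumes "is_ideal A" "\<And>i. i \<le> r \<Longrightarrow> fps_nth (V ^ i * W ^ (r - i)) t \<in> A"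
  shows "fps_nth ((V + W) ^ r) t \<in> A"
proof -
  have "fps_nth (of_nat (r choose i) * V ^ i * W ^ (r - i)) t =
      of_nat (r choose i) * fps_nth (V ^ i * W ^ (r - i)) t" for i
    by (simp add: mult.assoc fps_of_nat[symmetric])
  then show ?thesis
    by (auto simp: binomial_ring fps_sum_nth assms intro!: ideal_ops(5)[OF assms(1)] ideal_mult[OF assms(1)])
qed

text \<open>Up to a power of z, the substituted series is \<open>y(z)\<close> minus its first
  \<open>size L\<close> terms. In the binomial expansion each of these low factors consumes at most
  \<open>size L - 1\<close> of the index, while the new parts \<open>L\<close> raise the bound for
  the remaining power \<open>i\<close> by at most \<open>size L * i\<close>.\<close>

lemma index_shift_fusion_ideal:
  assumes "u \<in> fusion_ideal M"
  shows "index_shift (size L) u \<in> fusion_ideal (M + L)"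
proof -
  let ?k = "size L" and ?A = "fusion_ideal (M + L)"
  let ?W = "- fps_cutoff ?k ys"
  have "is_ideal {u. index_shift ?k u \<in> ?A}"
    using ideal_fusion_ideal[of "M + L"]
    by (auto simp: is_ideal_def pm.subspace_def index_shift_var)
  moreover have "index_shift ?k (fps_nth (ys ^ r) s) \<in> ?A" if rs: "minsum M r < s + r" for r s
  proof -
    have "index_shift ?k (fps_nth (ys ^ r) s) = fps_nth ((fps_X ^ ?k) ^ r * fps_shift ?k ys ^ r) (s + ?k * r)"
      by (simp add: index_shift_ys_pow fps_X_power_mult_nth flip: power_mult)
    also have "\<dots> = fps_nth ((ys + ?W) ^ r) (s + ?k * r)"
      by (simp add: X_pow_mult_fps_shift flip: power_mult_distrib)
    also have "\<dots> \<in> ?A"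
    proof (intro ideal_binomial[OF ideal_fusion_ideal] ideal_mult_nth[OF ideal_fusion_ideal] fusion_ideal_gen)
      fix i a assume i: "i \<le> r" "a \<le> s + ?k * r" "fps_nth (?W ^ (r - i)) (s + ?k * r - a) \<noteq> 0"
      have "s + ?k * r - a + (r - i) \<le> ?k * (r - i)"
        by (rule low_pow_nth[OF _ i(3)]) simp
      then have "s + ?k * r + (r - i) \<le> ?k * (r - i) + a" by linarith
      moreover have "?k * (r - i) + ?k * i = ?k * r"
        using i(1) by (simp flip: distrib_left)
      ultimately have "s + r + ?k * i \<le> a + i" using i(1) by linarith
      moreover have "minsum (M + L) i \<le> minsum M r + ?k * i"
        using minsum_mono[OF i(1), of M] minsum_le_size[of L i] by simp
      ultimately show "minsum (M + L) i < a + i" using rs by linarith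
    qed
    finally show ?thesis .
  qed
  ultimately have "fusion_ideal M \<subseteq> {u. index_shift ?k u \<in> ?A}"
    by (intro fusion_ideal_least) auto
  then show ?thesis using assms by auto
qed

lemma top_power_fusion_ideal:
  assumes "size M = Suc K" "minsum M j < K * j + j"
  shows "yv K ^ j \<in> fusion_ideal M"
  using ys_pow_top_coeff[OF ideal_fusion_ideal[of M], of K j] var_fusion_ideal[of M] assms
    ideal_cong[OF ideal_fusion_ideal] fusion_ideal_gen[of M j "K * j"] by auto

text \<open>The annihilator of \<open>y_K^b\<close> is a submodule of weight \<open>w\<close> that
  contains a power of \<open>y_0\<close>, so \<open>garland\<close> applies to it.\<close>

lemma fusion_ideal_colon_weight:
  assumes "size M = Suc K" "K > 0" "sum_mset M = w + 2 * b" "w < s + r"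
  shows "fps_nth (ys ^ r) s * yv K ^ b \<in> fusion_ideal M"
proof -
  have "submod w {u. u * yv K ^ b \<in> fusion_ideal M}"
    using submod_fusion_ideal[of M] highest_weight_mod_top_power[OF ideal_fusion_ideal[of M], of K w b] var_fusion_ideal[of M] assms
    by (intro submod_colon[of "w + 2 * b"]) auto
  moreover have "yv 0 ^ Suc (sum_mset M) \<in> fusion_ideal M"
    using fusion_ideal_gen[of M "Suc (sum_mset M)" 0] minsum_le_sum[of M "Suc (sum_mset M)"]
    by (simp add: fps_power_zeroth)
  ultimately show ?thesis
    using garland[of w "{u. u * yv K ^ b \<in> fusion_ideal M}" "Suc (sum_mset M)" s r] assms
    by (auto intro: ideal_mult_right[OF ideal_fusion_ideal])
qed

text \<open>For small \<open>r\<close> every monomial of the coefficient contains an index of at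
  least \<open>size N + 1\<close>, and such variables annihilate the given power. For large
  \<open>r\<close> the parts exceeding \<open>r\<close> only shift indices, and for the remaining
  ones the bound is a total weight, which \<open>fusion_ideal_colon_weight\<close> attains.\<close>

lemma fusion_ideal_colon:
  assumes N: "\<And>x. x \<in># N \<Longrightarrow> a \<le> x" and b: "b \<le> a" "b > 0"
  shows "fusion_ideal (add_mset (a - b) N) \<subseteq>
    {u. u * yv (Suc (size N)) ^ b \<in> fusion_ideal (add_mset a (add_mset b N))}"
proof (rule fusion_ideal_least)
  let ?K = "Suc (size N)" and ?M = "add_mset a (add_mset b N)"
  let ?C = "{u. u * yv ?K ^ b \<in> fusion_ideal ?M}"
  note A = ideal_fusion_ideal[of ?M]
  show C: "is_ideal ?C" by (rule ideal_colon[OF A])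
  fix r s assume rs: "minsum (add_mset (a - b) N) r < s + r"
  show "fps_nth (ys ^ r) s \<in> ?C"
  proof (cases "r \<le> a - b")
    case True
    with N have "minsum N r = size N * r"
      by (intro minsum_ge) fastforce
    with rs True have s: "size N * r + 1 \<le> s" by simp
    have "minsum ?M (Suc b) \<le> Suc b + b + size N * Suc b"
      using minsum_le_size[of N "Suc b"] by simp
    then have "yv ?K ^ Suc b \<in> fusion_ideal ?M"
      by (intro top_power_fusion_ideal) simp_all
    then have "yv ?K ^ 1 \<in> ?C" by simp
    moreover have "yv p \<in> ?C" if "?K < p" for p
      using that ideal_mult_right[OF A var_fusion_ideal[of ?M p]] by simp
    ultimately show ?thesis
      using ys_pow_in_ideal[OF C _ _ s] by blast
  next
    case False
    \<comment> \<open>The minimum with \<open>r\<close> is \<open>r\<close> on \<open>L\<close> and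
      the part itself elsewhere. Thus the bound is \<open>size L * r + w\<close>: the weight bound
      for \<open>M'\<close> after a shift of all indices by \<open>size L\<close>.\<close>
    define L where "L = filter_mset (\<lambda>x. r < x) N"
    define N' where "N' = filter_mset (\<lambda>x. \<not> r < x) N"
    define M' where "M' = add_mset a (add_mset b N')"
    define w where "w = sum_mset N' + (a - b)"
    let ?k = "size L" and ?K' = "Suc (size N')"
    have N_eq: "N = N' + L" by (auto simp: L_def N'_def multiset_partition add.commute)
    have K: "?K = ?K' + ?k" by (simp add: N_eq)
    have "minsum L r = ?k * r" by (rule minsum_ge) (auto simp: L_def)
    moreover have "minsum N' r = sum_mset N'" by (rule minsum_le) (auto simp: N'_def)
    ultimately have rs': "?k * r + w < s + r"
      using rs False by (simp add: N_eq w_def)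
    let ?lo = "fps_cutoff ?k ys" and ?hi = "fps_X ^ ?k * fps_shift ?k ys"
    \<comment> \<open>The powers of \<open>?hi\<close> carry the shifted relations; a factor
      \<open>?lo\<close> has degree below \<open>size L\<close> and cannot use up more of the index
      than the bound allows for it.\<close>
    have "fps_nth ((?hi + ?lo) ^ r) s \<in> ?C"
    proof (intro ideal_binomial[OF C] ideal_mult_nth[OF C])
      fix i c assume i: "i \<le> r" "c \<le> s" "fps_nth (?lo ^ (r - i)) (s - c) \<noteq> 0"
      show "fps_nth (?hi ^ i) c \<in> ?C"
      proof (cases "?k * i \<le> c")
        case True
        have "s - c + (r - i) \<le> ?k * (r - i)"
          by (rule low_pow_nth[OF _ i(3)]) simp
        moreover have "?k * (r - i) + ?k * i = ?k * r"
          using i(1) by (simp flip: distrib_left)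
        ultimately have "w < c - ?k * i + i" using rs' i(1,2) True by linarith
        then have "fps_nth (ys ^ i) (c - ?k * i) * yv ?K' ^ b \<in> fusion_ideal M'"
          using b by (intro fusion_ideal_colon_weight[of _ _ w]) (auto simp: M'_def w_def)
        from index_shift_fusion_ideal[OF this, of L]
        have "fps_nth (fps_shift ?k ys ^ i) (c - ?k * i) * yv ?K ^ b \<in> fusion_ideal ?M"
          by (simp add: index_shift_mult index_shift_ys_pow index_shift_var_pow K M'_def N_eq)
        with True show ?thesis
          by (simp add: power_mult_distrib fps_X_power_mult_nth flip: power_mult)
      qed (simp add: power_mult_distrib fps_X_power_mult_nth ideal_ops(1)[OF A] flip: power_mult)
    qed
    then show ?thesis by (simp add: X_pow_mult_fps_shift)
  qed
qed

text \<open>The bounds of the two multisets differ only for \<open>b \<le> r \<le> a\<close>, and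
  then by one. There all parts of \<open>N\<close> are at least \<open>r\<close>, so each monomial
  of an additional relation contains the power \<open>b\<close> of the top variable or a variable of
  higher index.\<close>

lemma fusion_ideal_raise:
  assumes N: "\<And>x. x \<in># N \<Longrightarrow> a \<le> x" and b: "b \<le> a" "b > 0"
  shows "fusion_ideal (add_mset (Suc a) (add_mset (b - 1) N)) =
    {u + p * yv (Suc (size N)) ^ b | u p. u \<in> fusion_ideal (add_mset a (add_mset b N))}"
    (is "fusion_ideal ?M' = ?A'")
proof
  let ?K = "Suc (size N)" and ?M = "add_mset a (add_mset b N)"
  note A = ideal_fusion_ideal[of ?M]
  have A': "is_ideal ?A'"
    unfolding is_ideal_def pm.subspace_def
  proof (intro conjI ballI allI)
    show "0 \<in> ?A'" by (rule CollectI) (rule exI[of _ 0], rule exI[of _ 0], simp add: ideal_ops(1)[OF A])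
  next
    fix x y assume "x \<in> ?A'" "y \<in> ?A'"
    then obtain u p v q where "x = u + p * yv ?K ^ b" "y = v + q * yv ?K ^ b"
      "u \<in> fusion_ideal ?M" "v \<in> fusion_ideal ?M" by blast
    then have "x + y = (u + v) + (p + q) * yv ?K ^ b" "u + v \<in> fusion_ideal ?M"
      by (auto simp: algebra_simps ideal_ops[OF A])
    then show "x + y \<in> ?A'" by blast
  next
    fix c x assume "x \<in> ?A'"
    then obtain u p where "x = u + p * yv ?K ^ b" "u \<in> fusion_ideal ?M" by blast
    then have "smul c x = smul c u + smul c p * yv ?K ^ b" "smul c u \<in> fusion_ideal ?M"
      by (auto simp: pm.scale_right_distrib ideal_ops[OF A])
    then show "smul c x \<in> ?A'" by blast
  next
    fix x j assume "x \<in> ?A'"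
    then obtain u p where "x = u + p * yv ?K ^ b" "u \<in> fusion_ideal ?M" by blast
    then have "yv j * x = yv j * u + (yv j * p) * yv ?K ^ b" "yv j * u \<in> fusion_ideal ?M"
      by (auto simp: distrib_left mult.assoc ideal_mult[OF A])
    then show "yv j * x \<in> ?A'" by blast
  qed
  have sub: "fusion_ideal ?M \<subseteq> ?A'"
  proof
    fix u assume "u \<in> fusion_ideal ?M"
    moreover have "u = u + 0 * yv ?K ^ b" by simp
    ultimately show "u \<in> ?A'" by blast
  qed
  have "yv ?K ^ b = 0 + 1 * yv ?K ^ b" by simp
  then have vA': "yv ?K ^ b \<in> ?A'" using ideal_ops(1)[OF A] by blast
  show "fusion_ideal ?M' \<subseteq> ?A'"
  proof (rule fusion_ideal_least[OF A'])
    fix r s assume rs: "minsum ?M' r < s + r"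
    show "fps_nth (ys ^ r) s \<in> ?A'"
    proof (cases "minsum ?M r < s + r")
      case True
      then show ?thesis using sub fusion_ideal_gen by blast
    next
      case False
      with rs b have r: "b \<le> r" "r \<le> a" by (auto simp: min_def split: if_splits)
      then have "minsum N r = size N * r" using N by (intro minsum_ge) fastforce
      with rs r b have s: "size N * r + b \<le> s" by auto
      show ?thesis
        by (rule ys_pow_in_ideal[OF A' _ vA' s], rule subsetD[OF sub], rule var_fusion_ideal) simp
    qed
  qed
  show "?A' \<subseteq> fusion_ideal ?M'"
  proof -
    note A1 = ideal_fusion_ideal[of ?M']
    have "fusion_ideal ?M \<subseteq> fusion_ideal ?M'"
    proof (rule fusion_ideal_least[OF A1], rule fusion_ideal_gen)
      fix r s assume "minsum ?M r < s + r"
      moreover have "minsum ?M' r \<le> minsum ?M r" using b by auto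
      ultimately show "minsum ?M' r < s + r" by linarith
    qed
    moreover have "yv ?K ^ b \<in> fusion_ideal ?M'"
    proof (rule top_power_fusion_ideal)
      show "minsum ?M' b < ?K * b + b" using b minsum_le_size[of N b] by auto
    qed simp
    ultimately have "u + p * yv ?K ^ b \<in> fusion_ideal ?M'" if "u \<in> fusion_ideal ?M" for u p
      using that by (intro ideal_ops(2)[OF A1] ideal_mult[OF A1]) auto
    then show ?thesis by blast
  qed
qed

section \<open>Spanning sets and the upper bound\<close>

definition spanning :: "nat multiset set \<Rightarrow> ypoly set \<Rightarrow> bool" where
  "spanning E A \<longleftrightarrow> pm.span (mon ` E \<union> A) = UNIV"

text \<open>A spanning set of the quotient together with translates of one for the submodule. An
  inclusion for \<open>C\<close> suffices, which is all that is known at this stage.\<close>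

lemma spanning_step:
  assumes A: "is_ideal A" and E1: "spanning E1 {u + p * mon V | u p. u \<in> A}"
    and E2: "spanning E2 C" and C: "C \<subseteq> {u. u * mon V \<in> A}"
  shows "spanning (E1 \<union> (\<lambda>M. M + V) ` E2) A"
proof -
  let ?W = "pm.span (mon ` (E1 \<union> (\<lambda>M. M + V) ` E2) \<union> A)"
  have "p * mon V \<in> ?W" for p
  proof -
    have "p \<in> pm.span (mon ` E2 \<union> C)" using E2 by (simp add: spanning_def)
    then show ?thesis
    proof (induction rule: pm.span_induct)
      case base
      show ?case by (auto simp: pm.subspace_def distrib_right intro: pm.span_zero pm.span_add pm.span_scale)
    next
      case (step x)
      then show ?case using C by (auto simp: mon_mult intro!: pm.span_base)
    qed
  qed
  then have "mon ` E1 \<union> {u + p * mon V | u p. u \<in> A} \<subseteq> ?W"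
    by (auto intro!: pm.span_add intro: pm.span_base)
  then have "pm.span (mon ` E1 \<union> {u + p * mon V | u p. u \<in> A}) \<subseteq> ?W"
    by (rule pm.span_minimal) (rule pm.subspace_span)
  with E1 show ?thesis by (auto simp: spanning_def)
qed

text \<open>The dimension of the tensor product of the simple sl2-modules whose highest weights are
  the parts.\<close>

definition fusion_dim :: "nat multiset \<Rightarrow> nat" where
  "fusion_dim M = (\<Prod>x\<in>#M. Suc x)"

lemma fusion_dim_simps [simp]: "fusion_dim {#} = 1" "fusion_dim (add_mset x M) = Suc x * fusion_dim M"
  by (simp_all add: fusion_dim_def)

lemma fusion_ideal_add_0: "fusion_ideal (add_mset 0 M) = fusion_ideal M"
  by (simp add: fusion_ideal_def)

lemma fusion_ideal_single_spanning: "spanning ((\<lambda>i. replicate_mset i 0) ` {..n}) (fusion_ideal {#n#})"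
proof -
  have "mon M \<in> pm.span (mon ` (\<lambda>i. replicate_mset i 0) ` {..n} \<union> fusion_ideal {#n#})" for M
  proof (cases "\<exists>p\<in>#M. p > 0")
    case True
    then obtain p where "p \<in># M" "1 \<le> p" by auto
    then have "mon M \<in> fusion_ideal {#n#}"
      using ideal_var_mon[OF ideal_fusion_ideal var_fusion_ideal[of "{#n#}" p]] by auto
    then show ?thesis by (simp add: pm.span_base)
  next
    case False
    have M: "M = replicate_mset (size M) 0"
    proof (rule set_mset_subset_singletonD)
      show "set_mset M \<subseteq> {0}" using False by auto
    qed
    show ?thesis
    proof (cases "size M \<le> n")
      case True
      with M show ?thesis by (metis (no_types, lifting) UnI1 atMost_iff image_eqI pm.span_base)
    next
      case False
      then have "fps_nth (ys ^ size M) 0 \<in> fusion_ideal {#n#}" by (intro fusion_ideal_gen) auto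
      then have "mon M \<in> fusion_ideal {#n#}" by (subst M) (simp add: mon_replicate fps_power_zeroth)
      then show ?thesis by (simp add: pm.span_base)
    qed
  qed
  then show ?thesis unfolding spanning_def
    by (metis (no_types, lifting) UNIV_eq_I mon_in_subspaceD pm.subspace_span)
qed

definition small_spanning :: "nat multiset \<Rightarrow> bool" where
  "small_spanning M \<longleftrightarrow> (\<exists>E. finite E \<and> card E \<le> fusion_dim M \<and> spanning E (fusion_ideal M))"

lemma small_spanning_step:
  assumes N: "\<And>x. x \<in># N \<Longrightarrow> a \<le> x" and b: "b \<le> a" "b > 0"
    and ub1: "small_spanning (add_mset (Suc a) (add_mset (b - 1) N))" and ub2: "small_spanning (add_mset (a - b) N)"
  shows "small_spanning (add_mset a (add_mset b N))"
proof -
  let ?V = "replicate_mset b (Suc (size N))"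
  obtain E1 where E1: "finite E1" "card E1 \<le> fusion_dim (add_mset (Suc a) (add_mset (b - 1) N))"
    "spanning E1 (fusion_ideal (add_mset (Suc a) (add_mset (b - 1) N)))"
    using ub1 unfolding small_spanning_def by blast
  obtain E2 where E2: "finite E2" "card E2 \<le> fusion_dim (add_mset (a - b) N)"
    "spanning E2 (fusion_ideal (add_mset (a - b) N))"
    using ub2 unfolding small_spanning_def by blast
  let ?E = "E1 \<union> (\<lambda>M. M + ?V) ` E2"
  have "spanning ?E (fusion_ideal (add_mset a (add_mset b N)))"
    using E1(3) E2(3) fusion_ideal_colon[OF N b] fusion_ideal_raise[OF N b]
    by (intro spanning_step[OF ideal_fusion_ideal]) (auto simp: mon_replicate)
  moreover have "card ?E \<le> fusion_dim (add_mset a (add_mset b N))"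
  proof -
    have "card ?E \<le> card E1 + card E2"
      by (meson E2(1) add_mono card_Un_le card_image_le le_refl le_trans)
    also have "\<dots> \<le> Suc (Suc a) * (b * fusion_dim N) + Suc (a - b) * fusion_dim N"
      using E1(2) E2(2) b by simp
    also have "\<dots> = (Suc (Suc a) * b + Suc (a - b)) * fusion_dim N"
      by (simp add: algebra_simps)
    also have "Suc (Suc a) * b + Suc (a - b) = Suc a * Suc b"
      using b by simp
    also have "\<dots> * fusion_dim N = fusion_dim (add_mset a (add_mset b N))"
      by (simp only: fusion_dim_simps mult.assoc)
    finally show ?thesis .
  qed
  ultimately show ?thesis unfolding small_spanning_def
    by (intro exI[of _ ?E] conjI) (use E1(1) E2(1) in simp_all)
qed

text \<open>Outer induction on the number of parts, inner induction on the smallest part b. One end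
  term has the same number of parts and smallest part \<open>b - 1\<close>, the other has one part
  fewer. Parts 0 are dropped, and a single part is treated directly.\<close>

lemma small_spanning_fusion_ideal: "small_spanning M"
proof (induction "size M" arbitrary: M)
  case 0
  then show ?case
    using fusion_ideal_single_spanning[of 0] by (auto simp: small_spanning_def fusion_ideal_add_0 intro!: exI[of _ "{{#}}"])
next
  case (Suc k)
  have *: "small_spanning (add_mset b M')" if "size M' = k" "\<And>x. x \<in># M' \<Longrightarrow> b \<le> x" for b M'
    using that
  proof (induction b arbitrary: M')
    case 0
    then show ?case using Suc.hyps(1)[of M'] by (simp add: small_spanning_def fusion_ideal_add_0)
  next
    case (Suc b)
    show ?case
    proof (cases "k = 0")
      case True
      with Suc.prems have "M' = {#}" by simp
      moreover have "card ((\<lambda>i. replicate_mset i 0 :: nat multiset) ` {..Suc b}) \<le> Suc (Suc b)"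
        using card_image_le[of "{..Suc b}"] by simp
      ultimately show ?thesis
        using fusion_ideal_single_spanning[of "Suc b"] unfolding small_spanning_def
        by (intro exI[of _ "(\<lambda>i. replicate_mset i 0) ` {..Suc b}"]) auto
    next
      case False
      with Suc.prems have ne: "M' \<noteq> {#}" by auto
      define a where "a = Min (set_mset M')"
      have a: "a \<in># M'" unfolding a_def by (rule Min_in) (use ne in auto)
      then obtain N where M': "M' = add_mset a N" by (metis mset_add)
      have N: "a \<le> x" if "x \<in># N" for x
      proof -
        from that have "x \<in># M'" by (subst M') simp
        then show ?thesis unfolding a_def by simp
      qed
      have ab: "Suc b \<le> a" using Suc.prems(2)[OF a] .
      have 1: "small_spanning (add_mset (Suc a) (add_mset b N))"
      proof -
        have "small_spanning (add_mset b (add_mset (Suc a) N))"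
          using Suc.prems ab N by (intro Suc.IH) (fastforce simp: M')+
        then show ?thesis by (simp add: add_mset_commute)
      qed
      have 2: "small_spanning (add_mset (a - Suc b) N)"
        using Suc.prems by (intro Suc.hyps(1)) (simp add: M')
      show ?thesis
        using small_spanning_step[OF N ab _ _ 2] 1 by (simp add: M' add_mset_commute)
    qed
  qed
  define b where "b = Min (set_mset M)"
  from Suc.hyps(2) have "M \<noteq> {#}" by auto
  then have "b \<in># M" unfolding b_def by (intro Min_in) auto
  then obtain M' where M': "M = add_mset b M'" by (metis mset_add)
  have "b \<le> x" if "x \<in># M'" for x
  proof -
    from that have "x \<in># M" by (subst M') simp
    then show ?thesis unfolding b_def by simp
  qed
  with * Suc.hyps(2) show ?case by (simp add: M')
qed

section \<open>The lower bound for the dimension\<close>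

lemma independent_mon: "pm.independent (mon ` B)"
  unfolding pm.dependent_def
proof clarify
  fix M assume "M \<in> B" "mon M \<in> pm.span (mon ` B - {mon M})"
  moreover have "pm.span (mon ` B - {mon M}) \<subseteq> {u. Poly_Mapping.lookup u M = 0}"
  proof (rule pm.span_minimal)
    show "mon ` B - {mon M} \<subseteq> {u. Poly_Mapping.lookup u M = 0}"
      by (auto simp: mon_def lookup_single when_def)
    show "pm.subspace {u. Poly_Mapping.lookup u M = 0}"
      by (auto simp: pm.subspace_def lookup_add)
  qed
  ultimately show False by (auto simp: mon_def)
qed

lemma inj_mon: "inj mon"
  by (rule injI) (use keys_single in \<open>metis mon_def singleton_inject zero_neq_one\<close>)

lemma lookup_var_mult:
  "Poly_Mapping.lookup (yv q * u) M = (if q \<in># M then Poly_Mapping.lookup u (M - {#q#}) else 0)"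
proof (induction u rule: pm_induct)
  case (mon N)
  have "add_mset q N = M \<longleftrightarrow> q \<in># M \<and> N = M - {#q#}"
    by auto
  then show ?case by (auto simp: yv_mult_mon) (auto simp: mon_def lookup_single when_def)
qed (auto simp: distrib_left lookup_add)

section \<open>Evaluation at the points 0, ..., m - 1\<close>

context
  fixes m :: nat
begin

definition geom :: "nat \<Rightarrow> complex fps" where
  "geom j = Abs_fps (\<lambda>p. of_nat j ^ p)"

lemma geom_nth: "fps_nth (geom j) p = of_nat j ^ p"
  by (simp add: geom_def)

lemma geom_mult: "(1 - fps_const (of_nat j) * fps_X) * geom j = 1"
proof (rule fps_ext)
  fix n
  show "fps_nth ((1 - fps_const (of_nat j) * fps_X) * geom j) n = fps_nth 1 n"
    by (cases n) (simp_all add: geom_def algebra_simps)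
qed

text \<open>The action of \<open>y t^p\<close> on a tensor product of evaluation modules at these
  points; on the right \<open>yv j\<close> stands for y on the j-th factor. By
  \<open>0 ^ 0 = 1\<close> the point 0 takes part for \<open>p = 0\<close>.\<close>

definition ev :: "nat \<Rightarrow> ypoly" where
  "ev p = (\<Sum>j<m. smul (of_nat j ^ p) (yv j))"

definition phi :: "ypoly \<Rightarrow> ypoly" where
  "phi = lin (\<lambda>M. \<Prod>p\<in>#M. ev p)"

lemma plinear_phi: "plinear phi"
  unfolding phi_def by (rule plinear_lin)

lemmas phi_add = plinear_add[OF plinear_phi]
  and phi_smul = plinear_scale[OF plinear_phi]
  and phi_sum = plinear_sum[OF plinear_phi]

lemma phi_1: "phi 1 = 1"
  by (simp add: phi_def flip: mon_empty)

lemma phi_var: "phi (yv q * u) = ev q * phi u"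
proof -
  have "plinear (\<lambda>u. phi (yv q * u))" "plinear (\<lambda>u. ev q * phi u)"
    by (auto intro!: plinearI simp: phi_add phi_smul algebra_simps)
  then show ?thesis
    by (rule plinear_eqI) (simp add: phi_def yv_mult_mon)
qed

lemma phi_mult: "phi (u * v) = phi u * phi v"
  by (induction u rule: ypoly_induct)
    (simp_all add: phi_1 phi_var phi_add phi_smul mult.assoc distrib_right)

text \<open>Expanding the \<open>r\<close>-th power of the sum of the \<open>y\<^sub>j / (1 - j z)\<close>; the constants
  \<open>\<alpha> M\<close> are multinomial coefficients, whose values do not matter.\<close>

lemma lookup_phi_ys_pow:
  "\<exists>\<alpha> :: nat multiset \<Rightarrow> complex. (\<forall>M. size M \<noteq> r \<longrightarrow> \<alpha> M = 0) \<and> (\<forall>s M. Poly_Mapping.lookup (phi (fps_nth (ys ^ r) s)) M =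
     \<alpha> M * fps_nth (\<Prod>j\<in>#M. geom j) s)"
proof (induction r)
  case 0
  show ?case
    by (intro exI[of _ "\<lambda>M. if M = {#} then 1 else 0"])
      (auto simp: fps_one_nth phi_1 plinear_0[OF plinear_phi] lookup_one when_def)
next
  case (Suc r)
  then obtain \<alpha> :: "nat multiset \<Rightarrow> complex" where \<alpha>: "\<And>M. size M \<noteq> r \<Longrightarrow> \<alpha> M = 0"
    "\<And>s M. Poly_Mapping.lookup (phi (fps_nth (ys ^ r) s)) M = \<alpha> M * fps_nth (\<Prod>j\<in>#M. geom j) s"
    by blast
  define \<beta> where "\<beta> M = (\<Sum>j<m. if j \<in># M then \<alpha> (M - {#j#}) else 0)" for M
  have "\<beta> M = 0" if "size M \<noteq> Suc r" for M
    unfolding \<beta>_def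
  proof (rule sum.neutral, intro ballI)
    fix j
    have "\<alpha> (M - {#j#}) = 0" if "j \<in># M"
    proof -
      from that obtain N where "M = add_mset j N" by (metis mset_add)
      with \<open>size M \<noteq> Suc r\<close> \<alpha>(1)[of N] show ?thesis by simp
    qed
    then show "(if j \<in># M then \<alpha> (M - {#j#}) else 0) = 0" by simp
  qed
  moreover have "Poly_Mapping.lookup (phi (fps_nth (ys ^ Suc r) s)) M =
      \<beta> M * fps_nth (\<Prod>j\<in>#M. geom j) s" for s M
  proof -
    have "Poly_Mapping.lookup (phi (fps_nth (ys ^ Suc r) s)) M =
        (\<Sum>i\<in>{0..s}. \<Sum>j<m. of_nat j ^ i * (if j \<in># M then
          \<alpha> (M - {#j#}) * fps_nth (\<Prod>j\<in>#M - {#j#}. geom j) (s - i) else 0))"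
      by (simp add: fps_mult_nth phi_sum phi_var ev_def sum_distrib_right lookup_sum
          lookup_var_mult \<alpha>(2) cong: if_cong)
    also have "\<dots> = (\<Sum>j<m. \<Sum>i\<in>{0..s}. of_nat j ^ i * (if j \<in># M then
          \<alpha> (M - {#j#}) * fps_nth (\<Prod>j\<in>#M - {#j#}. geom j) (s - i) else 0))"
      by (rule sum.swap)
    also have "\<dots> = (\<Sum>j<m. (if j \<in># M then \<alpha> (M - {#j#}) else 0) * fps_nth (\<Prod>j\<in>#M. geom j) s)"
    proof (rule sum.cong[OF refl])
      fix j
      show "(\<Sum>i\<in>{0..s}. of_nat j ^ i * (if j \<in># M then
          \<alpha> (M - {#j#}) * fps_nth (\<Prod>j\<in>#M - {#j#}. geom j) (s - i) else 0)) =
          (if j \<in># M then \<alpha> (M - {#j#}) else 0) * fps_nth (\<Prod>j\<in>#M. geom j) s"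
      proof (cases "j \<in># M")
        case True
        then obtain N where "M = add_mset j N" by (metis mset_add)
        then show ?thesis
          by (simp add: fps_mult_nth geom_nth sum_distrib_left mult.left_commute)
      qed simp
    qed
    also have "\<dots> = \<beta> M * fps_nth (\<Prod>j\<in>#M. geom j) s"
      by (simp add: \<beta>_def sum_distrib_right)
    finally show ?thesis .
  qed
  ultimately show ?case by (intro exI[of _ \<beta>]) blast
qed

text \<open>Lagrange interpolation: a polynomial in t that is 1 at the point j and 0 at the others
  isolates the j-th factor.\<close>

lemma ev_interpolation: "j < m \<Longrightarrow> \<exists>u. phi u = yv j"
proof -
  assume j: "j < m"
  define R :: "complex poly" where "R = (\<Prod>i\<in>{..<m} - {j}. [:- of_nat i, 1:])"
  have R0: "poly R (of_nat i) = 0" if "i < m" "i \<noteq> j" for i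
    using that by (simp add: R_def poly_prod)
  have Rj: "poly R (of_nat j) \<noteq> 0"
    by (auto simp: R_def poly_prod)
  define L where "L = Polynomial.smult (inverse (poly R (of_nat j))) R"
  have L: "poly L (of_nat i) = (if i = j then 1 else 0)" if "i < m" for i
    using that R0 Rj by (simp add: L_def)
  define u where "u = (\<Sum>p\<le>Polynomial.degree L. smul (Polynomial.coeff L p) (yv p))"
  have phi_yv: "phi (yv p) = ev p" for p
    using phi_var[of p 1] by (simp add: phi_1)
  have "phi u = (\<Sum>p\<le>Polynomial.degree L. \<Sum>i<m. smul (Polynomial.coeff L p * of_nat i ^ p) (yv i))"
    by (simp add: u_def phi_sum phi_smul phi_yv ev_def pm.scale_sum_right)
  also have "\<dots> = (\<Sum>i<m. \<Sum>p\<le>Polynomial.degree L. smul (Polynomial.coeff L p * of_nat i ^ p) (yv i))"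
    by (rule sum.swap)
  also have "\<dots> = (\<Sum>i<m. smul (poly L (of_nat i)) (yv i))"
    by (simp add: poly_altdef pm.scale_sum_left)
  also have "\<dots> = (\<Sum>i<m. if i = j then yv j else 0)"
    by (rule sum.cong) (auto simp: L)
  also have "\<dots> = yv j" using j by simp
  finally show "\<exists>u. phi u = yv j" ..
qed

lemma phi_surj_mon: "set_mset M \<subseteq> {..<m} \<Longrightarrow> \<exists>u. phi u = mon M"
proof (induction M)
  case empty
  show ?case using phi_1 by auto
next
  case (add j M)
  then obtain v where "phi v = mon M" by auto
  moreover obtain u where "phi u = yv j" using add.prems ev_interpolation[of j] by auto
  ultimately have "phi (u * v) = mon (add_mset j M)" by (simp add: phi_mult yv_mult_mon)
  then show ?case by blast
qed

end

lemma fps_nth_poly_prod_bound: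
  fixes f :: "'i \<Rightarrow> complex fps"
  assumes "finite I" "\<And>i k. i \<in> I \<Longrightarrow> d i < k \<Longrightarrow> fps_nth (f i) k = 0" "(\<Sum>i\<in>I. d i) < k"
  shows "fps_nth (\<Prod>i\<in>I. f i) k = 0"
  using assms
proof (induction I arbitrary: k rule: finite_induct)
  case (insert i I)
  have "fps_nth (f i) a * fps_nth (\<Prod>i\<in>I. f i) (k - a) = 0" if "a \<le> k" for a
  proof (cases "d i < a")
    case False
    then have "fps_nth (\<Prod>i\<in>I. f i) (k - a) = 0"
      using insert.prems insert.hyps that by (intro insert.IH) auto
    then show ?thesis by simp
  qed (use insert.prems in auto)
  then have "fps_nth (f i * (\<Prod>i\<in>I. f i)) k = 0"
    unfolding fps_mult_nth by (intro sum.neutral) simp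
  with insert.hyps show ?case by simp
qed (simp add: fps_one_nth)

lemma fps_nth_linear_pow:
  "d < k \<Longrightarrow> fps_nth ((1 - fps_const (c :: complex) * fps_X) ^ d) k = 0"
proof -
  assume "d < k"
  have "fps_nth (\<Prod>i\<in>{..<d}. 1 - fps_const c * fps_X) k = 0"
  proof (rule fps_nth_poly_prod_bound[where d = "\<lambda>_. 1"])
    fix l :: nat assume "1 < l"
    then show "fps_nth (1 - fps_const c * fps_X) l = 0" by (cases l) auto
  qed (use \<open>d < k\<close> in auto)
  then show ?thesis by simp
qed

text \<open>Degeneration: an element of \<open>\<C>[y]\<close> killed by evaluation at the distinct points
  \<open>0, 1, 2, \<dots>\<close> has its top component in the ideal of relations, so a basis of the graded quotient
  still spans the semisimple one, whose dimension is known.\<close>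

lemma spanning_card_ge:
  assumes E: "finite E" "spanning E (fusion_ideal (mset xs))"
  shows "fusion_dim (mset xs) \<le> card E"
proof -
  define m where "m = length xs"
  \<comment> \<open>\<open>Box\<close> indexes the monomial basis of the truncated ring in which the
    power \<open>xs ! j + 1\<close> of the j-th variable is zero, and \<open>tau\<close> is
    \<open>phi\<close> followed by reduction to this ring.\<close>
  define Box where "Box = {M. set_mset M \<subseteq> {..<m} \<and> (\<forall>j<m. count M j \<le> xs ! j)}"
  define tau where "tau u = lin (\<lambda>M. if M \<in> Box then mon M else 0) (phi m u)" for u
  define S where "S = pm.span (tau ` mon ` E)"
  have S: "pm.subspace S" unfolding S_def by (rule pm.subspace_span)
  note S_ops = pm.subspace_0[OF S] pm.subspace_add[OF S] pm.subspace_scale[OF S]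
    pm.subspace_sum[OF S] pm.subspace_diff[OF S]
  have tau: "plinear tau"
    by (rule plinearI) (simp_all add: tau_def phi_add phi_smul lin_add lin_smul)
  note tau_ops = plinear_add[OF tau] plinear_scale[OF tau] plinear_0[OF tau] plinear_sum[OF tau]
    plinear_diff[OF tau]
  have lookup_tau: "Poly_Mapping.lookup (tau u) M =
      (if M \<in> Box then Poly_Mapping.lookup (phi m u) M else 0)" for u M
  proof -
    have "Poly_Mapping.lookup (lin (\<lambda>M. if M \<in> Box then mon M else 0) v) M =
      (if M \<in> Box then Poly_Mapping.lookup v M else 0)" for v
      by (induction v rule: pm_induct)
        (auto simp: lin_add lin_smul lookup_add, auto simp: mon_def lookup_single when_def)
    then show ?thesis by (simp add: tau_def)
  qed
  have tau_0: "tau u = 0 \<longleftrightarrow> (\<forall>M\<in>Box. Poly_Mapping.lookup (phi m u) M = 0)" for u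
    by (metis lookup_tau lookup_zero poly_mapping_eqI)
  have tau_ideal: "is_ideal {u. tau u = 0}"
    unfolding is_ideal_def
  proof (intro conjI ballI allI)
    show "pm.subspace {u. tau u = 0}" by (auto simp: pm.subspace_def tau_ops)
    fix u j assume "u \<in> {u. tau u = 0}"
    then have u: "Poly_Mapping.lookup (phi m u) M = 0" if "M \<in> Box" for M
      using that tau_0 by auto
    have Box: "M - {#q#} \<in> Box" if "M \<in> Box" for M q
      using that by (auto simp: Box_def dest: in_diffD intro: order_trans[OF diff_le_self])
    have "Poly_Mapping.lookup (phi m (yv j * u)) M = 0" if "M \<in> Box" for M
      using that Box
      by (auto simp: phi_var ev_def sum_distrib_right lookup_sum lookup_var_mult u intro!: sum.neutral)
    then show "yv j * u \<in> {u. tau u = 0}" by (simp add: tau_0)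
  qed
  \<comment> \<open>Each defining relation survives the deformation up to terms of lower degree in
    t.\<close>
  have deform: "\<exists>c. tau (fps_nth (ys ^ r) s - (\<Sum>i<s. smul (c i) (fps_nth (ys ^ r) i))) = 0"
    if rs: "minsum (mset xs) r < s + r" for r s
  proof -
    define d where "d j = min (xs ! j) r" for j
    \<comment> \<open>Clears denominators: in a monomial of \<open>Box\<close> with \<open>r\<close>
      factors the pole \<open>1 / (1 - j z)\<close> has multiplicity at most \<open>d j\<close>.
      After multiplication a polynomial of degree at most \<open>minsum (mset xs) r - r\<close> is
      left, and this is less than \<open>s\<close>.\<close>
    define Q where "Q = (\<Prod>j<m. (1 - fps_const (of_nat j :: complex) * fps_X) ^ d j)"
    have Q0: "fps_nth Q 0 = 1" 
    proof -
      have "fps_nth (\<Prod>j\<in>J. (1 - fps_const (of_nat j :: complex) * fps_X) ^ d j) 0 = 1" for J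
        by (induction J rule: infinite_finite_induct) (simp_all add: fps_power_zeroth)
      then show ?thesis by (simp add: Q_def)
    qed
    obtain \<alpha> where \<alpha>: "\<And>M. size M \<noteq> r \<Longrightarrow> \<alpha> M = 0"
      "\<And>s M. Poly_Mapping.lookup (phi m (fps_nth (ys ^ r) s)) M = \<alpha> M * fps_nth (\<Prod>j\<in>#M. geom j) s"
      using lookup_phi_ys_pow[where m = m and r = r] by metis
    define g where "g = (\<Sum>i\<le>s. smul (fps_nth Q (s - i)) (fps_nth (ys ^ r) i))"
    have "Poly_Mapping.lookup (phi m g) M = 0" if M: "M \<in> Box" for M
    proof (cases "size M = r")
      case True
      have set: "set_mset M \<subseteq> {..<m}" using M by (simp add: Box_def)
      have cnt: "count M j \<le> d j" if "j < m" for j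
        using M that True count_le_size[of M j] by (simp add: Box_def d_def)
      have geom: "(\<Prod>j\<in>#M. geom j) = (\<Prod>j<m. geom j ^ count M j)"
        unfolding image_prod_mset_multiplicity
        by (rule prod.mono_neutral_left) (use set in \<open>auto simp: not_in_iff\<close>)
      have "Q * (\<Prod>j\<in>#M. geom j) =
          (\<Prod>j<m. (1 - fps_const (of_nat j) * fps_X) ^ (d j - count M j))"
        unfolding Q_def geom prod.distrib[symmetric]
      proof (rule prod.cong[OF refl])
        fix j assume "j \<in> {..<m}"
        then have "d j = (d j - count M j) + count M j" using cnt by simp
        then have "(1 - fps_const (of_nat j) * fps_X) ^ d j * geom j ^ count M j =
          (1 - fps_const (of_nat j) * fps_X) ^ (d j - count M j) *
          ((1 - fps_const (of_nat j) * fps_X) * geom j) ^ count M j"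
          by (metis (no_types, lifting) mult.assoc power_add power_mult_distrib)
        then show "(1 - fps_const (of_nat j) * fps_X) ^ d j * geom j ^ count M j =
          (1 - fps_const (of_nat j) * fps_X) ^ (d j - count M j)"
          by (simp add: geom_mult)
      qed
      moreover have "(\<Sum>j<m. d j - count M j) < s"
      proof -
        have sum_count: "(\<Sum>j<m. count M j) = r"
        proof -
          have "size M = (\<Sum>j\<in>set_mset M. count M j)" by (simp add: size_multiset_overloaded_eq)
          also have "\<dots> = (\<Sum>j<m. count M j)"
            by (rule sum.mono_neutral_left) (use set in \<open>auto simp: not_in_iff\<close>)
          finally show ?thesis using True by simp
        qed
        have sum_d: "(\<Sum>j<m. d j) = minsum (mset xs) r"
          by (simp add: d_def m_def minsum_def sum_mset_sum_list sum_list_sum_nth atLeast0LessThan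
              flip: mset_map)
        have "(\<Sum>j<m. d j - count M j) = (\<Sum>j<m. d j) - (\<Sum>j<m. count M j)"
          using cnt by (intro sum_subtractf_nat) auto
        then have eq: "(\<Sum>j<m. d j - count M j) = minsum (mset xs) r - r"
          by (simp only: sum_count sum_d)
        have "(\<Sum>j<m. count M j) \<le> (\<Sum>j<m. d j)" using cnt by (intro sum_mono) auto
        then have "r \<le> minsum (mset xs) r" using sum_count sum_d by simp
        with eq show ?thesis using rs by linarith
      qed
      ultimately have "fps_nth (Q * (\<Prod>j\<in>#M. geom j)) s = 0"
        by (simp add: fps_nth_poly_prod_bound[where d = "\<lambda>j. d j - count M j"] fps_nth_linear_pow)
      moreover have "Poly_Mapping.lookup (phi m g) M = \<alpha> M * fps_nth ((\<Prod>j\<in>#M. geom j) * Q) s"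
        by (subst fps_mult_nth) (simp add: g_def phi_sum phi_smul lookup_sum \<alpha>(2) atLeast0AtMost
            sum_distrib_left mult_ac)
      ultimately show ?thesis by (simp add: mult.commute)
    qed (simp add: g_def phi_sum phi_smul lookup_sum \<alpha>)
    then have "tau g = 0" by (simp add: tau_0)
    moreover have "g = fps_nth (ys ^ r) s -
        (\<Sum>i<s. smul (- fps_nth Q (s - i)) (fps_nth (ys ^ r) i))"
    proof -
      have "{..s} = insert s {..<s}" by auto
      then have "g = smul (fps_nth Q 0) (fps_nth (ys ^ r) s) +
          (\<Sum>i<s. smul (fps_nth Q (s - i)) (fps_nth (ys ^ r) i))"
        by (simp add: g_def)
      then show ?thesis by (simp add: Q0 sum_negf)
    qed
    ultimately show ?thesis by (intro exI[of _ "\<lambda>i. - fps_nth Q (s - i)"]) simp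
  qed
  \<comment> \<open>Induction on the degree in t: by \<open>deform\<close>, the image of the degree
    \<open>d\<close> part of a relation is a combination of images from lower degrees, which are in
    \<open>S\<close> already.\<close>
  define low where "low d \<longleftrightarrow> (\<forall>e<d. \<forall>u\<in>homog sum_mset e. tau u \<in> S)" for d
  have key: "low d \<Longrightarrow> tau (component sum_mset d (mon N * u)) \<in> S" if "u \<in> fusion_ideal (mset xs)" for u N d
    using that unfolding fusion_ideal_def
  proof (induction arbitrary: N rule: idl.induct)
    case (idl_gen g)
    then obtain r s where g: "g = fps_nth (ys ^ r) s" and rs: "minsum (mset xs) r < s + r" by auto
    have hom: "mon N * fps_nth (ys ^ r) i \<in> homog sum_mset (sum_mset N + i)" for i
      using keys_mult[of "mon N" "fps_nth (ys ^ r) i"]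
      by (fastforce simp: homog_def mon_def dest: keys_ys_pow)
    show ?case
    proof (cases "d = sum_mset N + s")
      case True
      obtain c where "tau (fps_nth (ys ^ r) s - (\<Sum>i<s. smul (c i) (fps_nth (ys ^ r) i))) = 0"
        using deform[OF rs] by blast
      then have "tau (mon N * (fps_nth (ys ^ r) s - (\<Sum>i<s. smul (c i) (fps_nth (ys ^ r) i)))) = 0"
        using ideal_mult[OF tau_ideal] by blast
      then have "tau (mon N * g) = (\<Sum>i<s. smul (c i) (tau (mon N * fps_nth (ys ^ r) i)))"
        by (simp add: g right_diff_distrib tau_ops sum_distrib_left)
      moreover have "tau (mon N * fps_nth (ys ^ r) i) \<in> S" if "i < s" for i
      proof -
        have "sum_mset N + i < d" using that True by simp
        with \<open>low d\<close> hom[of i] show ?thesis unfolding low_def by blast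
      qed
      ultimately have "tau (mon N * g) \<in> S" by (auto intro!: S_ops)
      with hom[of s] True show ?thesis by (simp add: g component_of_homog)
    next
      case False
      with hom[of s] show ?thesis by (simp add: g component_of_homog tau_ops S_ops)
    qed
  next
    case (idl_var u q)
    have "mon N * (yv q * u) = mon (add_mset q N) * u"
      by (simp flip: yv_mult_mon add: algebra_simps)
    with idl_var show ?case by simp
  qed (simp_all add: component_add component_smul tau_ops S_ops distrib_left)
  have step: "tau (mon M) \<in> S" if "low (sum_mset M)" for M
  proof -
    have "tau (component sum_mset (sum_mset M) u) \<in> S"
      if "u \<in> pm.span (mon ` E \<union> fusion_ideal (mset xs))" for u
      using that
    proof (induction rule: pm.span_induct)
      case base
      show ?case by (auto simp: pm.subspace_def component_add component_smul tau_ops S_ops)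
    next
      case (step u)
      then consider e where "e \<in> E" "u = mon e" | "u \<in> fusion_ideal (mset xs)" by blast
      then show ?case
      proof cases
        case 1
        then show ?thesis by (auto simp: tau_ops S_def pm.span_zero intro: pm.span_base)
      next
        case 2
        from key[OF 2 \<open>low (sum_mset M)\<close>, of "{#}"] show ?thesis by simp
      qed
    qed
    from this[of "mon M"] E(2) show ?thesis by (simp add: spanning_def)
  qed
  have "low d" for d
  proof (induction d)
    case (Suc d)
    have "tau u \<in> S" if "u \<in> homog sum_mset d" for u
    proof -
      have "tau (mon M) \<in> S" if "M \<in> Poly_Mapping.keys u" for M
        using \<open>u \<in> homog sum_mset d\<close> that Suc by (intro step) (auto simp: homog_def)
      then have "(\<Sum>k\<in>Poly_Mapping.keys u. smul (Poly_Mapping.lookup u k) (tau (mon k))) \<in> S"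
        by (auto intro!: S_ops)
      then show ?thesis by (subst pm_expand) (simp add: tau_ops)
    qed
    with Suc show ?case by (auto simp: low_def less_Suc_eq)
  qed (simp add: low_def)
  with step have "tau (mon M) \<in> S" for M by blast
  then have all: "tau u \<in> S" for u
    by (subst pm_expand) (auto simp: tau_ops intro!: S_ops)
  define B where "B = (\<lambda>f. \<Sum>j<m. replicate_mset (f j) j) ` (PiE {..<m} (\<lambda>j. {..xs ! j}))"
  have cnt: "count (\<Sum>j<m. replicate_mset (f j) j) i = (if i < m then f i else 0)" for f :: "nat \<Rightarrow> nat" and i
    by (simp add: count_sum if_distrib cong: if_cong)
  have inj_B: "inj_on (\<lambda>f. \<Sum>j<m. replicate_mset (f j) j) (PiE {..<m} (\<lambda>j. {..xs ! j}))"
  proof (rule inj_onI)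
    fix f g assume fg: "f \<in> PiE {..<m} (\<lambda>j. {..xs ! j})" "g \<in> PiE {..<m} (\<lambda>j. {..xs ! j})"
      "(\<Sum>j<m. replicate_mset (f j) j) = (\<Sum>j<m. replicate_mset (g j) j)"
    show "f = g"
    proof (rule PiE_ext[OF fg(1,2)])
      fix i assume "i \<in> {..<m}"
      then show "f i = g i"
        using arg_cong[OF fg(3), of "\<lambda>M. count M i"] by (simp add: cnt)
    qed
  qed
  have cardB: "card B = fusion_dim (mset xs)"
  proof -
    have "(\<Prod>j<length xs. Suc (xs ! j)) = fusion_dim (mset xs)" for xs
      by (induction xs) (simp_all add: prod.lessThan_Suc_shift del: prod.lessThan_Suc)
    with inj_B show ?thesis by (simp add: B_def card_image card_PiE m_def)
  qed
  have "B \<subseteq> Box"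
  proof
    fix M assume "M \<in> B"
    then obtain f where f: "f \<in> PiE {..<m} (\<lambda>j. {..xs ! j})" "M = (\<Sum>j<m. replicate_mset (f j) j)"
      by (auto simp: B_def)
    then have "count M i = (if i < m then f i else 0)" for i by (simp add: cnt)
    moreover from this have "set_mset M \<subseteq> {..<m}" by (auto simp flip: count_greater_zero_iff split: if_splits)
    ultimately show "M \<in> Box" using f(1) by (auto simp: Box_def PiE_iff)
  qed
  have "mon ` B \<subseteq> S"
  proof clarify
    fix M assume "M \<in> B"
    with \<open>B \<subseteq> Box\<close> have M: "M \<in> Box" by blast
    then obtain u where "phi m u = mon M" using phi_surj_mon[of M m] by (auto simp: Box_def)
    with M have "tau u = mon M" by (simp add: tau_def)
    with all[of u] show "mon M \<in> S" by simp
  qed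
  then have "card (mon ` B) \<le> card (tau ` mon ` E)"
    using pm.independent_span_bound[of "tau ` mon ` E" "mon ` B"] E(1) independent_mon
    by (auto simp: S_def)
  also have "\<dots> \<le> card E"
    using E(1) by (meson card_image_le finite_imageI order_trans)
  finally show ?thesis
    using cardB card_image[OF inj_on_subset[OF inj_mon subset_UNIV], of B] by simp
qed

lemma fusion_ideal_basis: "\<exists>E. finite E \<and> card E = fusion_dim M \<and> spanning E (fusion_ideal M)"
  using small_spanning_fusion_ideal[of M] spanning_card_ge unfolding small_spanning_def
  by (metis ex_mset le_antisym)

section \<open>Independence modulo an ideal, and exactness\<close>

lemma span_decomp:
  assumes "finite E" "pm.subspace A" "p \<in> pm.span (E \<union> A)"
  shows "\<exists>c. p - (\<Sum>e\<in>E. smul (c e) e) \<in> A"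
proof -
  from assms(3) obtain x y where "p = x + y" "x \<in> pm.span E" "y \<in> pm.span A"
    by (auto simp: pm.span_Un)
  moreover have "pm.span A = A" using assms(2) by (simp add: pm.span_eq_iff)
  moreover from \<open>x \<in> pm.span E\<close> obtain c where "x = (\<Sum>e\<in>E. smul (c e) e)"
    using assms(1) by (auto simp: pm.span_finite)
  ultimately show ?thesis by (intro exI[of _ c]) simp
qed

lemma span_decomp_mon:
  assumes "finite E" "pm.subspace A" "p \<in> pm.span (mon ` E \<union> A)"
  shows "\<exists>c. p - (\<Sum>e\<in>E. smul (c e) (mon e)) \<in> A"
proof -
  obtain c where "p - (\<Sum>e\<in>mon ` E. smul (c e) e) \<in> A"
    using span_decomp[OF _ assms(2,3)] assms(1) by blast
  then have "p - (\<Sum>e\<in>E. smul (c (mon e)) (mon e)) \<in> A"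
    by (simp add: sum.reindex inj_on_subset[OF inj_mon subset_UNIV])
  then show ?thesis by (intro exI[of _ "\<lambda>e. c (mon e)"])
qed

lemma span_remove_dependent:
  assumes E: "finite E" and A: "pm.subspace A" and c: "(\<Sum>e\<in>E. smul (c e) e) \<in> A" "e0 \<in> E" "c e0 \<noteq> 0"
  shows "pm.span (E \<union> A) \<subseteq> pm.span ((E - {e0}) \<union> A)"
proof (rule pm.span_minimal)
  let ?W = "pm.span ((E - {e0}) \<union> A)"
  have base: "x \<in> ?W" if "x \<in> E - {e0} \<or> x \<in> A" for x using that by (auto intro: pm.span_base)
  have "(\<Sum>e\<in>E. smul (c e) e) - (\<Sum>e\<in>E - {e0}. smul (c e) e) \<in> ?W"
    using c(1) by (intro pm.span_diff pm.span_sum pm.span_scale base) auto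
  then have "smul (c e0) e0 \<in> ?W" using E c(2) by (simp add: sum.remove)
  then have "smul (inverse (c e0)) (smul (c e0) e0) \<in> ?W" by (rule pm.span_scale)
  then have "e0 \<in> ?W" using c(3) by simp
  then show "E \<union> A \<subseteq> ?W" using base by blast
qed (rule pm.subspace_span)

text \<open>Otherwise one element could be discarded, leaving a spanning set smaller than
  \<open>spanning_card_ge\<close> permits.\<close>

lemma spanning_minimal_independent:
  assumes E: "finite E" "spanning E (fusion_ideal M)" "card E \<le> fusion_dim M"
    and c: "(\<Sum>e\<in>E. smul (c e) (mon e)) \<in> fusion_ideal M" "e0 \<in> E"
  shows "c e0 = 0"
proof (rule ccontr)
  assume "c e0 \<noteq> 0"
  have inj: "inj_on mon E" by (rule inj_on_subset[OF inj_mon subset_UNIV])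
  have "(\<Sum>x\<in>mon ` E. smul (c (the_inv_into E mon x)) x) \<in> fusion_ideal M"
    using c(1) by (simp add: sum.reindex inj the_inv_into_f_f)
  then have "pm.span (mon ` E \<union> fusion_ideal M) \<subseteq> pm.span ((mon ` E - {mon e0}) \<union> fusion_ideal M)"
    using E(1) c(2) \<open>c e0 \<noteq> 0\<close> inj
    by (intro span_remove_dependent[OF _ ideal_subspace[OF ideal_fusion_ideal],
        where c = "\<lambda>x. c (the_inv_into E mon x)"]) (auto simp: the_inv_into_f_f)
  moreover have "mon ` E - {mon e0} = mon ` (E - {e0})"
    using inj_mon by (auto simp: inj_def)
  ultimately have "spanning (E - {e0}) (fusion_ideal M)" using E(2) by (auto simp: spanning_def)
  moreover obtain xs where "M = mset xs" using ex_mset by metis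
  ultimately have "fusion_dim M \<le> card (E - {e0})" using spanning_card_ge E(1) by blast
  also have "\<dots> < card E" using E(1) c(2) by (rule card_Diff1_less)
  finally show False using E(3) by simp
qed

text \<open>Since the dimensions of the two ends of the sequence add up to that of the middle, the
  sequence is exact.\<close>

lemma fusion_ideal_colon_eq:
  assumes N: "\<And>x. x \<in># N \<Longrightarrow> a \<le> x" and b: "b \<le> a" "b > 0"
  shows "{u. u * yv (Suc (size N)) ^ b \<in> fusion_ideal (add_mset a (add_mset b N))} =
    fusion_ideal (add_mset (a - b) N)"
proof
  let ?M = "add_mset a (add_mset b N)" and ?M1 = "add_mset (Suc a) (add_mset (b - 1) N)"
  let ?M2 = "add_mset (a - b) N" and ?V = "replicate_mset b (Suc (size N))"
  show "fusion_ideal ?M2 \<subseteq> {u. u * yv (Suc (size N)) ^ b \<in> fusion_ideal ?M}"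
    by (rule fusion_ideal_colon[OF N b])
  obtain E1 E2 where E1: "finite E1" "card E1 = fusion_dim ?M1" "spanning E1 (fusion_ideal ?M1)"
    and E2: "finite E2" "card E2 = fusion_dim ?M2" "spanning E2 (fusion_ideal ?M2)"
    using fusion_ideal_basis by metis
  let ?E = "E1 \<union> (\<lambda>M. M + ?V) ` E2"
  have fin: "finite ?E" using E1 E2 by simp
  have span: "spanning ?E (fusion_ideal ?M)"
    using E1(3) E2(3) fusion_ideal_colon[OF N b] fusion_ideal_raise[OF N b]
    by (intro spanning_step[OF ideal_fusion_ideal]) (auto simp: mon_replicate)
  have "card ?E \<le> card E1 + card E2"
    by (meson E2(1) add_mono card_Un_le card_image_le le_refl le_trans)
  also have "\<dots> = Suc (Suc a) * (b * fusion_dim N) + Suc (a - b) * fusion_dim N"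
    using E1(2) E2(2) b by simp
  also have "\<dots> = (Suc (Suc a) * b + Suc (a - b)) * fusion_dim N"
    by (simp add: algebra_simps)
  also have "Suc (Suc a) * b + Suc (a - b) = Suc a * Suc b"
    using b by simp
  also have "\<dots> * fusion_dim N = fusion_dim ?M"
    by (simp only: fusion_dim_simps mult.assoc)
  finally have card: "card ?E \<le> fusion_dim ?M" .
  show "{u. u * yv (Suc (size N)) ^ b \<in> fusion_ideal ?M} \<subseteq> fusion_ideal ?M2"
  proof clarify
    fix p assume p: "p * yv (Suc (size N)) ^ b \<in> fusion_ideal ?M"
    have "p \<in> pm.span (mon ` E2 \<union> fusion_ideal ?M2)" using E2(3) by (simp add: spanning_def)
    then obtain c where c: "p - (\<Sum>e\<in>E2. smul (c e) (mon e)) \<in> fusion_ideal ?M2"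
      using span_decomp_mon[OF E2(1) ideal_subspace[OF ideal_fusion_ideal]] by blast
    then have "(p - (\<Sum>e\<in>E2. smul (c e) (mon e))) * mon ?V \<in> fusion_ideal ?M"
      using fusion_ideal_colon[OF N b] by (auto simp: mon_replicate)
    then have "p * mon ?V - (\<Sum>e\<in>E2. smul (c e) (mon (e + ?V))) \<in> fusion_ideal ?M"
      by (simp add: left_diff_distrib sum_distrib_right mon_mult)
    then have *: "(\<Sum>e\<in>E2. smul (c e) (mon (e + ?V))) \<in> fusion_ideal ?M"
      using p ideal_ops(3)[OF ideal_fusion_ideal, of "p * mon ?V" ?M] by (fastforce simp: mon_replicate)
    \<comment> \<open>The coefficients carried over to the union, with value 0 outside the
      translated set.\<close>
    define c' where "c' x = (if x \<in> (\<lambda>M. M + ?V) ` E2 then c (x - ?V) else 0)" for x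
    have "(\<Sum>x\<in>?E. smul (c' x) (mon x)) = (\<Sum>x\<in>(\<lambda>M. M + ?V) ` E2. smul (c' x) (mon x))"
      by (rule sum.mono_neutral_right) (use fin in \<open>auto simp: c'_def\<close>)
    also have "\<dots> = (\<Sum>e\<in>E2. smul (c e) (mon (e + ?V)))"
      by (subst sum.reindex) (auto simp: inj_on_def c'_def intro!: sum.cong)
    finally have "(\<Sum>x\<in>?E. smul (c' x) (mon x)) \<in> fusion_ideal ?M" using * by simp
    then have "c' (e + ?V) = 0" if "e \<in> E2" for e
      using spanning_minimal_independent[OF fin span card] that by blast
    then have "c e = 0" if "e \<in> E2" for e using that by (auto simp: c'_def)
    then show "p \<in> fusion_ideal ?M2" using c by simp
  qed
qed

section \<open>Flags of ideals\<close>

definition demazure_ideal :: "nat \<Rightarrow> nat \<Rightarrow> ypoly set" where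
  "demazure_ideal l r = fusion_ideal (add_mset (r mod l) (replicate_mset (r div l) l))"

text \<open>The trace in \<open>\<C>[y]\<close> of a flag by level three Demazure modules: \<open>q\<close> represents the generator of
  the factor \<open>B / A\<close> of highest weight \<open>r\<close>.  The set \<open>G\<close> serves to ask for homogeneous generators.\<close>

inductive ideal_flag :: "ypoly set \<Rightarrow> nat \<Rightarrow> ypoly set \<Rightarrow> nat list \<Rightarrow> bool" for G n where
  ideal_flag_base: "ideal_flag G n UNIV []"
| ideal_flag_step: "ideal_flag G n B rs \<Longrightarrow> submod n A \<Longrightarrow> B = {u + p * q | u p. u \<in> A} \<Longrightarrow> q \<in> G \<Longrightarrow>
    q \<in> homog size e \<Longrightarrow> n = r + 2 * e \<Longrightarrow> highest_weight_mod n r A q \<Longrightarrow>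
    {p. p * q \<in> A} = demazure_ideal 3 r \<Longrightarrow> ideal_flag G n A (rs @ [r])"

lemma homog_mult:
  assumes dg: "\<And>M N. dg (M + N) = dg M + dg N"
    and "u \<in> homog dg d" "v \<in> homog dg e"
  shows "u * v \<in> homog dg (d + e)"
  using assms keys_mult[of u v] unfolding homog_def by fastforce

text \<open>Multiplication by \<open>v\<close> identifies C[y] modulo the annihilator of
  \<open>v\<close> with the submodule that \<open>v\<close> generates modulo \<open>A\<close>. A
  flag of the former is carried into this submodule and continues the flag \<open>rs\<close>
  downwards.\<close>

lemma ideal_flag_append:
  assumes A: "submod n A" and v: "highest_weight_mod n w A v" "v \<in> homog size e" "n = w + 2 * e"
    and G: "\<And>q. q \<in> G \<Longrightarrow> q * v \<in> G"
    and top: "ideal_flag G n {u + p * v | u p. u \<in> A} rs"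
  shows "ideal_flag G w B ss \<Longrightarrow> {u. u * v \<in> A} \<subseteq> B \<Longrightarrow>
    ideal_flag G n {u + p * v | u p. u \<in> A \<and> p \<in> B} (rs @ ss)"
proof (induction rule: ideal_flag.induct)
  case ideal_flag_base
  then show ?case using top by simp
next
  case (ideal_flag_step B ss A2 q e2 r)
  note IA = submod_ideal[OF A] and IA2 = submod_ideal[OF ideal_flag_step.hyps(2)]
  let ?B = "\<lambda>B. {u + p * v | u p. u \<in> A \<and> p \<in> B}"
  have B: "A2 \<subseteq> B"
  proof
    fix u assume "u \<in> A2"
    moreover have "u = u + 0 * q" by simp
    ultimately show "u \<in> B" unfolding ideal_flag_step.hyps(3) by blast
  qed
  have IH: "ideal_flag G n (?B B) (rs @ ss)"
    using ideal_flag_step B by blast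
  have "ideal_flag G n (?B A2) ((rs @ ss) @ [r])"
  proof (rule ideal_flag.ideal_flag_step[OF IH, of _ "q * v" "e2 + e"])
    show "q * v \<in> G" by (rule G) (rule ideal_flag_step.hyps)
    show "q * v \<in> homog size (e2 + e)"
      using ideal_flag_step.hyps v(2) by (intro homog_mult) auto
    show "n = r + 2 * (e2 + e)" using v(3) ideal_flag_step.hyps by simp
    show "submod n (?B A2)"
      unfolding submod_def is_ideal_def pm.subspace_def
    proof (intro conjI ballI allI)
      have "(0::ypoly) = 0 + 0 * v" by simp
      then show "0 \<in> ?B A2" using ideal_ops(1)[OF IA] ideal_ops(1)[OF IA2] by blast
    next
      fix x y assume "x \<in> ?B A2" "y \<in> ?B A2"
      then obtain u p u' p' where *: "x = u + p * v" "y = u' + p' * v" "u \<in> A" "u' \<in> A" "p \<in> A2" "p' \<in> A2"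
        by blast
      then have "x + y = (u + u') + (p + p') * v" by (simp add: algebra_simps)
      moreover have "u + u' \<in> A" "p + p' \<in> A2" using * ideal_ops(2) IA IA2 by blast+
      ultimately show "x + y \<in> ?B A2" by blast
    next
      fix c x assume "x \<in> ?B A2"
      then obtain u p where *: "x = u + p * v" "u \<in> A" "p \<in> A2" by blast
      then have "smul c x = smul c u + smul c p * v" by (simp add: pm.scale_right_distrib)
      moreover have "smul c u \<in> A" "smul c p \<in> A2" using * ideal_ops(6) IA IA2 by blast+
      ultimately show "smul c x \<in> ?B A2" by blast
    next
      fix x j assume "x \<in> ?B A2"
      then obtain u p where *: "x = u + p * v" "u \<in> A" "p \<in> A2" by blast
      have "yv j * x = yv j * u + (yv j * p) * v" by (simp add: * distrib_left mult.assoc)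
      moreover have "yv j * u \<in> A" "yv j * p \<in> A2" using * ideal_mult IA IA2 by blast+
      ultimately show "yv j * x \<in> ?B A2" by blast
      have "hop n j x = (hop n j u + (hop n j (p * v) - hop w j p * v)) + hop w j p * v"
        by (simp add: *)
      moreover have "hop n j u + (hop n j (p * v) - hop w j p * v) \<in> A"
        using A * highest_weight_mod_mult(1)[OF IA v(1)] by (intro ideal_ops(2)[OF IA]) (auto simp: submod_def)
      moreover have "hop w j p \<in> A2" using ideal_flag_step.hyps(2) * by (auto simp: submod_def)
      ultimately show "hop n j x \<in> ?B A2" by blast
      have "xop n j x = (xop n j u + (xop n j (p * v) - xop w j p * v)) + xop w j p * v"
        by (simp add: *)
      moreover have "xop n j u + (xop n j (p * v) - xop w j p * v) \<in> A"
        using A * highest_weight_mod_mult(2)[OF IA v(1)] by (intro ideal_ops(2)[OF IA]) (auto simp: submod_def)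
      moreover have "xop w j p \<in> A2" using ideal_flag_step.hyps(2) * by (auto simp: submod_def)
      ultimately show "xop n j x \<in> ?B A2" by blast
    qed
    show "highest_weight_mod n r (?B A2) (q * v)"
      unfolding highest_weight_mod_def
    proof (intro allI conjI)
      fix j :: nat
      let ?c = "if j = 0 then of_nat r else 0 :: ypoly"
      have c: "(if j = 0 then of_nat r * w else 0) = ?c * w" for w by simp
      have "hop n j (q * v) - ?c * (q * v) =
          (hop n j (q * v) - hop w j q * v) + (hop w j q - ?c * q) * v"
        by (simp add: left_diff_distrib mult.assoc)
      moreover have "hop w j q - ?c * q \<in> A2"
        using ideal_flag_step.hyps(7)[unfolded highest_weight_mod_def, rule_format, of j] unfolding c by blast
      ultimately show "hop n j (q * v) - (if j = 0 then of_nat r * (q * v) else 0) \<in> ?B A2"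
        unfolding c using highest_weight_mod_mult(1)[OF IA v(1)] by blast
      have "xop n j (q * v) = (xop n j (q * v) - xop w j q * v) + xop w j q * v" by simp
      moreover have "xop w j q \<in> A2" using ideal_flag_step.hyps(7) by (simp add: highest_weight_mod_def)
      ultimately show "xop n j (q * v) \<in> ?B A2" using highest_weight_mod_mult(2)[OF IA v(1)] by blast
    qed
    show "?B B = {u + p * (q * v) | u p. u \<in> ?B A2}"
    proof (rule subset_antisym; rule subsetI)
      fix x assume "x \<in> ?B B"
      then obtain u p p' where "x = u + (p + p' * q) * v" "u \<in> A" "p \<in> A2"
        unfolding ideal_flag_step.hyps(3) by blast
      moreover from this have "x = (u + p * v) + p' * (q * v)" by (simp add: algebra_simps)
      ultimately show "x \<in> {u + p * (q * v) | u p. u \<in> ?B A2}" by blast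
    next
      fix x assume "x \<in> {u + p * (q * v) | u p. u \<in> ?B A2}"
      then obtain u p p' where "x = (u + p * v) + p' * (q * v)" "u \<in> A" "p \<in> A2" by blast
      moreover from this have "x = u + (p + p' * q) * v" by (simp add: algebra_simps)
      ultimately show "x \<in> ?B B" unfolding ideal_flag_step.hyps(3) by blast
    qed
    have "p * (q * v) \<in> ?B A2 \<longleftrightarrow> p * q \<in> A2" for p
    proof
      assume "p * (q * v) \<in> ?B A2"
      then obtain u p' where *: "p * (q * v) = u + p' * v" "u \<in> A" "p' \<in> A2" by blast
      then have "(p * q - p') * v \<in> A" by (simp add: algebra_simps)
      \<comment> \<open>As \<open>A2\<close> contains the annihilator of \<open>v\<close> modulo
        \<open>A\<close>, the element \<open>u + p' * v\<close> determines \<open>p'\<close> modulo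
        \<open>A2\<close>.\<close>
      then have "p * q - p' \<in> A2" using ideal_flag_step.prems by blast
      then show "p * q \<in> A2" using ideal_cong[OF IA2] * by blast
    next
      assume "p * q \<in> A2"
      moreover have "p * (q * v) = 0 + (p * q) * v" by (simp add: algebra_simps)
      ultimately show "p * (q * v) \<in> ?B A2" using ideal_ops(1)[OF IA] by blast
    qed
    then show "{p. p * (q * v) \<in> ?B A2} = demazure_ideal 3 r" using ideal_flag_step.hyps by simp
  qed
  then show ?case by simp
qed

text \<open>For a parts 3, b parts 2 and c parts 1, where \<open>c \<le> 1\<close> in all uses. The
  two smallest parts are resolved: (2, 2) into (3, 1) and nothing, (2, 1) into (3, 0) and 1. With no
  part 2, or a single 2 and no 1, the ideal is already that of a level three module.\<close>

fun flag_weights :: "nat \<Rightarrow> nat \<Rightarrow> nat \<Rightarrow> nat list" where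
  "flag_weights a 0 c = [3 * a + c]"
| "flag_weights a (Suc 0) 0 = [3 * a + 2]"
| "flag_weights a (Suc (Suc b)) 0 = flag_weights (Suc a) b 1 @ flag_weights a b 0"
| "flag_weights a (Suc b) (Suc c) = flag_weights (Suc a) b 0 @ flag_weights a b (Suc c)"

definition mixed_parts :: "nat \<Rightarrow> nat \<Rightarrow> nat \<Rightarrow> nat multiset" where
  "mixed_parts a b c = replicate_mset a 3 + replicate_mset b 2 + replicate_mset c 1"

definition t_homogeneous :: "ypoly set" where
  "t_homogeneous = {u. \<exists>d. u \<in> homog sum_mset d}"

lemma yv_pow_homog: "yv K ^ b \<in> homog size b" "yv K ^ b \<in> homog sum_mset (b * K)"
  by (simp_all flip: mon_replicate)

lemma ideal_flag_single:
  assumes "1 \<in> G" "fusion_ideal M = demazure_ideal 3 r" "sum_mset M = r"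
  shows "ideal_flag G r (fusion_ideal M) [r]"
proof -
  have "x \<in> {u + p * 1 | u p. u \<in> fusion_ideal M}" for x
    by (rule CollectI, rule exI[of _ 0], rule exI[of _ x]) (simp add: ideal_ops(1)[OF ideal_fusion_ideal])
  then have "UNIV = {u + p * 1 | u p. u \<in> fusion_ideal M}" by (rule UNIV_eq_I)
  moreover have "(1 :: ypoly) \<in> homog size 0" using homog_mon[of "{#} :: nat multiset" size 0] by simp
  moreover have "highest_weight_mod r r (fusion_ideal M) 1"
    by (simp add: highest_weight_mod_def hop_1 ideal_ops(1)[OF ideal_fusion_ideal])
  ultimately have "ideal_flag G r (fusion_ideal M) ([] @ [r])"
    using submod_fusion_ideal[of M] assms
    by (intro ideal_flag_step[OF ideal_flag_base, where q = 1 and e = 0]) auto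
  then show ?thesis by simp
qed

lemma ideal_flag_fusion_ideal_step:
  assumes N: "\<And>x. x \<in># N \<Longrightarrow> a \<le> x" and b: "b \<le> a" "b > 0"
    and n: "n = sum_mset (add_mset a (add_mset b N))" and w: "w = sum_mset (add_mset (a - b) N)"
    and top: "ideal_flag t_homogeneous n (fusion_ideal (add_mset (Suc a) (add_mset (b - 1) N))) rs"
    and bot: "ideal_flag t_homogeneous w (fusion_ideal (add_mset (a - b) N)) ss"
  shows "ideal_flag t_homogeneous n (fusion_ideal (add_mset a (add_mset b N))) (rs @ ss)"
proof -
  let ?M = "add_mset a (add_mset b N)" and ?v = "yv (Suc (size N)) ^ b"
  have nw: "n = w + 2 * b" using n w b by simp
  have highest_weight_mod: "highest_weight_mod n w (fusion_ideal ?M) ?v"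
    unfolding nw by (rule highest_weight_mod_top_power[OF ideal_fusion_ideal]) (auto intro: var_fusion_ideal)
  have G: "q * ?v \<in> t_homogeneous" if "q \<in> t_homogeneous" for q
    using that homog_mult[OF _ _ yv_pow_homog(2)] unfolding t_homogeneous_def by fastforce
  have "ideal_flag t_homogeneous n {u + p * ?v | u p. u \<in> fusion_ideal ?M \<and> p \<in> fusion_ideal (add_mset (a - b) N)} (rs @ ss)"
    using top bot fusion_ideal_raise[OF N b] fusion_ideal_colon_eq[OF N b] submod_fusion_ideal[of ?M]
    by (intro ideal_flag_append[OF _ highest_weight_mod yv_pow_homog(1) nw G]) (auto simp: n)
  moreover have "{u + p * ?v | u p. u \<in> fusion_ideal ?M \<and> p \<in> fusion_ideal (add_mset (a - b) N)} = fusion_ideal ?M"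
  proof (rule subset_antisym; rule subsetI)
    fix x assume "x \<in> {u + p * ?v | u p. u \<in> fusion_ideal ?M \<and> p \<in> fusion_ideal (add_mset (a - b) N)}"
    then show "x \<in> fusion_ideal ?M"
      using fusion_ideal_colon[OF N b] ideal_ops(2)[OF ideal_fusion_ideal[of ?M]] by blast
  next
    fix x assume "x \<in> fusion_ideal ?M"
    moreover have "x = x + 0 * ?v" by simp
    ultimately show "x \<in> {u + p * ?v | u p. u \<in> fusion_ideal ?M \<and> p \<in> fusion_ideal (add_mset (a - b) N)}"
      using ideal_ops(1)[OF ideal_fusion_ideal] by blast
  qed
  ultimately show ?thesis by simp
qed

lemma ideal_flag_mixed_parts:
  "c \<le> 1 \<Longrightarrow> ideal_flag t_homogeneous (3 * a + 2 * b + c) (fusion_ideal (mixed_parts a b c)) (flag_weights a b c)"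
proof (induction a b c rule: flag_weights.induct)
  case (1 a c)
  have "1 \<in> t_homogeneous" unfolding t_homogeneous_def using homog_mon[of "{#}" sum_mset 0] by auto
  moreover have "fusion_ideal (mixed_parts a 0 c) = demazure_ideal 3 (3 * a + c)"
  proof -
    have "(3 * a + c) div 3 = a" "(3 * a + c) mod 3 = c" using 1 by simp_all
    then show ?thesis using 1 by (cases c) (simp_all add: demazure_ideal_def mixed_parts_def fusion_ideal_add_0)
  qed
  moreover have "sum_mset (mixed_parts a 0 c) = 3 * a + c" by (simp add: mixed_parts_def)
  ultimately show ?case using ideal_flag_single[of t_homogeneous "mixed_parts a 0 c" "3 * a + c"] by simp
next
  case (2 a)
  have "1 \<in> t_homogeneous" unfolding t_homogeneous_def using homog_mon[of "{#}" sum_mset 0] by auto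
  moreover have "fusion_ideal (mixed_parts a (Suc 0) 0) = demazure_ideal 3 (3 * a + 2)"
  proof -
    have "(3 * a + 2) div 3 = a" "(3 * a + 2) mod 3 = 2" by presburger+
    then show ?thesis by (simp only: demazure_ideal_def mixed_parts_def) simp
  qed
  moreover have "sum_mset (mixed_parts a (Suc 0) 0) = 3 * a + 2" by (simp add: mixed_parts_def)
  ultimately show ?case using ideal_flag_single[of t_homogeneous "mixed_parts a (Suc 0) 0" "3 * a + 2"] by simp
next
  case (3 a b)
  have eq: "mixed_parts a (Suc (Suc b)) 0 = add_mset 2 (add_mset 2 (mixed_parts a b 0))"
    by (simp add: mixed_parts_def)
  have eq1: "add_mset (Suc 2) (add_mset (2 - 1) (mixed_parts a b 0)) = mixed_parts (Suc a) b 1"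
    by (simp add: mixed_parts_def numeral_3_eq_3 numeral_2_eq_2)
  have n3: "3 * a + 2 * Suc (Suc b) + 0 = 3 * Suc a + 2 * b + 1" by simp
  have "ideal_flag t_homogeneous (3 * a + 2 * Suc (Suc b) + 0) (fusion_ideal (add_mset 2 (add_mset 2 (mixed_parts a b 0))))
      (flag_weights (Suc a) b 1 @ flag_weights a b 0)"
  proof (rule ideal_flag_fusion_ideal_step)
    show "ideal_flag t_homogeneous (3 * a + 2 * Suc (Suc b) + 0)
        (fusion_ideal (add_mset (Suc 2) (add_mset (2 - 1) (mixed_parts a b 0)))) (flag_weights (Suc a) b 1)"
      unfolding eq1 n3 by (rule 3) simp
    show "ideal_flag t_homogeneous (3 * a + 2 * b + 0) (fusion_ideal (add_mset (2 - 2) (mixed_parts a b 0))) (flag_weights a b 0)"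
      using 3 by (simp add: fusion_ideal_add_0)
  qed (auto simp: mixed_parts_def split: if_splits)
  then show ?case by (simp add: eq)
next
  case (4 a b c)
  then have c: "c = 0" by simp
  have eq: "mixed_parts a (Suc b) (Suc 0) = add_mset 2 (add_mset 1 (mixed_parts a b 0))"
    by (simp add: mixed_parts_def)
  have eq1: "add_mset (Suc 2) (add_mset (1 - 1) (mixed_parts a b 0)) = add_mset 0 (mixed_parts (Suc a) b 0)"
    by (simp add: mixed_parts_def numeral_3_eq_3 numeral_2_eq_2)
  have eq2: "add_mset (2 - 1) (mixed_parts a b 0) = mixed_parts a b (Suc 0)"
    by (simp add: mixed_parts_def)
  have n4: "3 * a + 2 * Suc b + 1 = 3 * Suc a + 2 * b + 0" by simp
  have "ideal_flag t_homogeneous (3 * a + 2 * Suc b + 1) (fusion_ideal (add_mset 2 (add_mset 1 (mixed_parts a b 0))))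
      (flag_weights (Suc a) b 0 @ flag_weights a b (Suc 0))"
  proof (rule ideal_flag_fusion_ideal_step)
    show "ideal_flag t_homogeneous (3 * a + 2 * Suc b + 1)
        (fusion_ideal (add_mset (Suc 2) (add_mset (1 - 1) (mixed_parts a b 0)))) (flag_weights (Suc a) b 0)"
      unfolding eq1 fusion_ideal_add_0 n4 by (rule 4) simp
    show "ideal_flag t_homogeneous (3 * a + 2 * b + 1) (fusion_ideal (add_mset (2 - 1) (mixed_parts a b 0))) (flag_weights a b (Suc 0))"
      unfolding eq2 using 4 c by simp
  qed (auto simp: mixed_parts_def split: if_splits)
  then show ?case by (simp add: eq c)
qed

lemma demazure_ideal_2_mixed_parts: "demazure_ideal 2 s = fusion_ideal (mixed_parts 0 (s div 2) (s mod 2))"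
  by (cases "even s") (auto simp: demazure_ideal_def mixed_parts_def fusion_ideal_add_0 odd_iff_mod_2_eq_one)

lemma ideal_flag_demazure_ideal_2: "ideal_flag t_homogeneous s (demazure_ideal 2 s) (flag_weights 0 (s div 2) (s mod 2))"
  using ideal_flag_mixed_parts[of "s mod 2" 0 "s div 2"] by (simp add: demazure_ideal_2_mixed_parts)

section \<open>Uniqueness of the weights of a flag\<close>

lemma hop_0_homog: "u \<in> homog size R \<Longrightarrow> hop n 0 u = of_nat n * u - of_nat (2 * R) * u"
proof -
  have "sderiv 0 (mon M) = of_nat (size M) * mon M" for M
    by (induction M) (simp_all add: yv_mult_mon[symmetric] distrib_right distrib_left mult.left_commute)
  moreover assume "u \<in> homog size R"
  ultimately have "sderiv 0 u = (\<Sum>k\<in>Poly_Mapping.keys u.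
      smul (Poly_Mapping.lookup u k) (of_nat R * mon k))"
    by (subst pm_expand) (auto simp: sderiv_sum homog_def intro!: sum.cong)
  also have "\<dots> = of_nat R * u"
    by (subst (3) pm_expand) (simp add: sum_distrib_left)
  finally show ?thesis by (simp add: hop_def mult.assoc)
qed

text \<open>A submodule is stable under h, which acts on size R by \<open>n - 2 R\<close>; these
  eigenvalues are distinct, so the components can be separated. The induction removes one size at a
  time.\<close>

lemma submod_component_size:
  assumes A: "submod n A" and "u \<in> A"
  shows "component size R u \<in> A"
proof -
  note I = submod_ideal[OF A]
  have "component size R u \<in> A"
    if "finite D" "u \<in> A" "size ` Poly_Mapping.keys u \<subseteq> D" for D u R
    using that
  proof (induction D arbitrary: u R rule: finite_induct)
    case empty
    then have "u = 0" by simp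
    then show ?case by (simp add: ideal_ops[OF I])
  next
    case (insert d D)
    \<comment> \<open>The operator h minus its eigenvalue on size \<open>d\<close>: it kills that
      component and rescales the others by nonzero scalars.\<close>
    define w where "w = hop n 0 u - (of_nat n * u - of_nat (2 * d) * u)"
    have fin: "finite (insert d D)" using insert by simp
    have w: "w = (\<Sum>e\<in>insert d D. (of_nat (2 * d) - of_nat (2 * e)) * component size e u)"
    proof -
      have "u = (\<Sum>e\<in>insert d D. component size e u)"
        by (rule sym, rule component_sum_eq[OF fin]) (use insert in auto)
      then have "hop n 0 u = (\<Sum>e\<in>insert d D. hop n 0 (component size e u))"
        by (metis hop_sum)
      also have "\<dots> = (\<Sum>e\<in>insert d D. of_nat n * component size e u - of_nat (2 * e) * component size e u)"
        by (intro sum.cong refl hop_0_homog component_homog)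
      finally have 1: "hop n 0 u = \<dots>" .
      have 2: "of_nat n * u - of_nat (2 * d) * u =
          (\<Sum>e\<in>insert d D. of_nat n * component size e u - of_nat (2 * d) * component size e u)"
        using \<open>u = _\<close> by (simp add: sum_subtractf flip: sum_distrib_left)
      show ?thesis
        unfolding w_def 1 2 sum_subtractf[symmetric] by (simp add: algebra_simps)
    qed
    have wA: "w \<in> A"
      unfolding w_def using A insert.prems
      by (intro ideal_ops(3)[OF I] ideal_mult[OF I]) (auto simp: submod_def)
    have component_w: "component size e w = (of_nat (2 * d) - of_nat (2 * e)) * component size e u" for e
    proof (cases "e \<in> insert d D")
      case True
      have "component size e ((of_nat (2 * d) - of_nat (2 * e')) * component size e' u) =
          (if e' = e then (of_nat (2 * d) - of_nat (2 * e)) * component size e u else 0)" for e'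
      proof -
        have "(of_nat (2 * d) - of_nat (2 * e')) * component size e' u =
            smul (of_nat (2 * d) - of_nat (2 * e')) (component size e' u)"
          by (simp only: left_diff_distrib pm.scale_left_diff_distrib smul_of_nat)
        then show ?thesis
          using component_of_homog[OF component_homog, of size e e' u]
          by (auto simp: component_smul)
      qed
      then show ?thesis
        unfolding w component_sum by (simp only: sum.delta[OF fin] True if_True)
    next
      case False
      have "component size e u = 0" using False insert.prems by (intro component_eq_0) auto
      moreover have "component size e w = 0"
      proof -
        have "component size e ((of_nat (2 * d) - of_nat (2 * e')) * component size e' u) = 0" if "e' \<noteq> e" for e'
        proof -
          have "(of_nat (2 * d) - of_nat (2 * e')) * component size e' u =
              smul (of_nat (2 * d) - of_nat (2 * e')) (component size e' u)"
            by (simp only: left_diff_distrib pm.scale_left_diff_distrib smul_of_nat)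
          then show ?thesis
            using component_of_homog[OF component_homog, of size e e' u] that by (auto simp: component_smul)
        qed
        moreover have "x \<noteq> e" if "x \<in> insert d D" for x using that False by auto
        ultimately show ?thesis unfolding w component_sum by (intro sum.neutral ballI) simp
      qed
      ultimately show ?thesis by simp
    qed
    have keys_w: "size ` Poly_Mapping.keys w \<subseteq> D"
    proof
      fix e assume "e \<in> size ` Poly_Mapping.keys w"
      then obtain k where k: "k \<in> Poly_Mapping.keys w" "size k = e" by auto
      then have "Poly_Mapping.lookup (component size e w) k \<noteq> 0" by (simp add: lookup_component in_keys_iff)
      then have "component size e w \<noteq> 0" by auto
      then have "component size e u \<noteq> 0" "e \<noteq> d" unfolding component_w by auto
      then have "e \<in> size ` Poly_Mapping.keys u" using component_eq_0 by blast
      with insert.prems \<open>e \<noteq> d\<close> show "e \<in> D" by auto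
    qed
    have other: "component size e u \<in> A" if "e \<noteq> d" for e
    proof -
      have "component size e w \<in> A" by (rule insert.IH[OF wA keys_w])
      then have "smul (of_nat (2 * d) - of_nat (2 * e)) (component size e u) \<in> A"
        by (simp only: component_w left_diff_distrib pm.scale_left_diff_distrib smul_of_nat)
      then have "smul (inverse (of_nat (2 * d) - of_nat (2 * e))) (smul (of_nat (2 * d) - of_nat (2 * e)) (component size e u)) \<in> A"
        by (rule ideal_ops(6)[OF I])
      moreover have "(of_nat (2 * d) - of_nat (2 * e) :: complex) \<noteq> 0"
        using that by (metis eq_iff_diff_eq_0 mult_cancel1 of_nat_eq_iff zero_neq_numeral)
      ultimately show ?thesis by simp
    qed
    show ?case
    proof (cases "R = d")
      case True
      have "u = (\<Sum>e\<in>insert d D. component size e u)"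
        by (rule sym, rule component_sum_eq[OF fin]) (use insert in auto)
      then have "component size d u = u - (\<Sum>e\<in>D. component size e u)"
        using insert.hyps by (simp add: algebra_simps)
      also have "\<dots> \<in> A"
        using insert by (intro ideal_ops(3)[OF I] ideal_ops(5)[OF I] other) auto
      finally show ?thesis using True by simp
    qed (rule other)
  qed
  from this[of "size ` Poly_Mapping.keys u" u R] assms(2) show ?thesis by simp
qed

section \<open>Dimensions of weight spaces\<close>

lemma component_mult_homog:
  fixes p q :: ypoly
  assumes dg: "\<And>M N. dg (M + N) = dg M + dg N" and q: "q \<in> homog dg e"
  shows "component dg R (p * q) = (if e \<le> R then component dg (R - e) p * q else 0)"
proof -
  have "component dg R (mon M * q) = (if e \<le> R then component dg (R - e) (mon M) * q else 0)" for M
  proof -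
    have h: "mon M * q \<in> homog dg (dg M + e)"
      by (rule homog_mult[OF dg _ q]) simp
    show ?thesis using component_of_homog[OF h, of R] by (auto split: if_splits)
  qed
  moreover have "plinear (\<lambda>p. component dg R (p * q))"
    "plinear (\<lambda>p. if e \<le> R then component dg (R - e) p * q else 0)"
    by (rule plinearI; simp add: distrib_right component_add component_smul)+
  ultimately show ?thesis using plinear_eqI[of "\<lambda>p. component dg R (p * q)"
      "\<lambda>p. if e \<le> R then component dg (R - e) p * q else 0" p] by simp
qed

definition codim :: "nat \<Rightarrow> ypoly set \<Rightarrow> nat \<Rightarrow> bool" where
  "codim R A N \<longleftrightarrow> (\<exists>E. finite E \<and> card E = N \<and> E \<subseteq> homog size R \<and>
     homog size R \<subseteq> pm.span (E \<union> A) \<and>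
     (\<forall>c. (\<Sum>e\<in>E. smul (c e) e) \<in> A \<longrightarrow> (\<forall>e\<in>E. c e = 0)))"

text \<open>Steinitz exchange modulo \<open>A\<close>: representatives of \<open>E\<close> in the
  span of \<open>F\<close> inherit independence.\<close>

lemma card_le_of_independent_mod:
  assumes A: "pm.subspace A" and F: "finite F" and E: "finite E" "E \<subseteq> pm.span (F \<union> A)"
    and ind: "\<And>c. (\<Sum>e\<in>E. smul (c e) e) \<in> A \<Longrightarrow> \<forall>e\<in>E. c e = 0"
  shows "card E \<le> card F"
proof -
  have "\<forall>e\<in>E. \<exists>x. x \<in> pm.span F \<and> e - x \<in> A"
  proof
    fix e assume "e \<in> E"
    then obtain c where "e - (\<Sum>f\<in>F. smul (c f) f) \<in> A"
      using span_decomp[OF F A] E(2) by blast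
    moreover have "(\<Sum>f\<in>F. smul (c f) f) \<in> pm.span F"
      by (rule pm.span_sum, rule pm.span_scale, rule pm.span_base)
    ultimately show "\<exists>x. x \<in> pm.span F \<and> e - x \<in> A" by blast
  qed
  then obtain g where g: "\<And>e. e \<in> E \<Longrightarrow> g e \<in> pm.span F" "\<And>e. e \<in> E \<Longrightarrow> e - g e \<in> A"
    by metis
  have zero: "\<forall>e\<in>E. c e = 0" if "(\<Sum>e\<in>E. smul (c e) (g e)) = 0" for c
  proof (rule ind)
    have "(\<Sum>e\<in>E. smul (c e) (e - g e)) \<in> A"
      using g(2) A by (intro pm.subspace_sum pm.subspace_scale) auto
    then show "(\<Sum>e\<in>E. smul (c e) e) \<in> A"
      using that by (simp add: pm.scale_right_diff_distrib sum_subtractf)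
  qed
  have inj: "inj_on g E"
  proof (rule inj_onI, rule ccontr)
    fix x y assume xy: "x \<in> E" "y \<in> E" "g x = g y" "x \<noteq> y"
    define c where "c e = (if e = x then 1 else if e = y then - 1 else (0 :: complex))" for e
    have "(\<Sum>e\<in>E. smul (c e) (g e)) = (\<Sum>e\<in>{x, y}. smul (c e) (g e))"
      by (rule sum.mono_neutral_right) (use xy E in \<open>auto simp: c_def\<close>)
    also have "\<dots> = 0" using xy by (simp add: c_def)
    finally have "c x = 0" using zero xy(1) by blast
    then show False by (simp add: c_def)
  qed
  have "pm.independent (g ` E)"
    unfolding pm.dependent_finite[OF finite_imageI[OF E(1)]]
  proof clarify
    fix u v assume u: "(\<Sum>v\<in>g ` E. smul (u v) v) = 0" "v \<in> E" "u (g v) \<noteq> 0"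
    then have "(\<Sum>e\<in>E. smul (u (g e)) (g e)) = 0" by (simp add: sum.reindex[OF inj])
    from zero[OF this] u show False by blast
  qed
  moreover have "g ` E \<subseteq> pm.span F" using g(1) by auto
  ultimately have "card (g ` E) \<le> card F" using pm.independent_span_bound[OF F] by blast
  then show ?thesis by (simp add: card_image[OF inj])
qed

lemma codim_unique:
  assumes "pm.subspace A" "codim R A N" "codim R A N'"
  shows "N = N'"
proof -
  have "N \<le> N'" if NN': "codim R A N" "codim R A N'" for N N'
  proof -
    obtain E where E: "finite E" "card E = N" "E \<subseteq> homog size R"
      "\<And>c. (\<Sum>e\<in>E. smul (c e) e) \<in> A \<Longrightarrow> \<forall>e\<in>E. c e = 0"
      using NN'(1) unfolding codim_def by blast
    obtain F where F: "finite F" "card F = N'" "homog size R \<subseteq> pm.span (F \<union> A)"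
      using NN'(2) unfolding codim_def by blast
    show ?thesis using card_le_of_independent_mod[OF assms(1) F(1) E(1) _ E(4)] E F by blast
  qed
  with assms show ?thesis by (meson le_antisym)
qed

lemma codim_exists:
  assumes A: "pm.subspace A" and F: "finite F" "F \<subseteq> homog size R" "homog size R \<subseteq> pm.span (F \<union> A)"
  shows "\<exists>N. codim R A N"
proof -
  define Q where "Q E \<longleftrightarrow> finite E \<and> E \<subseteq> homog size R \<and> homog size R \<subseteq> pm.span (E \<union> A)" for E
  have "Q F" using F by (simp add: Q_def)
  then obtain E where E: "Q E" "\<And>E'. Q E' \<Longrightarrow> card E \<le> card E'"
    using ex_has_least_nat[of Q F card] by blast
  have "c e = 0" if c: "(\<Sum>e\<in>E. smul (c e) e) \<in> A" and e: "e \<in> E" for c e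
  proof (rule ccontr)
    assume "c e \<noteq> 0"
    then have "pm.span (E \<union> A) \<subseteq> pm.span ((E - {e}) \<union> A)"
      using E(1) c e A by (intro span_remove_dependent) (auto simp: Q_def)
    then have "Q (E - {e})" using E(1) by (auto simp: Q_def)
    from E(2)[OF this] show False
      using E(1) e by (metis Q_def card_Diff1_less leD)
  qed
  then show ?thesis using E(1) unfolding codim_def Q_def by blast
qed

text \<open>Additivity along the exact sequence with ends C[y]/C and C[y]/B, whose first map,
  multiplication by \<open>q\<close>, raises the size by \<open>e\<close>.\<close>

lemma codim_step:
  assumes A: "pm.subspace A" "\<And>u R. u \<in> A \<Longrightarrow> component size R u \<in> A"
    and B: "B = {u + p * q | u p. u \<in> A}" "pm.subspace B" and q: "q \<in> homog size e"
    and C: "C = {p. p * q \<in> A}"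
    and N1: "codim R B N1" and N2: "e \<le> R \<Longrightarrow> codim (R - e) C N2"
  shows "codim R A (N1 + (if e \<le> R then N2 else 0))"
proof -
  obtain E1 where E1: "finite E1" "card E1 = N1" "E1 \<subseteq> homog size R"
    "homog size R \<subseteq> pm.span (E1 \<union> B)"
    "\<And>c. (\<Sum>x\<in>E1. smul (c x) x) \<in> B \<Longrightarrow> \<forall>x\<in>E1. c x = 0"
    using N1 unfolding codim_def by blast
  have AB: "A \<subseteq> B"
  proof
    fix u assume "u \<in> A"
    moreover have "u = u + 0 * q" by simp
    ultimately show "u \<in> B" unfolding B(1) by blast
  qed
  have qB: "p * q \<in> B" for p
  proof -
    have "p * q = 0 + p * q" by simp
    then show ?thesis unfolding B(1) using pm.subspace_0[OF A(1)] by blast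
  qed
  have Csub: "pm.subspace C"
    using A(1) unfolding C by (auto simp: pm.subspace_def distrib_right)
  have decomp: "\<exists>c p. w - (\<Sum>x\<in>E1. smul (c x) x) - p * q \<in> A \<and> (if e \<le> R then p \<in> homog size (R - e) else p = 0)"
    if w: "w \<in> homog size R" for w
  proof -
    obtain c where "w - (\<Sum>x\<in>E1. smul (c x) x) \<in> B"
      using span_decomp[OF E1(1) B(2)] E1(4) w by blast
    then obtain u p where up: "w - (\<Sum>x\<in>E1. smul (c x) x) = u + p * q" "u \<in> A"
      unfolding B(1) by blast
    have "w - (\<Sum>x\<in>E1. smul (c x) x) \<in> homog size R"
      using w E1(3) by (intro homog_diff homog_sum homog_smul) auto
    then have "component size R (u + p * q) = u + p * q"
      unfolding up(1)[symmetric] by (simp add: component_of_homog)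
    moreover have "component size R (p * q) = (if e \<le> R then component size (R - e) p * q else 0)"
      by (rule component_mult_homog[OF _ q]) simp
    ultimately have "w - (\<Sum>x\<in>E1. smul (c x) x) - (if e \<le> R then component size (R - e) p else 0) * q
        = component size R u"
      using up(1) by (simp add: component_add split: if_splits) (metis add_diff_cancel_right')
    moreover have "component size R u \<in> A" by (rule A(2)[OF up(2)])
    ultimately show ?thesis
      by (intro exI[of _ c] exI[of _ "if e \<le> R then component size (R - e) p else 0"])
        (simp add: component_homog)
  qed
  show ?thesis
  proof (cases "e \<le> R")
    case False
    have "w \<in> pm.span (E1 \<union> A)" if w: "w \<in> homog size R" for w :: ypoly
    proof -
      obtain c where "w - (\<Sum>x\<in>E1. smul (c x) x) \<in> A"
        using decomp[OF w] False by auto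
      then have "(w - (\<Sum>x\<in>E1. smul (c x) x)) + (\<Sum>x\<in>E1. smul (c x) x) \<in> pm.span (E1 \<union> A)"
        by (intro pm.span_add pm.span_sum pm.span_scale) (auto intro: pm.span_base)
      then show ?thesis by simp
    qed
    then show ?thesis
      using False E1 AB unfolding codim_def by (intro exI[of _ E1]) auto
  next
    case True
    obtain E2 where E2: "finite E2" "card E2 = N2" "E2 \<subseteq> homog size (R - e)"
      "homog size (R - e) \<subseteq> pm.span (E2 \<union> C)"
      "\<And>c. (\<Sum>x\<in>E2. smul (c x) x) \<in> C \<Longrightarrow> \<forall>x\<in>E2. c x = 0"
      using N2[OF True] unfolding codim_def by blast
    have inj: "inj_on (\<lambda>x. x * q) E2"
    proof (rule inj_onI, rule ccontr)
      fix x y assume xy: "x \<in> E2" "y \<in> E2" "x * q = y * q" "x \<noteq> y"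
      define c where "c z = (if z = x then 1 else if z = y then - 1 else (0 :: complex))" for z
      have "(\<Sum>z\<in>E2. smul (c z) z) = (\<Sum>z\<in>{x, y}. smul (c z) z)"
        by (rule sum.mono_neutral_right) (use xy E2 in \<open>auto simp: c_def\<close>)
      also have "\<dots> \<in> C" using xy pm.subspace_0[OF A(1)] by (simp add: c_def C left_diff_distrib)
      finally have "c x = 0" using E2(5) xy(1) by blast
      then show False by (simp add: c_def)
    qed
    have disj: "E1 \<inter> (\<lambda>x. x * q) ` E2 = {}"
    proof (rule ccontr)
      assume "E1 \<inter> (\<lambda>x. x * q) ` E2 \<noteq> {}"
      then obtain x where x: "x \<in> E1" "x \<in> B" using qB by blast
      define c where "c z = (if z = x then 1 else (0 :: complex))" for z
      have "(\<Sum>z\<in>E1. smul (c z) z) = (\<Sum>z\<in>{x}. smul (c z) z)"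
        by (rule sum.mono_neutral_right) (use x E1 in \<open>auto simp: c_def\<close>)
      also have "\<dots> \<in> B" using x by (simp add: c_def)
      finally have "c x = 0" using E1(5) x(1) by blast
      then show False by (simp add: c_def)
    qed
    let ?E = "E1 \<union> (\<lambda>x. x * q) ` E2"
    have sum_E: "(\<Sum>x\<in>?E. smul (c x) x) = (\<Sum>x\<in>E1. smul (c x) x) + (\<Sum>x\<in>E2. smul (c (x * q)) x) * q"
      for c
      using E1(1) E2(1) disj
      by (subst sum.union_disjoint) (auto simp: sum.reindex[OF inj] sum_distrib_right)
    have "codim R A (N1 + N2)"
      unfolding codim_def
    proof (intro exI[of _ ?E] conjI allI impI)
      show "finite ?E" using E1(1) E2(1) by simp
      show "card ?E = N1 + N2"
        using E1(1,2) E2(1,2) disj by (simp add: card_Un_disjoint card_image[OF inj])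
      show "?E \<subseteq> homog size R"
        using E1(3) E2(3) True homog_mult[OF _ _ q, of _ "R - e"] by fastforce
      show "homog size R \<subseteq> pm.span (?E \<union> A)"
      proof
        fix w :: ypoly assume "w \<in> homog size R"
        then obtain c p where *: "w - (\<Sum>x\<in>E1. smul (c x) x) - p * q \<in> A" "p \<in> homog size (R - e)"
          using decomp[of w] True by auto
        obtain d where "p - (\<Sum>x\<in>E2. smul (d x) x) \<in> C"
          using span_decomp[OF E2(1) Csub] E2(4) *(2) by blast
        then have **: "(p - (\<Sum>x\<in>E2. smul (d x) x)) * q \<in> A" by (simp add: C)
        have "w = (w - (\<Sum>x\<in>E1. smul (c x) x) - p * q) + (p - (\<Sum>x\<in>E2. smul (d x) x)) * q +
            ((\<Sum>x\<in>E1. smul (c x) x) + (\<Sum>x\<in>E2. smul (d x) (x * q)))"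
          by (simp add: left_diff_distrib sum_distrib_right)
        also have "\<dots> \<in> pm.span (?E \<union> A)"
          using * ** by (intro pm.span_add pm.span_sum pm.span_scale) (auto intro: pm.span_base)
        finally show "w \<in> pm.span (?E \<union> A)" .
      qed
      fix c assume c: "(\<Sum>x\<in>?E. smul (c x) x) \<in> A"
      then have "(\<Sum>x\<in>E1. smul (c x) x) + (\<Sum>x\<in>E2. smul (c (x * q)) x) * q \<in> B"
        using AB sum_E by auto
      then have "(\<Sum>x\<in>E1. smul (c x) x) + (\<Sum>x\<in>E2. smul (c (x * q)) x) * q - (\<Sum>x\<in>E2. smul (c (x * q)) x) * q \<in> B"
        by (intro pm.subspace_diff[OF B(2)] qB)
      then have 1: "\<forall>x\<in>E1. c x = 0" by (intro E1(5)) simp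
      then have "(\<Sum>x\<in>E2. smul (c (x * q)) x) * q \<in> A" using c sum_E by simp
      then have "\<forall>x\<in>E2. c (x * q) = 0" by (intro E2(5)[of "\<lambda>x. c (x * q)"]) (simp add: C)
      with 1 show "\<forall>x\<in>?E. c x = 0" by auto
    qed
    with True show ?thesis by simp
  qed
qed

lemma demazure_ideal_submod: "submod r (demazure_ideal l r)"
proof -
  have "sum_mset (add_mset (r mod l) (replicate_mset (r div l) l)) = r"
    by (simp add: mult.commute)
  then show ?thesis unfolding demazure_ideal_def using submod_fusion_ideal by metis
qed

lemma codim_demazure_ideal_exists: "\<exists>N. codim R (demazure_ideal l r) N"
proof -
  obtain E where E: "finite E" "spanning E (demazure_ideal l r)"
    unfolding demazure_ideal_def using fusion_ideal_basis by metis
  note A = submod_subspace[OF demazure_ideal_submod[of r l]]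
  show ?thesis
  proof (rule codim_exists[OF A])
    let ?F = "mon ` {e \<in> E. size e = R}"
    show "finite ?F" "?F \<subseteq> homog size R" using E(1) by auto
    have "component size R u \<in> pm.span (?F \<union> demazure_ideal l r)" if "u \<in> pm.span (mon ` E \<union> demazure_ideal l r)" for u
      using that
    proof (induction rule: pm.span_induct)
      case base
      show ?case
        by (auto simp: pm.subspace_def component_add component_smul intro: pm.span_zero pm.span_add pm.span_scale)
    next
      case (step x)
      then consider e where "e \<in> E" "x = mon e" | "x \<in> demazure_ideal l r" by blast
      then show ?case
      proof cases
        case 1
        then have "size e = R \<Longrightarrow> x \<in> ?F" by blast
        with 1 show ?thesis by (auto simp: pm.span_zero intro: pm.span_base)
      next
        case 2
        then have "component size R x \<in> demazure_ideal l r" by (rule submod_component_size[OF demazure_ideal_submod])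
        then show ?thesis by (intro pm.span_base) blast
      qed
    qed
    then show "homog size R \<subseteq> pm.span (?F \<union> demazure_ideal l r)"
      using E(2) component_of_homog by (metis (no_types, lifting) UNIV_I spanning_def subsetI)
  qed
qed

definition cdim :: "nat \<Rightarrow> nat \<Rightarrow> nat" where
  "cdim r R = (SOME N. codim R (demazure_ideal 3 r) N)"

lemma codim_cdim: "codim R (demazure_ideal 3 r) (cdim r R)"
  unfolding cdim_def using codim_demazure_ideal_exists by (rule someI_ex)

text \<open>If 1 were in the ideal, the empty set would span, against the positive lower bound for
  the dimension.\<close>

lemma one_notin_demazure_ideal: "1 \<notin> demazure_ideal l r"
proof
  assume "1 \<in> demazure_ideal l r"
  then have "u \<in> demazure_ideal l r" for u
    using ideal_mult[OF submod_ideal[OF demazure_ideal_submod[of r l]], of 1 u] by simp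
  then have "spanning {} (demazure_ideal l r)" by (auto simp: spanning_def intro: pm.span_base)
  then have "fusion_dim (add_mset (r mod l) (replicate_mset (r div l) l)) \<le> 0"
    unfolding demazure_ideal_def using spanning_card_ge[of "{}"] by (metis card.empty ex_mset finite.emptyI)
  moreover have "0 < fusion_dim M" for M by (induction M) auto
  ultimately show False by (metis not_le)
qed

lemma cdim_0: "cdim r 0 = 1"
proof -
  have "codim 0 (demazure_ideal 3 r) 1"
    unfolding codim_def
  proof (intro exI[of _ "{1}"] conjI allI impI)
    show "{1 :: ypoly} \<subseteq> homog size 0" using homog_mon[of "{#} :: nat multiset" size 0] by simp
    show "homog size 0 \<subseteq> pm.span ({1} \<union> demazure_ideal 3 r)"
    proof
      fix u :: ypoly assume "u \<in> homog size 0"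
      then have "k = {#}" if "k \<in> Poly_Mapping.keys u" for k using that by (auto simp: homog_def)
      then have "mon k \<in> pm.span ({1} \<union> demazure_ideal 3 r)" if "k \<in> Poly_Mapping.keys u" for k
        using that by (intro pm.span_base) force
      then show "u \<in> pm.span ({1} \<union> demazure_ideal 3 r)"
        by (rule mon_in_subspaceD[OF pm.subspace_span])
    qed
    fix c assume c: "(\<Sum>e\<in>{1}. smul (c e) e) \<in> demazure_ideal 3 r"
    show "\<forall>e\<in>{1}. c e = 0"
    proof (rule ccontr)
      assume "\<not> (\<forall>e\<in>{1}. c e = 0)"
      then have "c 1 \<noteq> 0" by simp
      moreover have "smul (inverse (c 1)) (smul (c 1) 1) \<in> demazure_ideal 3 r"
        by (rule ideal_ops(6)[OF submod_ideal[OF demazure_ideal_submod]]) (use c in simp)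
      ultimately show False using one_notin_demazure_ideal by simp
    qed
  qed auto
  with codim_cdim[of 0 r] show ?thesis
    using codim_unique[OF submod_subspace[OF demazure_ideal_submod]] by metis
qed

lemma ideal_flag_submod: "ideal_flag G n A rs \<Longrightarrow> submod n A"
  by (induction rule: ideal_flag.induct) (auto simp: submod_def is_ideal_def)

lemma ideal_flag_weights: "ideal_flag G n A rs \<Longrightarrow> r \<in> set rs \<Longrightarrow> \<exists>e. n = r + 2 * e"
  by (induction rule: ideal_flag.induct) auto

definition contrib :: "nat \<Rightarrow> nat \<Rightarrow> nat \<Rightarrow> nat" where
  "contrib n R r = (let e = (n - r) div 2 in if e \<le> R then cdim r (R - e) else 0)"

lemma ideal_flag_codim: "ideal_flag G n A rs \<Longrightarrow> codim R A (\<Sum>r\<leftarrow>rs. contrib n R r)"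
proof (induction rule: ideal_flag.induct)
  case ideal_flag_base
  show ?case unfolding codim_def by (intro exI[of _ "{}"]) (auto intro: pm.span_base)
next
  case (ideal_flag_step B rs A q e r)
  have e: "(n - r) div 2 = e" using ideal_flag_step.hyps by simp
  have "codim R A ((\<Sum>r\<leftarrow>rs. contrib n R r) + (if e \<le> R then cdim r (R - e) else 0))"
    using ideal_flag_step codim_cdim submod_component_size[OF ideal_flag_step.hyps(2)]
      submod_subspace[OF ideal_flag_submod[OF ideal_flag_step.hyps(1)]]
    by (intro codim_step[OF submod_subspace[OF ideal_flag_step.hyps(2)] _ ideal_flag_step.hyps(3)])
      auto
  then show ?case by (simp add: contrib_def e)
qed

text \<open>Both lists produce the same codimensions. A factor of weight \<open>n - 2 e\<close>
  contributes nothing to sizes below \<open>e\<close> and exactly 1 to size \<open>e\<close>, so the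
  system for the counts is unitriangular.\<close>

lemma ideal_flag_unique:
  assumes "ideal_flag G n A rs" "ideal_flag G' n A ss"
  shows "count_list rs r = count_list ss r"
proof -
  let ?S = "(\<lambda>e. n - 2 * e) ` {..n div 2}"
  have sum: "(\<Sum>r\<leftarrow>xs. contrib n R r) =
      (\<Sum>e\<le>n div 2. count_list xs (n - 2 * e) * (if e \<le> R then cdim (n - 2 * e) (R - e) else 0))"
    if P: "ideal_flag G'' n A xs" for G'' xs R
  proof -
    have "set xs \<subseteq> ?S"
    proof
      fix r assume "r \<in> set xs"
      then obtain e where "n = r + 2 * e" using ideal_flag_weights[OF P] by blast
      then have "r = n - 2 * e" "e \<le> n div 2" by auto
      then show "r \<in> ?S" by blast
    qed
    then have "(\<Sum>r\<leftarrow>xs. contrib n R r) = (\<Sum>r\<in>?S. count_list xs r * contrib n R r)"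
      by (intro sum_list_map_eq_sum_count2) auto
    also have "\<dots> = (\<Sum>e\<le>n div 2. count_list xs (n - 2 * e) * contrib n R (n - 2 * e))"
      by (subst sum.reindex) (auto simp: inj_on_def)
    also have "\<dots> = (\<Sum>e\<le>n div 2. count_list xs (n - 2 * e) * (if e \<le> R then cdim (n - 2 * e) (R - e) else 0))"
    proof (intro sum.cong refl)
      fix e assume "e \<in> {..n div 2}"
      then have "(n - (n - 2 * e)) div 2 = e" by auto
      then show "count_list xs (n - 2 * e) * contrib n R (n - 2 * e) =
        count_list xs (n - 2 * e) * (if e \<le> R then cdim (n - 2 * e) (R - e) else 0)"
        by (simp add: contrib_def)
    qed
    finally show ?thesis .
  qed
  have eq: "(\<Sum>r\<leftarrow>rs. contrib n R r) = (\<Sum>r\<leftarrow>ss. contrib n R r)" for R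
    using codim_unique[OF submod_subspace[OF ideal_flag_submod[OF assms(1)]]]
      ideal_flag_codim[OF assms(1)] ideal_flag_codim[OF assms(2)] by blast
  have main: "count_list rs (n - 2 * R) = count_list ss (n - 2 * R)" if "R \<le> n div 2" for R
    using that
  proof (induction R rule: less_induct)
    case (less R)
    have split: "(\<Sum>e\<le>n div 2. count_list xs (n - 2 * e) * (if e \<le> R then cdim (n - 2 * e) (R - e) else 0)) =
        count_list xs (n - 2 * R) + (\<Sum>e<R. count_list xs (n - 2 * e) * cdim (n - 2 * e) (R - e))" for xs
    proof -
      have "(\<Sum>e\<le>n div 2. count_list xs (n - 2 * e) * (if e \<le> R then cdim (n - 2 * e) (R - e) else 0)) =
          (\<Sum>e\<le>R. count_list xs (n - 2 * e) * cdim (n - 2 * e) (R - e))"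
        by (rule sum.mono_neutral_cong_right) (use less.prems in auto)
      also have "{..R} = insert R {..<R}" by auto
      finally show ?thesis by (simp add: cdim_0)
    qed
    have "(\<Sum>e<R. count_list rs (n - 2 * e) * cdim (n - 2 * e) (R - e)) =
        (\<Sum>e<R. count_list ss (n - 2 * e) * cdim (n - 2 * e) (R - e))"
      using less by (intro sum.cong refl) auto
    with eq[of R] show ?case
      unfolding sum[OF assms(1)] sum[OF assms(2)] split by simp
  qed
  show ?thesis
  proof (cases "r \<in> set rs \<union> set ss")
    case True
    then obtain e where "n = r + 2 * e"
      using ideal_flag_weights[OF assms(1)] ideal_flag_weights[OF assms(2)] by blast
    then show ?thesis using main[of e] by auto
  next
    case False
    then show ?thesis by (simp add: count_list_0_iff)
  qed
qed

section \<open>Presentations of graded modules\<close>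

definition graded_piece :: "('k \<Rightarrow> nat) \<Rightarrow> int \<Rightarrow> ('k \<Rightarrow>\<^sub>0 complex) set" where
  "graded_piece dg r = {v. \<forall>w\<in>Poly_Mapping.keys v. int (dg w) = r}"

lemma graded_piece_homog: "graded_piece dg (int d) = homog dg d"
  by (simp add: graded_piece_def homog_def)

lemma graded_piece_neg: "r < 0 \<Longrightarrow> graded_piece dg r = {0}"
proof -
  assume "r < 0"
  then have "v = 0" if "v \<in> graded_piece dg r" for v
    using that by (intro poly_mapping_eqI) (force simp: graded_piece_def in_keys_iff)
  then show ?thesis by (auto simp: graded_piece_def)
qed

lemma graded_piece_subspace: "pm.subspace (graded_piece dg r)"
  by (auto simp: pm.subspace_def graded_piece_def in_keys_iff lookup_add)

lemma graded_piece_mon [simp]: "mon w \<in> graded_piece dg r \<longleftrightarrow> int (dg w) = r"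
  by (simp add: graded_piece_def mon_def)

definition stable :: "(current \<Rightarrow> 'w \<Rightarrow> 'w) \<Rightarrow> 'w set \<Rightarrow> bool" where
  "stable L C \<longleftrightarrow> (\<forall>A\<in>sl2t. \<forall>u\<in>C. L A u \<in> C)"

definition tgraded :: "('k \<Rightarrow> nat) \<Rightarrow> ('k \<Rightarrow>\<^sub>0 complex) set \<Rightarrow> bool" where
  "tgraded dg S \<longleftrightarrow> (\<forall>u\<in>S. \<forall>d. component dg d u \<in> S)"

definition action :: "(current \<Rightarrow> ('k \<Rightarrow>\<^sub>0 complex) \<Rightarrow> ('k \<Rightarrow>\<^sub>0 complex)) \<Rightarrow> bool" where
  "action L \<longleftrightarrow> (\<forall>A. plinear (L A)) \<and> (\<forall>A A' u. L (A + A') u = L A u + L A' u) \<and>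
     (\<forall>c A u. L (scale_current c A) u = smul c (L A u))"

lemma actionD:
  assumes "action L"
  shows "L A (u + v) = L A u + L A v" "L A (smul c u) = smul c (L A u)" "L A 0 = 0"
    "L A (u - v) = L A u - L A v" "L (A + A') u = L A u + L A' u"
    "L (scale_current c A) u = smul c (L A u)"
  using assms by (auto simp: action_def plinear_add plinear_scale plinear_0 plinear_diff)

text \<open>\<open>M\<close> is the quotient \<open>B / N\<close> of a subspace \<open>B\<close> of a concrete space with an operation \<open>L\<close> of
  the current algebra, through the map \<open>p\<close>.  No Lie identity is required of \<open>L\<close>.\<close>

locale presentation =
  fixes L :: "current \<Rightarrow> ('k \<Rightarrow>\<^sub>0 complex) \<Rightarrow> ('k \<Rightarrow>\<^sub>0 complex)" and dg :: "'k \<Rightarrow> nat"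
    and B :: "('k \<Rightarrow>\<^sub>0 complex) set" and M :: "'v gr_module"
    and p :: "('k \<Rightarrow>\<^sub>0 complex) \<Rightarrow> 'v" and N :: "('k \<Rightarrow>\<^sub>0 complex) set"
  assumes L: "action L" and B: "pm.subspace B" and N: "pm.subspace N" and NB: "N \<subseteq> B"
    and LB: "stable L B" and LN: "stable L N"
    and carrier: "carrier M = p ` B"
    and p_add: "\<And>u v. u \<in> B \<Longrightarrow> v \<in> B \<Longrightarrow> p u \<oplus>\<^bsub>M\<^esub> p v = p (u + v)"
    and p_smul: "\<And>c u. u \<in> B \<Longrightarrow> c \<odot>\<^bsub>M\<^esub> p u = p (smul c u)"
    and p_act: "\<And>A u. A \<in> sl2t \<Longrightarrow> u \<in> B \<Longrightarrow> act M A (p u) = p (L A u)"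
    and p_zero: "\<zero>\<^bsub>M\<^esub> = p 0"
    and p_eq: "\<And>u v. u \<in> B \<Longrightarrow> v \<in> B \<Longrightarrow> p u = p v \<longleftrightarrow> u - v \<in> N"
    and p_grade: "\<And>r. grade M r = p ` (B \<inter> graded_piece dg r)"
begin

lemmas B_closed [simp, intro] = pm.subspace_0[OF B] pm.subspace_add[OF B] pm.subspace_scale[OF B]
  pm.subspace_diff[OF B] pm.subspace_neg[OF B]

lemmas N_closed = pm.subspace_0[OF N] pm.subspace_add[OF N] pm.subspace_scale[OF N]
  pm.subspace_diff[OF N] pm.subspace_neg[OF N]

lemma L_B [simp, intro]: "A \<in> sl2t \<Longrightarrow> u \<in> B \<Longrightarrow> L A u \<in> B"
  using LB by (simp add: stable_def)

lemma p_eq_zero: "u \<in> B \<Longrightarrow> p u = \<zero>\<^bsub>M\<^esub> \<longleftrightarrow> u \<in> N"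
  by (simp add: p_zero p_eq)

lemma abelian_group: "abelian_group M"
proof (rule abelian_groupI)
  fix x assume "x \<in> carrier M"
  then obtain u where u: "u \<in> B" "x = p u" by (auto simp: carrier)
  then have "p (- u) \<oplus>\<^bsub>M\<^esub> x = \<zero>\<^bsub>M\<^esub>" by (simp add: p_add p_zero)
  then show "\<exists>y\<in>carrier M. y \<oplus>\<^bsub>M\<^esub> x = \<zero>\<^bsub>M\<^esub>" using u carrier by blast
qed (auto simp: carrier p_add p_zero add_ac)

sublocale abelian_group M by (rule abelian_group)

lemma p_neg: "u \<in> B \<Longrightarrow> \<ominus>\<^bsub>M\<^esub> p u = p (- u)"
  by (rule minus_equality) (auto simp: carrier p_add p_zero)

lemma p_minus: "u \<in> B \<Longrightarrow> v \<in> B \<Longrightarrow> p u \<ominus>\<^bsub>M\<^esub> p v = p (u - v)"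
  by (simp add: a_minus_def p_neg p_add)

lemma module: "module complex_ring M"
  by (rule moduleI[OF cring_from_type_algebra])
    (auto simp: abelian_group carrier p_smul p_add ring_of_type_algebra_def
      pm.scale_left_distrib pm.scale_right_distrib)

lemma p_act_pow: "A \<in> sl2t \<Longrightarrow> u \<in> B \<Longrightarrow> (act M A ^^ k) (p u) = p ((L A ^^ k) u) \<and> (L A ^^ k) u \<in> B"
  by (induction k) (auto simp: p_act)

lemma image_iff_mem: "N \<subseteq> C \<Longrightarrow> C \<subseteq> B \<Longrightarrow> pm.subspace C \<Longrightarrow> u \<in> B \<Longrightarrow> p u \<in> p ` C \<longleftrightarrow> u \<in> C"
proof
  assume C: "N \<subseteq> C" "C \<subseteq> B" "pm.subspace C" "u \<in> B" "p u \<in> p ` C"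
  then obtain v where "v \<in> C" "u - v \<in> N" using p_eq by blast
  then have "(u - v) + v \<in> C" using C by (intro pm.subspace_add) auto
  then show "u \<in> C" by simp
qed auto

lemma submodule_image:
  assumes "C \<subseteq> B" "pm.subspace C"
  shows "submodule (p ` C) complex_ring M"
proof (rule module.submoduleI[OF module])
  show "p ` C \<subseteq> carrier M" using assms by (auto simp: carrier)
  show "\<zero>\<^bsub>M\<^esub> \<in> p ` C" using pm.subspace_0[OF assms(2)] by (auto simp: p_zero)
  show "\<ominus>\<^bsub>M\<^esub> a \<in> p ` C" if "a \<in> p ` C" for a
    using that assms pm.subspace_neg[OF assms(2)] by (force simp: p_neg subset_iff)
  show "a \<oplus>\<^bsub>M\<^esub> b \<in> p ` C" if "a \<in> p ` C" "b \<in> p ` C" for a b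
    using that assms pm.subspace_add[OF assms(2)] by (force simp: p_add subset_iff)
  show "a \<odot>\<^bsub>M\<^esub> x \<in> p ` C" if "x \<in> p ` C" for a x
    using that assms pm.subspace_scale[OF assms(2)] by (force simp: p_smul subset_iff)
qed

lemma act_submodule_image:
  assumes "C \<subseteq> B" "pm.subspace C" "stable L C"
  shows "act_submodule (p ` C) M"
  unfolding act_submodule_def
  using submodule_image[OF assms(1,2)] assms by (auto simp: p_act subset_iff stable_def)

lemma act_submodule_preimage:
  assumes "act_submodule F M"
  shows "F \<subseteq> carrier M" "pm.subspace {u \<in> B. p u \<in> F}" "stable L {u \<in> B. p u \<in> F}"
proof -
  have F: "submodule F complex_ring M" and act: "\<And>A v. A \<in> sl2t \<Longrightarrow> v \<in> F \<Longrightarrow> act M A v \<in> F"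
    using assms by (auto simp: act_submodule_def)
  note F = module.submoduleE[OF module F]
  show "F \<subseteq> carrier M" by (rule F(1))
  have "\<zero>\<^bsub>M\<^esub> \<in> F"
    using assms by (metis act_submodule_def monoid.simps(2) submodule.axioms(1) subgroup.one_closed)
  then show "pm.subspace {u \<in> B. p u \<in> F}"
    using F(4,5) by (auto simp: pm.subspace_def p_zero ring_of_type_algebra_def simp flip: p_add p_smul)
  show "stable L {u \<in> B. p u \<in> F}"
    using act by (auto simp: stable_def simp flip: p_act)
qed

lemma coset:
  assumes "C \<subseteq> B" "u \<in> B"
  shows "p ` C +>\<^bsub>M\<^esub> p u = p ` {w \<in> B. w - u \<in> C}"
proof -
  have "p ` C +>\<^bsub>M\<^esub> p u = (\<lambda>c. p (c + u)) ` C"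
    using assms by (force simp: a_r_coset_def' p_add subset_iff)
  also have "\<dots> = p ` ((\<lambda>c. c + u) ` C)" by (simp add: image_image)
  also have "(\<lambda>c. c + u) ` C = {w \<in> B. w - u \<in> C}"
  proof
    show "{w \<in> B. w - u \<in> C} \<subseteq> (\<lambda>c. c + u) ` C"
    proof
      fix w assume "w \<in> {w \<in> B. w - u \<in> C}"
      then have "w = (w - u) + u" "w - u \<in> C" by auto
      then show "w \<in> (\<lambda>c. c + u) ` C" by blast
    qed
  qed (use assms in auto)
  finally show ?thesis .
qed

lemma coset_eq:
  assumes C: "N \<subseteq> C" "C \<subseteq> B" "pm.subspace C" and uv: "u \<in> B" "v \<in> B"
  shows "p ` C +>\<^bsub>M\<^esub> p u = p ` C +>\<^bsub>M\<^esub> p v \<longleftrightarrow> u - v \<in> C"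
proof
  assume "p ` C +>\<^bsub>M\<^esub> p u = p ` C +>\<^bsub>M\<^esub> p v"
  moreover have "p u \<in> p ` {w \<in> B. w - u \<in> C}" using uv pm.subspace_0[OF C(3)] by auto
  ultimately obtain w where w: "p u = p w" "w \<in> B" "w - v \<in> C"
    using coset[OF C(2)] uv by auto
  then have "u - w \<in> C" using p_eq uv C(1) by blast
  then have "(u - w) + (w - v) \<in> C" using w pm.subspace_add[OF C(3)] by blast
  then show "u - v \<in> C" by simp
next
  assume *: "u - v \<in> C"
  have "{w \<in> B. w - u \<in> C} = {w \<in> B. w - v \<in> C}"
  proof (intro Collect_cong conj_cong refl)
    fix w
    have "w - u \<in> C \<longleftrightarrow> (w - u) + (u - v) \<in> C"
      using * C(3) pm.subspace_add pm.subspace_diff by (metis add_diff_cancel_right')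
    then show "w - u \<in> C \<longleftrightarrow> w - v \<in> C" by simp
  qed
  then show "p ` C +>\<^bsub>M\<^esub> p u = p ` C +>\<^bsub>M\<^esub> p v" using coset[OF C(2)] uv by simp
qed

text \<open>The quotient is presented by the same \<open>B\<close> with a larger kernel, so nested
  quotients never leave the concrete space.\<close>

lemma quotient_presentation:
  assumes C: "N \<subseteq> C" "C \<subseteq> B" "pm.subspace C" "stable L C"
  shows "presentation L dg B (quotient_module M (p ` C)) (\<lambda>u. p ` C +>\<^bsub>M\<^esub> p u) C"
proof -
  let ?Q = "quotient_module M (p ` C)" and ?q = "\<lambda>u. p ` C +>\<^bsub>M\<^esub> p u"
  have mem: "x \<in> ?q u \<longleftrightarrow> (\<exists>w\<in>B. x = p w \<and> w - u \<in> C)" if "u \<in> B" for x u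
    using coset[OF C(2) that] by auto
  have self: "p u \<in> ?q u" if "u \<in> B" for u
    using that mem[OF that] pm.subspace_0[OF C(3)] by force
  have map: "(\<Union>v\<in>?q u. p ` C +>\<^bsub>M\<^esub> f v) = ?q (g u)"
    if u: "u \<in> B" and fg: "\<And>w. w \<in> B \<Longrightarrow> f (p w) = p (g w)" "\<And>w. w \<in> B \<Longrightarrow> g w \<in> B"
      "\<And>w. w \<in> B \<Longrightarrow> w - u \<in> C \<Longrightarrow> g w - g u \<in> C" for u f g
  proof -
    have "p ` C +>\<^bsub>M\<^esub> f v = ?q (g u)" if v: "v \<in> ?q u" for v
    proof -
      obtain w where "w \<in> B" "v = p w" "w - u \<in> C" using v mem[OF u] by auto
      then show ?thesis using coset_eq[OF C(1-3), of "g w" "g u"] fg u by simp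
    qed
    then show ?thesis using self[OF u] by blast
  qed
  show ?thesis
  proof (unfold_locales)
    show "carrier ?Q = ?q ` B" by (auto simp: quotient_module_def A_RCOSETS_def' carrier)
    fix u v assume uv: "u \<in> B" "v \<in> B"
    show "?q u = ?q v \<longleftrightarrow> u - v \<in> C" by (rule coset_eq[OF C(1-3) uv])
    show "?q u \<oplus>\<^bsub>?Q\<^esub> ?q v = ?q (u + v)"
    proof -
      have "?q u <+>\<^bsub>M\<^esub> ?q v = ?q (u + v)"
      proof (intro subset_antisym subsetI)
        fix x assume "x \<in> ?q u <+>\<^bsub>M\<^esub> ?q v"
        then obtain w w' where *: "w \<in> B" "w - u \<in> C" "w' \<in> B" "w' - v \<in> C" "x = p w \<oplus>\<^bsub>M\<^esub> p w'"
          using mem uv by (auto simp: set_add_def')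
        then have "x = p (w + w')" "(w + w') - (u + v) \<in> C"
          using pm.subspace_add[OF C(3) *(2,4)] by (simp_all add: p_add algebra_simps)
        then show "x \<in> ?q (u + v)" using mem[of "u + v"] uv * by blast
      next
        fix x assume "x \<in> ?q (u + v)"
        then obtain w where *: "w \<in> B" "x = p w" "w - (u + v) \<in> C" using mem[of "u + v"] uv by auto
        have "x = p (w - v) \<oplus>\<^bsub>M\<^esub> p v" using * uv by (simp add: p_add)
        moreover have "p (w - v) \<in> ?q u" using * uv mem[of u] by (force simp: algebra_simps)
        ultimately show "x \<in> ?q u <+>\<^bsub>M\<^esub> ?q v" using self[OF uv(2)] by (auto simp: set_add_def')
      qed
      then show ?thesis by (simp add: quotient_module_def)
    qed
  next
    fix c u assume u: "u \<in> B"
    show "c \<odot>\<^bsub>?Q\<^esub> ?q u = ?q (smul c u)"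
      using map[OF u, of "\<lambda>v. c \<odot>\<^bsub>M\<^esub> v" "smul c"] pm.subspace_scale[OF C(3)]
      by (simp add: quotient_module_def p_smul flip: pm.scale_right_diff_distrib)
  next
    fix A u assume A: "A \<in> sl2t" and u: "u \<in> B"
    show "act ?Q A (?q u) = ?q (L A u)"
      using map[OF u, of "act M A" "L A"] A C(4)
      by (simp add: quotient_module_def p_act stable_def flip: actionD(4)[OF L])
  next
    have "?q 0 = p ` {w \<in> B. w - 0 \<in> C}" by (rule coset[OF C(2)]) simp
    also have "{w \<in> B. w - 0 \<in> C} = C" using C(2) by auto
    finally show "\<zero>\<^bsub>?Q\<^esub> = ?q 0" by (simp add: quotient_module_def)
    show "grade ?Q r = ?q ` (B \<inter> graded_piece dg r)" for r
      by (simp add: quotient_module_def p_grade image_image)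
  qed (use L B LB C in auto)
qed

lemma restrict_presentation:
  assumes C: "N \<subseteq> C" "C \<subseteq> B" "pm.subspace C" "stable L C"
  shows "presentation L dg C (restrict_module M (p ` C)) p N"
proof (unfold_locales)
  fix r
  have "p ` C \<inter> p ` (B \<inter> graded_piece dg r) = p ` (C \<inter> graded_piece dg r)"
  proof (intro subset_antisym subsetI)
    fix x assume *: "x \<in> p ` C \<inter> p ` (B \<inter> graded_piece dg r)"
    then obtain u where "u \<in> B" "u \<in> graded_piece dg r" "x = p u" by blast
    moreover from this have "u \<in> C" using * image_iff_mem[OF C(1-3), of u] by simp
    ultimately show "x \<in> p ` (C \<inter> graded_piece dg r)" by simp
  qed (use C in auto)
  then show "grade (restrict_module M (p ` C)) r = p ` (C \<inter> graded_piece dg r)"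
    by (simp add: restrict_module_def p_grade)
qed (use L N LN C in \<open>auto simp: restrict_module_def p_add p_smul p_act p_zero p_eq subset_iff\<close>)

definition least_stable :: "('k \<Rightarrow>\<^sub>0 complex) set \<Rightarrow> ('k \<Rightarrow>\<^sub>0 complex) set" where
  "least_stable T = \<Inter>{C. pm.subspace C \<and> stable L C \<and> T \<subseteq> C}"

lemma least_stable: "pm.subspace (least_stable T)" "stable L (least_stable T)" "T \<subseteq> least_stable T"
  by (auto simp: least_stable_def pm.subspace_def stable_def)

lemma least_stable_least: "pm.subspace C \<Longrightarrow> stable L C \<Longrightarrow> T \<subseteq> C \<Longrightarrow> least_stable T \<subseteq> C"
  by (auto simp: least_stable_def)

lemma generated_submodule_image:
  assumes "B = UNIV"
  shows "generated_submodule M (p ` T) = p ` least_stable (N \<union> T)"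
proof
  have "act_submodule (p ` least_stable (N \<union> T)) M"
    by (rule act_submodule_image) (simp_all add: assms least_stable)
  then show "generated_submodule M (p ` T) \<subseteq> p ` least_stable (N \<union> T)"
    using least_stable(3)[of "N \<union> T"] unfolding generated_submodule_def by blast
  show "p ` least_stable (N \<union> T) \<subseteq> generated_submodule M (p ` T)"
    unfolding generated_submodule_def
  proof (rule Inter_greatest, clarify)
    fix F u assume F: "act_submodule F M" "p ` T \<subseteq> F" and u: "u \<in> least_stable (N \<union> T)"
    have sub: "pm.subspace {u \<in> B. p u \<in> F}" by (rule act_submodule_preimage[OF F(1)])
    have "p u \<in> F" if "u \<in> N" for u
    proof -
      have "p u = p 0" using that NB by (subst p_eq) auto
      then show ?thesis using pm.subspace_0[OF sub] by simp
    qed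
    then have "N \<union> T \<subseteq> {u \<in> B. p u \<in> F}" using F(2) assms by auto
    then have "least_stable (N \<union> T) \<subseteq> {u \<in> B. p u \<in> F}"
      by (rule least_stable_least[OF sub act_submodule_preimage(3)[OF F(1)]])
    with u show "p u \<in> F" by blast
  qed
qed

lemma generated_quotient_presentation:
  assumes "B = UNIV"
  shows "presentation L dg UNIV (quotient_module M (generated_submodule M (p ` T)))
    (\<lambda>u. generated_submodule M (p ` T) +>\<^bsub>M\<^esub> p u) (least_stable (N \<union> T))"
  using quotient_presentation[of "least_stable (N \<union> T)"] least_stable[of "N \<union> T"]
  unfolding generated_submodule_image[OF assms] by (simp add: assms)

lemma p_sum: "finite I \<Longrightarrow> (\<And>i. i \<in> I \<Longrightarrow> g i \<in> B) \<Longrightarrow> (\<Oplus>\<^bsub>M\<^esub>i\<in>I. p (g i)) = p (sum g I) \<and> sum g I \<in> B"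
proof (induction I rule: finite_induct)
  case (insert i I)
  have "(\<Oplus>\<^bsub>M\<^esub>i\<in>insert i I. p (g i)) = p (g i) \<oplus>\<^bsub>M\<^esub> (\<Oplus>\<^bsub>M\<^esub>i\<in>I. p (g i))"
    using insert by (intro finsum_insert) (auto simp: carrier)
  with insert show ?case by (simp add: p_add)
qed (simp add: p_zero)

lemma finsum_support:
  fixes g :: "int \<Rightarrow> 'v"
  assumes "finite I" "\<And>r. r \<in> I \<Longrightarrow> h r \<in> B" "\<And>r. r \<in> I \<Longrightarrow> g r = p (h r)"
    "{r. g r \<noteq> \<zero>\<^bsub>M\<^esub>} \<subseteq> I"
  shows "(\<Oplus>\<^bsub>M\<^esub>r\<in>{r. g r \<noteq> \<zero>\<^bsub>M\<^esub>}. g r) = p (\<Sum>r\<in>I. h r) \<and> (\<Sum>r\<in>I. h r) \<in> B"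
proof -
  have "(\<Oplus>\<^bsub>M\<^esub>r\<in>{r. g r \<noteq> \<zero>\<^bsub>M\<^esub>}. g r) = (\<Oplus>\<^bsub>M\<^esub>r\<in>I. p (h r))"
    by (rule add.finprod_mono_neutral_cong_left) (use assms in \<open>auto simp: carrier\<close>)
  then show ?thesis using p_sum[of I h] assms by simp
qed

text \<open>The bracket identity is asked only modulo \<open>N\<close>. Existence of homogeneous
  decompositions comes from the components of a representative in \<open>B\<close>; uniqueness holds
  because a representative of zero has all its components in \<open>N\<close>.\<close>

lemma graded_module:
  assumes lie: "\<And>A A' u. A \<in> sl2t \<Longrightarrow> A' \<in> sl2t \<Longrightarrow> u \<in> B \<Longrightarrow>
      L (bracket A A') u - (L A (L A' u) - L A' (L A u)) \<in> N"
    and deg: "\<And>a u r k. a \<in> sl2 \<Longrightarrow> u \<in> graded_piece dg r \<Longrightarrow>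
      L (tens a (Polynomial.monom 1 k)) u \<in> graded_piece dg (r + int k)"
    and tB: "tgraded dg B" and tN: "tgraded dg N"
  shows "graded_module M"
proof -
  interpret module complex_ring M by (rule module)
  have sl2t_closed: "A + A' \<in> sl2t" "scale_current c A \<in> sl2t" "bracket A A' \<in> sl2t"
    if "A \<in> sl2t" "A' \<in> sl2t" for A A' c
    using that
    by (auto simp: sl2t_def trace_def sum_2 scale_current_def bracket_def matrix_matrix_mult_def
        algebra_simps simp flip: smult_add_right)
  show ?thesis
  proof (intro graded_module.intro module graded_module_axioms.intro)
    fix A v assume A: "A \<in> sl2t" and "v \<in> carrier M"
    then obtain u where u: "u \<in> B" "v = p u" by (auto simp: carrier)
    show "act M A v \<in> carrier M" using A u by (auto simp: carrier p_act)
    show "act M (scale_current c A) v = c \<odot>\<^bsub>M\<^esub> act M A v" for c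
      using A u sl2t_closed(2)[OF A A] by (simp add: p_act p_smul actionD[OF L])
    show "act M A (c \<odot>\<^bsub>M\<^esub> v) = c \<odot>\<^bsub>M\<^esub> act M A v" for c
      using A u by (simp add: p_act p_smul actionD[OF L])
    fix A' assume A': "A' \<in> sl2t"
    show "act M (A + A') v = act M A v \<oplus>\<^bsub>M\<^esub> act M A' v"
      using A A' u sl2t_closed(1)[OF A A'] by (simp add: p_act p_add actionD[OF L])
    have "p (L (bracket A A') u) = p (L A (L A' u) - L A' (L A u))"
      using lie A A' u sl2t_closed(3)[OF A A'] by (subst p_eq) auto
    then show "act M (bracket A A') v = act M A (act M A' v) \<ominus>\<^bsub>M\<^esub> act M A' (act M A v)"
      using A A' u sl2t_closed(3)[OF A A'] by (simp add: p_act p_minus)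
  next
    fix A v w assume A: "A \<in> sl2t" and "v \<in> carrier M" "w \<in> carrier M"
    then obtain u u' where "u \<in> B" "v = p u" "u' \<in> B" "w = p u'" by (auto simp: carrier)
    then show "act M A (v \<oplus>\<^bsub>M\<^esub> w) = act M A v \<oplus>\<^bsub>M\<^esub> act M A w"
      using A by (simp add: p_act p_add actionD[OF L])
  next
    fix r
    show "submodule (grade M r) complex_ring M"
      unfolding p_grade by (rule submodule_image) (auto intro: pm.subspace_inter B graded_piece_subspace)
  next
    fix a v r k assume a: "a \<in> sl2" and "v \<in> grade M r"
    then obtain u where u: "u \<in> B" "u \<in> graded_piece dg r" "v = p u" by (auto simp: p_grade)
    have "tens a (Polynomial.monom 1 k) \<in> sl2t" by (rule tens_in_sl2t[OF a])
    then show "act M (tens a (Polynomial.monom 1 k)) v \<in> grade M (r + int k)"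
      using u deg[OF a u(2)] by (auto simp: p_act p_grade)
  next
    fix v assume "v \<in> carrier M"
    then obtain u where u: "u \<in> B" "v = p u" by (auto simp: carrier)
    define f where "f r = (if 0 \<le> r then p (component dg (nat r) u) else \<zero>\<^bsub>M\<^esub>)" for r
    show "\<exists>!f. (\<forall>r. f r \<in> grade M r) \<and> finite {r. f r \<noteq> \<zero>\<^bsub>M\<^esub>} \<and> v = (\<Oplus>\<^bsub>M\<^esub>r\<in>{r. f r \<noteq> \<zero>\<^bsub>M\<^esub>}. f r)"
    proof (rule ex1I[of _ f])
      have partB: "component dg d u \<in> B" for d using tB u by (simp add: tgraded_def)
      have 1: "f r \<in> grade M r" for r
      proof (cases "0 \<le> r")
        case True
        then have "component dg (nat r) u \<in> graded_piece dg r"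
          using component_homog[of dg "nat r" u] graded_piece_homog[of dg "nat r"] by simp
        with True partB show ?thesis by (auto simp: f_def p_grade)
      next
        case False
        then show ?thesis by (auto simp: f_def p_grade p_zero graded_piece_neg)
      qed
      let ?I = "int ` dg ` Poly_Mapping.keys u"
      have I: "{r. f r \<noteq> \<zero>\<^bsub>M\<^esub>} \<subseteq> ?I"
      proof
        fix r assume "r \<in> {r. f r \<noteq> \<zero>\<^bsub>M\<^esub>}"
        then have r: "0 \<le> r" "p (component dg (nat r) u) \<noteq> p 0" by (auto simp: f_def p_zero split: if_splits)
        then have "nat r \<in> dg ` Poly_Mapping.keys u" using component_eq_0 by metis
        then show "r \<in> ?I" using r(1) by (metis image_eqI int_nat_eq)
      qed
      have "(\<Oplus>\<^bsub>M\<^esub>r\<in>{r. f r \<noteq> \<zero>\<^bsub>M\<^esub>}. f r) = p (\<Sum>r\<in>?I. component dg (nat r) u)"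
        by (rule conjunct1[OF finsum_support[OF _ _ _ I]]) (use partB in \<open>auto simp: f_def\<close>)
      also have "(\<Sum>r\<in>?I. component dg (nat r) u) = (\<Sum>d\<in>dg ` Poly_Mapping.keys u. component dg d u)"
        by (subst sum.reindex) (auto simp: inj_on_def)
      also have "\<dots> = u" by (rule component_sum_eq) auto
      finally have "v = (\<Oplus>\<^bsub>M\<^esub>r\<in>{r. f r \<noteq> \<zero>\<^bsub>M\<^esub>}. f r)" using u(2) by simp
      moreover have "finite {r. f r \<noteq> \<zero>\<^bsub>M\<^esub>}" by (rule finite_subset[OF I]) simp
      ultimately show "(\<forall>r. f r \<in> grade M r) \<and> finite {r. f r \<noteq> \<zero>\<^bsub>M\<^esub>} \<and>
          v = (\<Oplus>\<^bsub>M\<^esub>r\<in>{r. f r \<noteq> \<zero>\<^bsub>M\<^esub>}. f r)" using 1 by blast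
      fix g assume g: "(\<forall>r. g r \<in> grade M r) \<and> finite {r. g r \<noteq> \<zero>\<^bsub>M\<^esub>} \<and>
          v = (\<Oplus>\<^bsub>M\<^esub>r\<in>{r. g r \<noteq> \<zero>\<^bsub>M\<^esub>}. g r)"
      then have "\<exists>w. w \<in> B \<and> w \<in> graded_piece dg r \<and> g r = p w" for r unfolding p_grade by blast
      then obtain h where h: "\<And>r. h r \<in> B" "\<And>r. h r \<in> graded_piece dg r" "\<And>r. g r = p (h r)" by metis
      define K where "K = {r. g r \<noteq> \<zero>\<^bsub>M\<^esub>}"
      have K: "finite K" using g by (simp add: K_def)
      have sK: "v = p (\<Sum>r\<in>K. h r)" "(\<Sum>r\<in>K. h r) \<in> B"
        using finsum_support[OF K h(1) h(3)] g by (auto simp: K_def)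
      then have uK: "u - (\<Sum>r\<in>K. h r) \<in> N" using p_eq[OF u(1) sK(2)] u(2) by simp
      show "g = f"
      proof
        fix r
        show "g r = f r"
        proof (cases "0 \<le> r")
          case False
          then have "h r = 0" using h(2)[of r] by (simp add: graded_piece_neg)
          with False show ?thesis using h(3)[of r] by (simp add: f_def p_zero)
        next
          case True
          have "component dg (nat r) (h r') = (if r' = r then h r else 0)" for r'
          proof (cases "0 \<le> r'")
            case T: True
            then have "h r' \<in> homog dg (nat r')" using h(2)[of r'] graded_piece_homog[of dg "nat r'"] by simp
            from component_of_homog[OF this, of "nat r"] show ?thesis using True T by auto
          next
            case False
            then have "h r' = 0" using h(2)[of r'] by (simp add: graded_piece_neg)
            with False True show ?thesis by auto
          qed
          then have "component dg (nat r) (\<Sum>r\<in>K. h r) = (if r \<in> K then h r else 0)"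
            by (simp add: component_sum K)
          then have pr: "component dg (nat r) u - (if r \<in> K then h r else 0) \<in> N"
            using tN[unfolded tgraded_def, rule_format, OF uK, of "nat r"] by (simp add: component_diff)
          have "p (component dg (nat r) u) = p (if r \<in> K then h r else 0)"
            using p_eq[OF partB, of "if r \<in> K then h r else 0" "nat r"] pr by (simp add: h(1))
          also have "\<dots> = g r" using h(3)[of r] by (auto simp: K_def p_zero)
          finally show ?thesis using True by (simp add: f_def)
        qed
      qed
    qed
  qed
qed

end

section \<open>The current algebra action on the polynomial ring\<close>

definition poly_apply :: "complex poly \<Rightarrow> (nat \<Rightarrow> ('k \<Rightarrow>\<^sub>0 complex) \<Rightarrow> 'l \<Rightarrow>\<^sub>0 complex) \<Rightarrow>
    ('k \<Rightarrow>\<^sub>0 complex) \<Rightarrow> 'l \<Rightarrow>\<^sub>0 complex" where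
  "poly_apply f T u = (\<Sum>p\<le>Polynomial.degree f. smul (Polynomial.coeff f p) (T p u))"

lemma poly_apply_bound: "Polynomial.degree f \<le> n \<Longrightarrow> poly_apply f T u = (\<Sum>p\<le>n. smul (Polynomial.coeff f p) (T p u))"
  unfolding poly_apply_def by (rule sum.mono_neutral_left) (auto simp: coeff_eq_0)

lemma poly_apply_add: "poly_apply (f + g) T u = poly_apply f T u + poly_apply g T u"
proof -
  let ?n = "max (Polynomial.degree f) (Polynomial.degree g)"
  have "Polynomial.degree (f + g) \<le> ?n" by (rule degree_add_le) auto
  then show ?thesis
    by (simp add: poly_apply_bound[of _ ?n] pm.scale_left_distrib sum.distrib)
qed

lemma poly_apply_smult: "poly_apply (Polynomial.smult c f) T u = smul c (poly_apply f T u)"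
  by (cases "c = 0") (simp_all add: poly_apply_def pm.scale_sum_right)

lemma poly_apply_0 [simp]: "poly_apply 0 T u = 0"
  by (simp add: poly_apply_def)

lemma poly_apply_minus: "poly_apply (- f) T u = - poly_apply f T u"
  using poly_apply_add[of "- f" f T u] by (simp add: eq_neg_iff_add_eq_0)

lemma poly_apply_diff: "poly_apply (f - g) T u = poly_apply f T u - poly_apply g T u"
  using poly_apply_add[of f "- g" T u] by (simp add: poly_apply_minus)

lemma poly_apply_monom: "poly_apply (Polynomial.monom c p) T u = smul c (T p u)"
proof -
  have "Polynomial.degree (Polynomial.monom c p) \<le> p" by (rule degree_monom_le)
  then have "poly_apply (Polynomial.monom c p) T u = (\<Sum>q\<le>p. if q = p then smul c (T p u) else 0)"
    unfolding poly_apply_bound[OF \<open>_ \<le> p\<close>] by (intro sum.cong refl) simp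
  then show ?thesis by simp
qed

lemma poly_apply_linear: "(\<And>p. plinear (T p)) \<Longrightarrow> plinear (poly_apply f T)"
  by (rule plinearI)
    (simp_all add: poly_apply_def plinear_add plinear_scale pm.scale_right_distrib sum.distrib
      pm.scale_sum_right pm.scale_left_commute mult.commute)

lemma poly_monom_induct [case_names add monom]:
  assumes "\<And>f g. P f \<Longrightarrow> P g \<Longrightarrow> P (f + g)" "\<And>c k. P (Polynomial.monom c k)"
  shows "P (f :: complex poly)"
proof -
  have "P (\<Sum>i\<le>n. Polynomial.monom (Polynomial.coeff f i) i)" for n
    by (induction n) (auto intro: assms)
  from this[of "Polynomial.degree f"] show ?thesis by (simp add: poly_as_sum_of_monoms)
qed

lemma poly_apply_comm:
  assumes lin: "\<And>p. plinear (T p)" "\<And>p. plinear (T' p)"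
    and comm: "\<And>p q. T p (T' q u) - T' q (T p u) = smul k (T'' (p + q) u)"
  shows "poly_apply f T (poly_apply g T' u) - poly_apply g T' (poly_apply f T u) = smul k (poly_apply (f * g) T'' u)"
proof (induction f rule: poly_monom_induct)
  case (add f1 f2)
  have "poly_apply (f1 + f2) T (poly_apply g T' u) - poly_apply g T' (poly_apply (f1 + f2) T u) =
      (poly_apply f1 T (poly_apply g T' u) - poly_apply g T' (poly_apply f1 T u)) +
      (poly_apply f2 T (poly_apply g T' u) - poly_apply g T' (poly_apply f2 T u))"
    by (simp add: poly_apply_add plinear_add[OF poly_apply_linear[OF lin(2)]])
  with add show ?case by (simp add: poly_apply_add distrib_right pm.scale_right_distrib)
next
  case (monom c p)
  show ?case
  proof (induction g rule: poly_monom_induct)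
    case (add g1 g2)
    have "poly_apply (Polynomial.monom c p) T (poly_apply (g1 + g2) T' u) -
        poly_apply (g1 + g2) T' (poly_apply (Polynomial.monom c p) T u) =
      (poly_apply (Polynomial.monom c p) T (poly_apply g1 T' u) - poly_apply g1 T' (poly_apply (Polynomial.monom c p) T u)) +
      (poly_apply (Polynomial.monom c p) T (poly_apply g2 T' u) - poly_apply g2 T' (poly_apply (Polynomial.monom c p) T u))"
      by (simp add: poly_apply_add plinear_add[OF poly_apply_linear[OF lin(1)]])
    with add show ?case by (simp add: poly_apply_add distrib_left pm.scale_right_distrib)
  next
    case (monom d q)
    have "T p (smul d (T' q u)) = smul d (T p (T' q u))" "T' q (smul c (T p u)) = smul c (T' q (T p u))"
      by (simp_all add: plinear_scale lin)
    then have "poly_apply (Polynomial.monom c p) T (poly_apply (Polynomial.monom d q) T' u) -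
        poly_apply (Polynomial.monom d q) T' (poly_apply (Polynomial.monom c p) T u) =
        smul (c * d) (T p (T' q u) - T' q (T p u))"
      by (simp add: poly_apply_monom pm.scale_right_diff_distrib mult.commute)
    then show ?case by (simp add: comm poly_apply_monom mult_monom mult.commute)
  qed
qed

text \<open>The lower right entry is left out in agreement with \<open>coord\<close>: on traceless
  matrices it is minus the upper left one.\<close>

definition current_apply :: "(nat \<Rightarrow> ('k \<Rightarrow>\<^sub>0 complex) \<Rightarrow> ('k \<Rightarrow>\<^sub>0 complex)) \<Rightarrow> (nat \<Rightarrow> ('k \<Rightarrow>\<^sub>0 complex) \<Rightarrow> ('k \<Rightarrow>\<^sub>0 complex)) \<Rightarrow>
    (nat \<Rightarrow> ('k \<Rightarrow>\<^sub>0 complex) \<Rightarrow> ('k \<Rightarrow>\<^sub>0 complex)) \<Rightarrow> current \<Rightarrow> ('k \<Rightarrow>\<^sub>0 complex) \<Rightarrow> ('k \<Rightarrow>\<^sub>0 complex)" where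
  "current_apply TX TY TH A u = poly_apply (A $ 1 $ 2) TX u + poly_apply (A $ 2 $ 1) TY u + poly_apply (A $ 1 $ 1) TH u"

lemma current_apply_tens:
  "current_apply TX TY TH (tens a (Polynomial.monom 1 p)) u =
     smul (a $ 1 $ 2) (TX p u) + smul (a $ 2 $ 1) (TY p u) + smul (a $ 1 $ 1) (TH p u)"
  by (simp add: current_apply_def tens_def poly_apply_smult poly_apply_monom)

lemma sl2_entries [simp]:
  "sl2_x $ 1 $ 1 = 0" "sl2_x $ 1 $ 2 = 1" "sl2_x $ 2 $ 1 = 0" "sl2_x $ 2 $ 2 = 0"
  "sl2_y $ 1 $ 1 = 0" "sl2_y $ 1 $ 2 = 0" "sl2_y $ 2 $ 1 = 1" "sl2_y $ 2 $ 2 = 0"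
  "sl2_h $ 1 $ 1 = 1" "sl2_h $ 1 $ 2 = 0" "sl2_h $ 2 $ 1 = 0" "sl2_h $ 2 $ 2 = -1"
  by (simp_all add: sl2_x_def sl2_y_def sl2_h_def)

lemma sl2_mem [simp]: "sl2_x \<in> sl2" "sl2_y \<in> sl2" "sl2_h \<in> sl2"
  by (simp_all add: sl2_def trace_def sum_2)

lemma tens_mem [simp]:
  "tens sl2_x f \<in> sl2t" "tens sl2_y f \<in> sl2t" "tens sl2_h f \<in> sl2t"
  by (simp_all add: tens_in_sl2t)

lemma bracket_nth: "bracket A B $ i $ j = (\<Sum>k\<in>UNIV. A $ i $ k * B $ k $ j) - (\<Sum>k\<in>UNIV. B $ i $ k * A $ k $ j)"
  by (simp add: bracket_def matrix_matrix_mult_def)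

lemma action_current_apply:
  assumes "\<And>p. plinear (TX p)" "\<And>p. plinear (TY p)" "\<And>p. plinear (TH p)"
  shows "action (current_apply TX TY TH)"
  using poly_apply_linear[OF assms(1)] poly_apply_linear[OF assms(2)] poly_apply_linear[OF assms(3)]
  by (auto simp: action_def current_apply_def poly_apply_add poly_apply_smult scale_current_def pm.scale_right_distrib
      intro!: plinearI simp: plinear_add plinear_scale)

definition verma_act :: "nat \<Rightarrow> current \<Rightarrow> ypoly \<Rightarrow> ypoly" where
  "verma_act n = current_apply (xop n) (\<lambda>p u. yv p * u) (hop n)"

lemma action_verma_act: "action (verma_act n)"
  unfolding verma_act_def by (rule action_current_apply) (rule plinear_xop plinear_mult_left plinear_hop)+

lemma stable_verma_act: "submod n A \<Longrightarrow> stable (verma_act n) A"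
proof -
  assume A: "submod n A"
  note S = submod_subspace[OF A]
  have "poly_apply f T u \<in> A" if "\<And>p. T p u \<in> A" for f T and u :: ypoly
    unfolding poly_apply_def by (intro pm.subspace_sum[OF S] pm.subspace_scale[OF S] that)
  then show ?thesis
    using A unfolding stable_def verma_act_def current_apply_def
    by (auto simp: submod_def is_ideal_def intro!: pm.subspace_add[OF S])
qed

lemma verma_act_xyh [simp]:
  "verma_act n (tens sl2_x (Polynomial.monom 1 p)) u = xop n p u"
  "verma_act n (tens sl2_y (Polynomial.monom 1 p)) u = yv p * u"
  "verma_act n (tens sl2_h (Polynomial.monom 1 p)) u = hop n p u"
  by (simp_all add: verma_act_def current_apply_tens)

lemma submod_of_stable: "pm.subspace A \<Longrightarrow> stable (verma_act n) A \<Longrightarrow> submod n A"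
  unfolding submod_def is_ideal_def stable_def using verma_act_xyh tens_mem by metis

lemma verma_act_bracket:
  assumes "A \<in> sl2t" "B \<in> sl2t"
  shows "verma_act n (bracket A B) u = verma_act n A (verma_act n B u) - verma_act n B (verma_act n A u)"
proof -
  define Y where "Y = (\<lambda>p (u :: ypoly). yv p * u)"
  have lin: "plinear (xop n p)" "plinear (Y p)" "plinear (hop n p)" for p
    unfolding Y_def by (rule plinear_xop plinear_mult_left plinear_hop)+
  have XY: "poly_apply f (xop n) (poly_apply g Y u) - poly_apply g Y (poly_apply f (xop n) u)
      = smul 1 (poly_apply (f * g) (hop n) u)" for f g
    by (rule poly_apply_comm[OF lin(1,2)]) (simp add: Y_def xop_var add.commute)
  have HX: "poly_apply f (hop n) (poly_apply g (xop n) u) - poly_apply g (xop n) (poly_apply f (hop n) u)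
      = smul 2 (poly_apply (f * g) (xop n) u)" for f g
    by (rule poly_apply_comm[OF lin(3,1)]) (simp add: hop_xop two_eq_smul)
  have HY: "poly_apply f (hop n) (poly_apply g Y u) - poly_apply g Y (poly_apply f (hop n) u)
      = smul (- 2) (poly_apply (f * g) Y u)" for f g
    by (rule poly_apply_comm[OF lin(3,2)]) (simp add: Y_def hop_var two_eq_smul add.commute)
  have XX: "poly_apply f (xop n) (poly_apply g (xop n) u) - poly_apply g (xop n) (poly_apply f (xop n) u)
      = smul 0 (poly_apply (f * g) Y u)" for f g
    by (rule poly_apply_comm[OF lin(1,1)]) (simp add: xop_comm)
  have YY: "poly_apply f Y (poly_apply g Y u) - poly_apply g Y (poly_apply f Y u)
      = smul 0 (poly_apply (f * g) Y u)" for f g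
    by (rule poly_apply_comm[OF lin(2,2)]) (simp add: Y_def mult.left_commute)
  have HH: "poly_apply f (hop n) (poly_apply g (hop n) u) - poly_apply g (hop n) (poly_apply f (hop n) u)
      = smul 0 (poly_apply (f * g) Y u)" for f g
    by (rule poly_apply_comm[OF lin(3,3)]) (simp add: hop_comm)
  define a b c where abc: "a = A $ 1 $ 1" "b = A $ 1 $ 2" "c = A $ 2 $ 1"
  define a' b' c' where abc': "a' = B $ 1 $ 1" "b' = B $ 1 $ 2" "c' = B $ 2 $ 1"
  have d: "A $ 2 $ 2 = - a" "B $ 2 $ 2 = - a'"
    using assms by (simp_all add: sl2t_def trace_def sum_2 abc abc' eq_neg_iff_add_eq_0 add.commute)
  have two: "Polynomial.smult 2 f = f + f" for f :: "complex poly"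
    using smult_add_left[of 1 1 f] by simp
  have e: "bracket A B $ 1 $ 2 = Polynomial.smult 2 (a * b') - Polynomial.smult 2 (a' * b)"
    "bracket A B $ 2 $ 1 = Polynomial.smult 2 (a' * c) - Polynomial.smult 2 (a * c')"
    "bracket A B $ 1 $ 1 = b * c' - b' * c"
    by (simp_all add: bracket_nth sum_2 d abc[symmetric] abc'[symmetric] two algebra_simps)
  note lins = plinear_add[OF poly_apply_linear[OF lin(1)]] plinear_add[OF poly_apply_linear[OF lin(2)]]
    plinear_add[OF poly_apply_linear[OF lin(3)]]
  \<comment> \<open>Expanding and pairing opposite terms leaves nine commutators, one for each
    choice of a component of \<open>A\<close> and one of \<open>B\<close>.\<close>
  have "verma_act n A (verma_act n B u) - verma_act n B (verma_act n A u) =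
      (poly_apply b (xop n) (poly_apply b' (xop n) u) - poly_apply b' (xop n) (poly_apply b (xop n) u)) +
      (poly_apply b (xop n) (poly_apply c' Y u) - poly_apply c' Y (poly_apply b (xop n) u)) -
      (poly_apply a' (hop n) (poly_apply b (xop n) u) - poly_apply b (xop n) (poly_apply a' (hop n) u)) -
      (poly_apply b' (xop n) (poly_apply c Y u) - poly_apply c Y (poly_apply b' (xop n) u)) +
      (poly_apply c Y (poly_apply c' Y u) - poly_apply c' Y (poly_apply c Y u)) -
      (poly_apply a' (hop n) (poly_apply c Y u) - poly_apply c Y (poly_apply a' (hop n) u)) +
      (poly_apply a (hop n) (poly_apply b' (xop n) u) - poly_apply b' (xop n) (poly_apply a (hop n) u)) +
      (poly_apply a (hop n) (poly_apply c' Y u) - poly_apply c' Y (poly_apply a (hop n) u)) +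
      (poly_apply a (hop n) (poly_apply a' (hop n) u) - poly_apply a' (hop n) (poly_apply a (hop n) u))"
    by (simp add: verma_act_def current_apply_def lins abc[symmetric] abc'[symmetric] flip: Y_def)
  also have "\<dots> = verma_act n (bracket A B) u"
    unfolding XX XY HX YY HY HH
    by (simp add: verma_act_def current_apply_def e poly_apply_diff poly_apply_smult flip: Y_def)
  finally show ?thesis ..
qed

section \<open>Homogeneity of the operators in the degree of t\<close>

lemma plinear_homog:
  assumes f: "plinear f" "\<And>k. f (mon k) \<in> homog dg' (dg k + j)" and u: "u \<in> homog dg d"
  shows "f u \<in> homog dg' (d + j)"
proof -
  have "f u = (\<Sum>k\<in>Poly_Mapping.keys u. smul (Poly_Mapping.lookup u k) (f (mon k)))"
    using arg_cong[OF pm_expand[of u], of f] by (simp add: plinear_sum[OF f(1)] plinear_scale[OF f(1)])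
  also have "\<dots> \<in> homog dg' (d + j)"
    using u f(2) by (intro homog_sum homog_smul) (auto simp: homog_def)
  finally show ?thesis .
qed

lemma sderiv_homog: "u \<in> homog sum_mset d \<Longrightarrow> sderiv j u \<in> homog sum_mset (d + j)"
proof -
  assume u: "u \<in> homog sum_mset d"
  have mon: "sderiv j (mon M) \<in> homog sum_mset (sum_mset M + j)" for M
  proof (induction M)
    case (add q M)
    have "yv (q + j) * mon M \<in> homog sum_mset (sum_mset (add_mset q M) + j)"
      by (simp add: yv_mult_mon)
    moreover have "yv q * sderiv j (mon M) \<in> homog sum_mset (q + (sum_mset M + j))"
      using add by (intro homog_mult) (simp_all add: yv_def)
    ultimately show ?case by (simp add: yv_mult_mon[symmetric] homog_add add.assoc)
  qed simp
  show ?thesis by (rule plinear_homog[OF plinear_sderiv mon u])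
qed

lemma hop_homog: "u \<in> homog sum_mset d \<Longrightarrow> hop n j u \<in> homog sum_mset (d + j)"
  using sderiv_homog[of u d j] by (auto simp: hop_def two_eq_smul simp flip: smul_of_nat
    intro!: homog_diff homog_smul pm.subspace_neg[OF subspace_homog])

lemma xop_homog: "u \<in> homog sum_mset d \<Longrightarrow> xop n j u \<in> homog sum_mset (d + j)"
proof -
  assume u: "u \<in> homog sum_mset d"
  have mon: "xop n j (mon M) \<in> homog sum_mset (sum_mset M + j)" for M
  proof (induction M)
    case (add q M)
    have "hop n (q + j) (mon M) \<in> homog sum_mset (q + (sum_mset M + j))"
      using hop_homog[of "mon M" "sum_mset M" n "q + j"] by (simp add: add_ac)
    moreover have "yv q * xop n j (mon M) \<in> homog sum_mset (q + (sum_mset M + j))"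
      using add by (intro homog_mult) (simp_all add: yv_def)
    ultimately show ?case by (simp add: yv_mult_mon[symmetric] xop_var homog_add add.assoc)
  qed simp
  show ?thesis by (rule plinear_homog[OF plinear_xop mon u])
qed

lemma yv_mult_homog: "u \<in> homog sum_mset d \<Longrightarrow> yv j * u \<in> homog sum_mset (d + j)"
  using homog_mult[of sum_mset "yv j" j u d] by (simp add: yv_def add.commute)

lemma verma_act_graded_piece:
  assumes "u \<in> graded_piece sum_mset r"
  shows "verma_act n (tens a (Polynomial.monom 1 k)) u \<in> graded_piece sum_mset (r + int k)"
proof (cases "r < 0")
  case True
  then have "u = 0" using assms by (simp add: graded_piece_neg)
  then show ?thesis by (simp add: actionD(3)[OF action_verma_act] pm.subspace_0[OF graded_piece_subspace])
next
  case False
  then obtain d where r: "r = int d" by (metis nat_0_le not_less)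
  then have u: "u \<in> homog sum_mset d" using assms by (simp add: graded_piece_homog)
  have "verma_act n (tens a (Polynomial.monom 1 k)) u \<in> homog sum_mset (d + k)"
    unfolding verma_act_def current_apply_tens using u
    by (intro homog_add homog_smul xop_homog hop_homog yv_mult_homog)
  then show ?thesis by (simp add: r flip: graded_piece_homog)
qed

lemma tgraded_UNIV: "tgraded dg UNIV"
  by (simp add: tgraded_def)

lemma component_sum_mset_mult:
  "component sum_mset d (yv q * u) = (if q \<le> d then yv q * component sum_mset (d - q) u else 0)"
  using component_mult_homog[of sum_mset "yv q" q d u] by (simp add: yv_def mult.commute)

lemma tgraded_fusion_ideal: "tgraded sum_mset (fusion_ideal M)"
  unfolding tgraded_def
proof
  fix u assume "u \<in> fusion_ideal M"
  then show "\<forall>d. component sum_mset d u \<in> fusion_ideal M"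
    unfolding fusion_ideal_def
  proof (induction rule: idl.induct)
    case (idl_gen g)
    then obtain r s where g: "g = fps_nth (ys ^ r) s" "minsum M r < s + r" by blast
    then have "g \<in> homog sum_mset s" using keys_ys_pow by (auto simp: homog_def)
    then have "component sum_mset d g = (if d = s then g else 0)" for d by (rule component_of_homog)
    then show ?case using idl_gen by (auto intro: idl.intros)
  next
    case (idl_var u q)
    then show ?case by (auto simp: component_sum_mset_mult intro: idl.intros)
  qed (auto simp: component_add component_smul intro: idl.intros)
qed

lemma tgraded_demazure_ideal: "tgraded sum_mset (demazure_ideal l r)"
  by (simp add: demazure_ideal_def tgraded_fusion_ideal)

text \<open>After removal of \<open>p\<close> parts \<open>l\<close> the remaining parts add up to
  \<open>s - l p\<close>, so the power of \<open>y_0\<close> lies in their ideal. Putting the parts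
  back shifts its index to \<open>p\<close>. If there are fewer than \<open>p\<close> such parts,
  the variable itself is in the ideal.\<close>

lemma demazure_ideal_mem_pow:
  assumes "max 0 (int s - int l * int p) \<le> int a"
  shows "yv p ^ (a + 1) \<in> demazure_ideal l s"
proof -
  let ?M = "add_mset (s mod l) (replicate_mset (s div l) l)"
  show ?thesis
  proof (cases "p \<le> s div l")
    case False
    then have "yv p \<in> demazure_ideal l s" unfolding demazure_ideal_def by (intro var_fusion_ideal) simp
    then show ?thesis using ideal_mult_right[OF submod_ideal[OF demazure_ideal_submod]] by simp
  next
    case True
    let ?M' = "add_mset (s mod l) (replicate_mset (s div l - p) l)"
    have "sum_mset ?M' + l * p = s"
    proof -
      have "(s div l - p) * l + l * p = (s div l) * l"
        using True by (simp add: mult.commute flip: distrib_left)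
      moreover have "sum_mset ?M' = s mod l + (s div l - p) * l" by simp
      ultimately show ?thesis using div_mult_mod_eq[of s l] by linarith
    qed
    then have "int (sum_mset ?M') = int s - int l * int p" by (metis add_diff_cancel_right' of_nat_add of_nat_mult)
    then have "minsum ?M' (a + 1) < 0 + (a + 1)"
      using assms minsum_le_sum[of ?M' "a + 1"] by linarith
    then have "fps_nth (ys ^ (a + 1)) 0 \<in> fusion_ideal ?M'" by (rule fusion_ideal_gen)
    then have "index_shift (size (replicate_mset p l)) (yv 0 ^ (a + 1)) \<in> fusion_ideal (?M' + replicate_mset p l)"
      by (intro index_shift_fusion_ideal) (simp add: fps_power_zeroth)
    moreover have "?M' + replicate_mset p l = ?M"
      using True by (intro multiset_eqI) auto
    ultimately show ?thesis by (simp add: index_shift_var_pow demazure_ideal_def del: power_Suc)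
  qed
qed

text \<open>Relations with \<open>s < t + r\<close> are Garland's. Otherwise \<open>r < l\<close>,
  and each monomial of the coefficient contains either a variable of index above
  \<open>s div l\<close>, all of which lie in \<open>A\<close>, or, for \<open>r > s mod l\<close>
  and modulo those variables, the power \<open>s mod l + 1\<close> of the variable of index
  \<open>s div l\<close>.\<close>

lemma demazure_ideal_least:
  assumes A: "submod s A" and y0: "yv 0 ^ (s + 1) \<in> A" and "l > 0"
    and pow: "\<And>p a. max 0 (int s - int l * int p) \<le> int a \<Longrightarrow> yv p ^ (a + 1) \<in> A"
  shows "demazure_ideal l s \<subseteq> A"
  unfolding demazure_ideal_def
proof (rule fusion_ideal_least[OF submod_ideal[OF A]])
  let ?K = "s div l" and ?s0 = "s mod l"
  fix r t assume rt: "minsum (add_mset ?s0 (replicate_mset ?K l)) r < t + r"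
  have ms: "minsum (replicate_mset k x) r = k * min x r" for k x by (induction k) auto
  have rt: "min ?s0 r + ?K * min l r < t + r" using rt by (simp add: ms)
  have s: "s = ?K * l + ?s0" by simp
  have var: "yv p \<in> A" if "?K < p" for p
  proof -
    have "s < l * (?K + 1)" using \<open>l > 0\<close> by (simp add: dividend_less_times_div)
    also have "\<dots> \<le> l * p" using that by (intro mult_le_mono) auto
    finally have "int s \<le> int l * int p" by (metis less_imp_le of_nat_le_iff of_nat_mult)
    then show ?thesis using pow[of p 0] by simp
  qed
  show "fps_nth (ys ^ r) t \<in> A"
  proof (cases "s < t + r")
    case True
    then show ?thesis by (rule garland[OF A y0])
  next
    case False
    have rl: "r < l"
    proof (rule ccontr)
      assume "\<not> r < l"
      then have "min l r = l" "min ?s0 r = ?s0" using mod_less_divisor[OF \<open>l > 0\<close>, of s] by auto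
      with rt s False show False by simp
    qed
    show ?thesis
    proof (cases "r \<le> ?s0")
      case True
      have "yv (Suc ?K) ^ 1 \<in> A" using var by simp
      moreover have "?K * r + 1 \<le> t"
      proof -
        have "min ?s0 r = r" "min l r = r" using True rl by auto
        with rt show ?thesis by simp
      qed
      ultimately show ?thesis
        using var by (intro ys_pow_in_ideal[OF submod_ideal[OF A], of ?K 1]) auto
    next
      case r: False
      have K: "?K \<noteq> 0"
      proof
        assume "?K = 0"
        then show False using rt s r False by (simp add: min_def)
      qed
      then obtain k where k: "?K = Suc k" by (metis not0_implies_Suc)
      have "max 0 (int s - int l * int ?K) \<le> int ?s0"
      proof -
        have "int s = int l * int ?K + int ?s0" by (metis mult_div_mod_eq of_nat_add of_nat_mult)
        then show ?thesis by simp
      qed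
      then have "yv ?K ^ (?s0 + 1) \<in> A" by (rule pow)
      moreover have "k * r + (?s0 + 1) \<le> t" using rt rl r by (simp add: k min_def)
      ultimately show ?thesis
        using var k by (intro ys_pow_in_ideal[OF submod_ideal[OF A], of k "?s0 + 1"]) auto
    qed
  qed
qed

section \<open>Demazure modules as quotients of the polynomial ring\<close>

definition letter :: "sl2_basis \<Rightarrow> nat \<Rightarrow> tensor \<Rightarrow> tensor" where
  "letter b p = lin (\<lambda>w. mon ((b, p) # w))"

lemma plinear_letter: "plinear (letter b p)"
  unfolding letter_def by (rule plinear_lin)

lemmas letter_ops = plinear_add[OF plinear_letter] plinear_scale[OF plinear_letter] plinear_0[OF plinear_letter]
  plinear_diff[OF plinear_letter] plinear_neg[OF plinear_letter]

lemma letter_mon [simp]: "letter b p (mon w) = mon ((b, p) # w)"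
  by (simp add: letter_def)

lemma left_mult_eq: "left_mult A v = current_apply (letter BX) (letter BY) (letter BH) A v"
proof -
  have poly_apply: "poly_apply f (letter b) v = (\<Sum>w\<in>Poly_Mapping.keys v. \<Sum>p\<le>Polynomial.degree f.
      Poly_Mapping.single ((b, p) # w) (Polynomial.coeff f p * Poly_Mapping.lookup v w))" for f b
    unfolding poly_apply_def letter_def lin_def pm.scale_sum_right
    by (subst sum.swap) (simp add: mon_def)
  show ?thesis
    by (simp add: left_mult_def current_apply_def poly_apply sum.distrib add.assoc)
qed

lemma action_left_mult: "action left_mult"
proof -
  have eq: "left_mult = current_apply (letter BX) (letter BY) (letter BH)" by (intro ext) (rule left_mult_eq)
  show ?thesis unfolding eq by (rule action_current_apply; rule plinear_letter)
qed

lemma left_mult_tens: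
  "left_mult (tens a (Polynomial.monom 1 p)) u =
     smul (a $ 1 $ 2) (letter BX p u) + smul (a $ 2 $ 1) (letter BY p u) + smul (a $ 1 $ 1) (letter BH p u)"
  by (simp add: left_mult_eq current_apply_tens)

lemma left_mult_xyh [simp]:
  "left_mult (tens sl2_x (Polynomial.monom 1 p)) u = letter BX p u"
  "left_mult (tens sl2_y (Polynomial.monom 1 p)) u = letter BY p u"
  "left_mult (tens sl2_h (Polynomial.monom 1 p)) u = letter BH p u"
  by (simp_all add: left_mult_tens)

abbreviation tdeg :: "(sl2_basis \<times> nat) list \<Rightarrow> nat" where
  "tdeg w \<equiv> sum_list (map snd w)"

lemma tensor_presentation: "presentation left_mult tdeg UNIV tensor_module (\<lambda>u. u) {0}"
proof
  show "stable left_mult {0}" by (simp add: stable_def actionD(3)[OF action_left_mult])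
  show "grade tensor_module r = (\<lambda>u. u) ` (UNIV \<inter> graded_piece tdeg r)" for r
    by (simp add: tensor_module_def graded_piece_def)
qed (auto simp: action_left_mult tensor_module_def stable_def pm.subspace_def simp flip: smul_def)

definition weyl_tensors :: "nat \<Rightarrow> tensor set" where
  "weyl_tensors s = {left_mult (tens sl2_x f) (mon []) | f. True} \<union>
     {letter BH p (mon []) - smul (if p = 0 then of_nat s else 0) (mon []) | p. True} \<union>
     {(left_mult (tens sl2_y 1) ^^ (s + 1)) (mon [])}"

definition dem_tensors :: "nat \<Rightarrow> nat \<Rightarrow> tensor set" where
  "dem_tensors l s = {(left_mult (tens sl2_y (Polynomial.monom 1 p)) ^^ (a + 1)) (mon []) | p a.
     int a \<ge> max 0 (int s - int l * int p)}"

definition tensor_kernel :: "nat \<Rightarrow> nat \<Rightarrow> tensor set" where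
  "tensor_kernel l s = \<Inter>{C. pm.subspace C \<and> stable left_mult C \<and>
     bracket_relations \<union> weyl_tensors s \<union> dem_tensors l s \<subseteq> C}"

lemma tensor_kernel:
  "pm.subspace (tensor_kernel l s)" "stable left_mult (tensor_kernel l s)"
  "bracket_relations \<union> weyl_tensors s \<union> dem_tensors l s \<subseteq> tensor_kernel l s"
  by (auto simp: tensor_kernel_def pm.subspace_def stable_def)

lemma tensor_kernel_least:
  "pm.subspace C \<Longrightarrow> stable left_mult C \<Longrightarrow>
    bracket_relations \<union> weyl_tensors s \<union> dem_tensors l s \<subseteq> C \<Longrightarrow> tensor_kernel l s \<subseteq> C"
  by (auto simp: tensor_kernel_def)

text \<open>The three nested quotients collapse to one: their kernels accumulate to the least stable
  subspace that contains all three sets of relations.\<close>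

lemma demazure_tensor_presentation:
  "\<exists>\<pi>. presentation left_mult tdeg UNIV (demazure l s) \<pi> (tensor_kernel l s)"
proof -
  interpret T: presentation left_mult tdeg UNIV tensor_module "\<lambda>u. u" "{0}"
    by (rule tensor_presentation)
  define p1 where "p1 u = env_ideal +>\<^bsub>tensor_module\<^esub> u" for u
  define J1 where "J1 = T.least_stable ({0} \<union> bracket_relations)"
  interpret E: presentation left_mult tdeg UNIV env_module p1 J1
    using T.generated_quotient_presentation[of bracket_relations]
    by (simp add: env_module_def env_ideal_def p1_def[abs_def] J1_def)
  have gen1: "env_gen = p1 (mon [])" by (simp add: env_gen_def p1_def mon_def)
  have weyl: "weyl_relations s = p1 ` weyl_tensors s"
  proof -
    have 1: "act env_module (tens sl2_x f) env_gen = p1 (left_mult (tens sl2_x f) (mon []))" for f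
      by (simp add: gen1 E.p_act)
    have 2: "act env_module (tens sl2_h (Polynomial.monom 1 p)) env_gen \<ominus>\<^bsub>env_module\<^esub>
        (c \<odot>\<^bsub>env_module\<^esub> env_gen) = p1 (letter BH p (mon []) - smul c (mon []))" for p c
      by (simp add: gen1 E.p_act E.p_smul E.p_minus)
    have 3: "(act env_module (tens sl2_y 1) ^^ (s + 1)) env_gen =
        p1 ((left_mult (tens sl2_y 1) ^^ (s + 1)) (mon []))"
      unfolding gen1 using E.p_act_pow[of "tens sl2_y 1" "mon []" "s + 1"] by simp
    show ?thesis
      unfolding weyl_relations_def weyl_tensors_def 1 2 3 image_Un
      by (intro arg_cong2[of _ _ _ _ "(\<union>)"]) blast+
  qed
  define p2 where "p2 u = weyl_ideal s +>\<^bsub>env_module\<^esub> p1 u" for u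
  define J2 where "J2 = T.least_stable (J1 \<union> weyl_tensors s)"
  interpret W: presentation left_mult tdeg UNIV "local_weyl s" p2 J2
    using E.generated_quotient_presentation[of "weyl_tensors s"]
    by (simp add: local_weyl_def weyl_ideal_def weyl p2_def[abs_def] J2_def)
  have gen2: "weyl_gen s = p2 (mon [])" by (simp add: weyl_gen_def p2_def gen1)
  have dem: "demazure_relations l s = p2 ` dem_tensors l s"
  proof -
    have "(act (local_weyl s) (tens sl2_y (Polynomial.monom 1 p)) ^^ (a + 1)) (weyl_gen s) =
        p2 ((left_mult (tens sl2_y (Polynomial.monom 1 p)) ^^ (a + 1)) (mon []))" for p a
      unfolding gen2 using W.p_act_pow[of "tens sl2_y (Polynomial.monom 1 p)" "mon []" "a + 1"] by simp
    then show ?thesis unfolding demazure_relations_def dem_tensors_def by auto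
  qed
  have pres: "presentation left_mult tdeg UNIV (demazure l s)
      (\<lambda>u. generated_submodule (local_weyl s) (p2 ` dem_tensors l s) +>\<^bsub>local_weyl s\<^esub> p2 u)
      (T.least_stable (J2 \<union> dem_tensors l s))"
    using W.generated_quotient_presentation[of "dem_tensors l s"]
    by (simp add: demazure_def dem)
  have "T.least_stable (J2 \<union> dem_tensors l s) = tensor_kernel l s"
  proof
    have sub: "bracket_relations \<union> weyl_tensors s \<union> dem_tensors l s \<subseteq> T.least_stable (J2 \<union> dem_tensors l s)"
      using T.least_stable(3)[of "J2 \<union> dem_tensors l s"] T.least_stable(3)[of "J1 \<union> weyl_tensors s"]
        T.least_stable(3)[of "{0} \<union> bracket_relations"]
      unfolding J1_def J2_def by blast
    show "tensor_kernel l s \<subseteq> T.least_stable (J2 \<union> dem_tensors l s)"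
      by (rule tensor_kernel_least[OF T.least_stable(1,2) sub])
    note K = tensor_kernel[where l = l and s = s]
    have "J1 \<subseteq> tensor_kernel l s"
      unfolding J1_def using K by (intro T.least_stable_least) (auto simp: pm.subspace_0)
    then have "J2 \<subseteq> tensor_kernel l s"
      unfolding J2_def using K by (intro T.least_stable_least) auto
    then show "T.least_stable (J2 \<union> dem_tensors l s) \<subseteq> tensor_kernel l s"
      using K by (intro T.least_stable_least) auto
  qed
  with pres show ?thesis by metis
qed

section \<open>Normal forms of words on the highest weight generator\<close>

definition ybop :: "nat \<Rightarrow> sl2_basis \<Rightarrow> nat \<Rightarrow> ypoly \<Rightarrow> ypoly" where
  "ybop n b p = (case b of BX \<Rightarrow> xop n p | BY \<Rightarrow> (\<lambda>u. yv p * u) | BH \<Rightarrow> hop n p)"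

lemma plinear_ybop: "plinear (ybop n b p)"
  by (cases b) (simp_all add: ybop_def plinear_xop plinear_hop plinear_mult_left)

primrec word_act :: "nat \<Rightarrow> (sl2_basis \<times> nat) list \<Rightarrow> ypoly" where
  "word_act n [] = 1"
| "word_act n (x # w) = ybop n (fst x) (snd x) (word_act n w)"

definition psi :: "nat \<Rightarrow> tensor \<Rightarrow> ypoly" where
  "psi n = lin (word_act n)"

lemma plinear_psi: "plinear (psi n)"
  unfolding psi_def by (rule plinear_lin)

lemmas psi_ops = plinear_add[OF plinear_psi] plinear_scale[OF plinear_psi] plinear_0[OF plinear_psi]
  plinear_diff[OF plinear_psi] plinear_sum[OF plinear_psi]

lemma psi_mon [simp]: "psi n (mon w) = word_act n w"
  by (simp add: psi_def)

lemma psi_letter: "psi n (letter b p v) = ybop n b p (psi n v)"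
proof -
  have "plinear (\<lambda>v. psi n (letter b p v))" "plinear (\<lambda>v. ybop n b p (psi n v))"
    by (rule plinearI; simp add: letter_ops psi_ops plinear_add[OF plinear_ybop] plinear_scale[OF plinear_ybop])+
  then show ?thesis by (rule plinear_eqI) simp
qed

lemma poly_apply_map:
  assumes "plinear g" "\<And>p. g (T p u) = T' p (g u)"
  shows "g (poly_apply f T u) = poly_apply f T' (g u)"
  by (simp add: poly_apply_def plinear_sum[OF assms(1)] plinear_scale[OF assms(1)] assms(2))

lemma psi_left_mult: "psi n (left_mult A v) = verma_act n A (psi n v)"
proof -
  have "psi n (poly_apply f (letter b) v) = poly_apply f (ybop n b) (psi n v)" for f b
    by (rule poly_apply_map[where g = "psi n"]) (rule plinear_psi psi_letter)+
  moreover have "ybop n BX = xop n" "ybop n BY = (\<lambda>p u. yv p * u)" "ybop n BH = hop n"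
    by (simp_all add: ybop_def fun_eq_iff)
  ultimately show ?thesis by (simp add: left_mult_eq current_apply_def verma_act_def psi_ops)
qed

text \<open>A section of \<open>psi\<close>; sorting merely fixes some order of the commuting
  variables. Compatibility with the action holds only modulo the relations.\<close>

definition sigma :: "ypoly \<Rightarrow> tensor" where
  "sigma = lin (\<lambda>M. mon (map (Pair BY) (sorted_list_of_multiset M)))"

lemma plinear_sigma: "plinear sigma"
  unfolding sigma_def by (rule plinear_lin)

lemmas sigma_ops = plinear_add[OF plinear_sigma] plinear_scale[OF plinear_sigma] plinear_0[OF plinear_sigma]
  plinear_diff[OF plinear_sigma]

lemma sigma_mon: "sigma (mon M) = mon (map (Pair BY) (sorted_list_of_multiset M))"
  by (simp add: sigma_def)

lemma sigma_1: "sigma 1 = mon []"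
  using sigma_mon[of "{#}"] by simp

lemma word_act_y: "word_act n (map (Pair BY) l) = mon (mset l)"
  by (induction l) (simp_all add: ybop_def yv_mult_mon)

lemma psi_sigma: "psi n (sigma u) = u"
proof -
  have "plinear (\<lambda>u. psi n (sigma u))" "plinear (\<lambda>u :: ypoly. u)"
    by (rule plinearI; simp add: psi_ops sigma_ops)+
  then show ?thesis by (rule plinear_eqI) (simp add: sigma_mon word_act_y)
qed

text \<open>What reordering of words uses of \<open>tensor_kernel\<close>: bracket and highest
  weight relations, and nothing about powers of y.\<close>

locale highest_weight_kernel =
  fixes J :: "tensor set" and n :: nat
  assumes J: "pm.subspace J" and stab: "stable left_mult J" and br: "bracket_relations \<subseteq> J"
    and hw_x: "\<And>p. letter BX p (mon []) \<in> J"
    and hw_h: "\<And>p. letter BH p (mon []) - smul (if p = 0 then of_nat n else 0) (mon []) \<in> J"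
begin

lemmas J_ops = pm.subspace_0[OF J] pm.subspace_add[OF J] pm.subspace_diff[OF J] pm.subspace_scale[OF J]

lemma letter_J: "u \<in> J \<Longrightarrow> letter b p u \<in> J"
proof -
  assume "u \<in> J"
  then have "left_mult A u \<in> J" if "A \<in> sl2t" for A using stab that by (simp add: stable_def)
  from this[of "tens sl2_x (Polynomial.monom 1 p)"] this[of "tens sl2_y (Polynomial.monom 1 p)"]
    this[of "tens sl2_h (Polynomial.monom 1 p)"]
  show "letter b p u \<in> J" by (cases b) simp_all
qed

lemma bracket_J: "A \<in> sl2t \<Longrightarrow> A' \<in> sl2t \<Longrightarrow>
    left_mult (bracket A A') v - (left_mult A (left_mult A' v) - left_mult A' (left_mult A v)) \<in> J"
  using br unfolding bracket_relations_def by blast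

lemma comm_tens:
  assumes "a \<in> sl2" "b \<in> sl2"
  shows "left_mult (tens (bracket a b) (Polynomial.monom 1 (i + j))) v -
    (left_mult (tens a (Polynomial.monom 1 i)) (left_mult (tens b (Polynomial.monom 1 j)) v) -
     left_mult (tens b (Polynomial.monom 1 j)) (left_mult (tens a (Polynomial.monom 1 i)) v)) \<in> J"
  using bracket_J[OF tens_in_sl2t[OF assms(1)] tens_in_sl2t[OF assms(2)], of "Polynomial.monom 1 i" "Polynomial.monom 1 j" v]
  by (simp add: bracket_tens mult_monom)

lemma comm_YY: "letter BY i (letter BY j v) - letter BY j (letter BY i v) \<in> J"
  using pm.subspace_neg[OF J comm_tens[of sl2_y sl2_y i j v]]
  by (simp add: left_mult_tens[of "bracket _ _"] bracket_nth sum_2)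

lemma comm_HY: "letter BH i (letter BY j v) - letter BY j (letter BH i v) + smul 2 (letter BY (i + j) v) \<in> J"
  using pm.subspace_neg[OF J comm_tens[of sl2_h sl2_y i j v]]
  by (simp add: left_mult_tens[of "bracket _ _"] bracket_nth sum_2 algebra_simps)

lemma comm_XY: "letter BX i (letter BY j v) - letter BY j (letter BX i v) - letter BH (i + j) v \<in> J"
  using pm.subspace_neg[OF J comm_tens[of sl2_x sl2_y i j v]]
  by (simp add: left_mult_tens[of "bracket _ _"] bracket_nth sum_2 algebra_simps)

lemma J_trans: "u - v \<in> J \<Longrightarrow> v - w \<in> J \<Longrightarrow> u - w \<in> J"
  using J_ops(2)[of "u - v" "v - w"] by simp

lemma word_move: "mon (map (Pair BY) (l1 @ a # l2)) - mon (map (Pair BY) (a # l1 @ l2)) \<in> J"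
proof (induction l1)
  case (Cons b l1)
  have "letter BY b (mon (map (Pair BY) (l1 @ a # l2)) - mon (map (Pair BY) (a # l1 @ l2))) \<in> J"
    using Cons by (rule letter_J)
  moreover have "letter BY b (letter BY a (mon (map (Pair BY) (l1 @ l2)))) - letter BY a (letter BY b (mon (map (Pair BY) (l1 @ l2)))) \<in> J"
    by (rule comm_YY)
  ultimately show ?case
    using J_trans[of "mon (map (Pair BY) ((b # l1) @ a # l2))" "mon (map (Pair BY) (b # a # l1 @ l2))"
        "mon (map (Pair BY) (a # (b # l1) @ l2))"] by (simp add: letter_ops)
qed (simp add: J_ops)

lemma word_perm: "mset l = mset l' \<Longrightarrow> mon (map (Pair BY) l) - mon (map (Pair BY) l') \<in> J"
proof (induction l arbitrary: l')
  case (Cons a l)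
  then have "a \<in> set l'" by (metis list.set_intros(1) set_mset_mset)
  then obtain l1 l2 where l': "l' = l1 @ a # l2" by (meson split_list)
  then have "mset l = mset (l1 @ l2)" using Cons.prems by simp
  then have "letter BY a (mon (map (Pair BY) l) - mon (map (Pair BY) (l1 @ l2))) \<in> J"
    by (intro letter_J Cons.IH)
  moreover have "- (mon (map (Pair BY) (l1 @ a # l2)) - mon (map (Pair BY) (a # l1 @ l2))) \<in> J"
    by (rule pm.subspace_neg[OF J word_move])
  ultimately show ?case
    using J_trans[of "mon (map (Pair BY) (a # l))" "mon (map (Pair BY) (a # l1 @ l2))"
        "mon (map (Pair BY) l')"] by (simp add: letter_ops l')
qed (simp add: J_ops)

lemma J_plinear:
  assumes "plinear f" "\<And>k. f (mon k) \<in> J"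
  shows "f u \<in> J"
  by (induction u rule: pm_induct)
    (auto simp: assms plinear_add[OF assms(1)] plinear_scale[OF assms(1)] J_ops)

lemma J_ypoly:
  assumes "plinear f" "f 1 \<in> J" "\<And>q u. f u \<in> J \<Longrightarrow> f (yv q * u) \<in> J"
  shows "f u \<in> J"
  by (induction u rule: ypoly_induct)
    (auto simp: assms plinear_add[OF assms(1)] plinear_scale[OF assms(1)] J_ops)

lemma sigma_y: "sigma (yv q * u) - letter BY q (sigma u) \<in> J"
proof (rule J_plinear[where f = "\<lambda>u. sigma (yv q * u) - letter BY q (sigma u)"])
  show "plinear (\<lambda>u. sigma (yv q * u) - letter BY q (sigma u))"
    by (rule plinearI) (simp_all add: distrib_left sigma_ops letter_ops pm.scale_right_diff_distrib)
  fix M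
  show "sigma (yv q * mon M) - letter BY q (sigma (mon M)) \<in> J"
    using word_perm[of "sorted_list_of_multiset (add_mset q M)" "q # sorted_list_of_multiset M"]
    by (simp add: yv_mult_mon sigma_mon)
qed

lemma sigma_h: "sigma (hop n j u) - letter BH j (sigma u) \<in> J"
proof (rule J_ypoly[where f = "\<lambda>u. sigma (hop n j u) - letter BH j (sigma u)"])
  show "plinear (\<lambda>u. sigma (hop n j u) - letter BH j (sigma u))"
    by (rule plinearI) (simp_all add: sigma_ops letter_ops pm.scale_right_diff_distrib)
next
  have "sigma (hop n j 1) = smul (if j = 0 then of_nat n else 0) (mon [])"
    using sigma_ops(2)[of "of_nat n" 1] by (simp add: hop_1 sigma_1 sigma_ops smul_of_nat)
  then show "sigma (hop n j 1) - letter BH j (sigma 1) \<in> J"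
    using pm.subspace_neg[OF J hw_h[of j]] by (simp add: sigma_1)
next
  fix q u assume IH: "sigma (hop n j u) - letter BH j (sigma u) \<in> J"
  have "sigma (hop n j (yv q * u)) - letter BH j (sigma (yv q * u)) =
    (sigma (yv q * hop n j u) - letter BY q (sigma (hop n j u)))
    - smul 2 (sigma (yv (q + j) * u) - letter BY (q + j) (sigma u))
    + letter BY q (sigma (hop n j u) - letter BH j (sigma u))
    - (letter BH j (letter BY q (sigma u)) - letter BY q (letter BH j (sigma u)) + smul 2 (letter BY (j + q) (sigma u)))
    - letter BH j (sigma (yv q * u) - letter BY q (sigma u))"
    by (simp add: hop_var two_eq_smul sigma_ops letter_ops pm.scale_right_diff_distrib add.commute[of j q])
  also have "\<dots> \<in> J"
    by (intro J_ops(2) J_ops(3) J_ops(4) letter_J sigma_y comm_HY IH)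
  finally show "sigma (hop n j (yv q * u)) - letter BH j (sigma (yv q * u)) \<in> J" .
qed

lemma sigma_x: "sigma (xop n j u) - letter BX j (sigma u) \<in> J"
proof (rule J_ypoly[where f = "\<lambda>u. sigma (xop n j u) - letter BX j (sigma u)"])
  show "plinear (\<lambda>u. sigma (xop n j u) - letter BX j (sigma u))"
    by (rule plinearI) (simp_all add: sigma_ops letter_ops pm.scale_right_diff_distrib)
  show "sigma (xop n j 1) - letter BX j (sigma 1) \<in> J"
    using pm.subspace_neg[OF J hw_x[of j]] by (simp add: sigma_1 sigma_ops)
next
  fix q u assume IH: "sigma (xop n j u) - letter BX j (sigma u) \<in> J"
  have "sigma (xop n j (yv q * u)) - letter BX j (sigma (yv q * u)) =
    (sigma (yv q * xop n j u) - letter BY q (sigma (xop n j u)))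
    + letter BY q (sigma (xop n j u) - letter BX j (sigma u))
    + (sigma (hop n (q + j) u) - letter BH (q + j) (sigma u))
    - (letter BX j (letter BY q (sigma u)) - letter BY q (letter BX j (sigma u)) - letter BH (j + q) (sigma u))
    - letter BX j (sigma (yv q * u) - letter BY q (sigma u))"
    by (simp add: xop_var sigma_ops letter_ops add.commute[of j q])
  also have "\<dots> \<in> J"
    by (intro J_ops(2) J_ops(3) letter_J sigma_y sigma_h comm_XY IH)
  finally show "sigma (xop n j (yv q * u)) - letter BX j (sigma (yv q * u)) \<in> J" .
qed

lemma sigma_ybop: "sigma (ybop n b p u) - letter b p (sigma u) \<in> J"
  by (cases b) (simp_all add: ybop_def sigma_x sigma_y sigma_h)

lemma sigma_verma_act: "sigma (verma_act n A u) - left_mult A (sigma u) \<in> J"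
proof -
  have poly_apply: "sigma (poly_apply f T u) - poly_apply f T' (sigma u) \<in> J"
    if "\<And>p. sigma (T p u) - T' p (sigma u) \<in> J" for f T T'
  proof -
    have eq: "sigma (poly_apply f T u) - poly_apply f T' (sigma u) =
        (\<Sum>p\<le>Polynomial.degree f. smul (Polynomial.coeff f p) (sigma (T p u) - T' p (sigma u)))"
      by (simp add: poly_apply_def plinear_sum[OF plinear_sigma] sigma_ops sum_subtractf
          pm.scale_right_diff_distrib)
    show ?thesis unfolding eq by (intro pm.subspace_sum[OF J] J_ops(4) that)
  qed
  have eq: "sigma (verma_act n A u) - left_mult A (sigma u) =
     (sigma (poly_apply (A $ 1 $ 2) (xop n) u) - poly_apply (A $ 1 $ 2) (letter BX) (sigma u)) +
     (sigma (poly_apply (A $ 2 $ 1) (\<lambda>p u. yv p * u) u) - poly_apply (A $ 2 $ 1) (letter BY) (sigma u)) +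
     (sigma (poly_apply (A $ 1 $ 1) (hop n) u) - poly_apply (A $ 1 $ 1) (letter BH) (sigma u))"
    by (simp add: verma_act_def left_mult_eq current_apply_def sigma_ops)
  show ?thesis unfolding eq by (intro J_ops(2) poly_apply sigma_x sigma_y sigma_h)
qed

text \<open>Every word is congruent to a combination of words in the letters y: bring the tail into
  normal form, then replace the first letter by its operator on C[y].\<close>

lemma sigma_psi: "v - sigma (psi n v) \<in> J"
proof (rule J_plinear[where f = "\<lambda>v. v - sigma (psi n v)"])
  show "plinear (\<lambda>v. v - sigma (psi n v))"
    by (rule plinearI) (simp_all add: psi_ops sigma_ops pm.scale_right_diff_distrib)
  fix w
  show "mon w - sigma (psi n (mon w)) \<in> J"
  proof (induction w)
    case (Cons x w)
    obtain b p where x: "x = (b, p)" by (cases x)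
    have eq: "mon (x # w) - sigma (psi n (mon (x # w))) =
        letter b p (mon w - sigma (psi n (mon w))) -
        (sigma (ybop n b p (psi n (mon w))) - letter b p (sigma (psi n (mon w))))"
      by (simp add: x letter_ops)
    show ?case unfolding eq by (intro J_ops(3) letter_J sigma_ybop Cons)
  qed (simp add: sigma_1 J_ops)
qed

lemma sigma_y_pow: "sigma (yv p ^ k) - (letter BY p ^^ k) (mon []) \<in> J"
proof (induction k)
  case (Suc k)
  have eq: "sigma (yv p ^ Suc k) - (letter BY p ^^ Suc k) (mon []) =
      (sigma (yv p * yv p ^ k) - letter BY p (sigma (yv p ^ k))) +
      letter BY p (sigma (yv p ^ k) - (letter BY p ^^ k) (mon []))"
    by (simp add: letter_ops)
  show ?case unfolding eq by (intro J_ops(2) letter_J sigma_y Suc)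
qed (simp add: sigma_1 J_ops)

lemma sigma_y_pow_mem: "(letter BY p ^^ k) (mon []) \<in> J \<Longrightarrow> sigma (yv p ^ k) \<in> J"
  using J_ops(2)[OF sigma_y_pow[of p k]] by fastforce

lemma submod_sigma: "submod n {u. sigma u \<in> J}"
proof -
  have "sigma (yv j * u) \<in> J" "sigma (hop n j u) \<in> J" "sigma (xop n j u) \<in> J"
    if "sigma u \<in> J" for u j
    using J_ops(2)[OF sigma_y[of j u] letter_J[OF that, of BY j]]
      J_ops(2)[OF sigma_h[of j u] letter_J[OF that, of BH j]]
      J_ops(2)[OF sigma_x[of j u] letter_J[OF that, of BX j]] by simp_all
  then show ?thesis
    using J_ops by (auto simp: submod_def is_ideal_def pm.subspace_def sigma_ops)
qed

end

lemma verma_act_y_pow: "(verma_act n (tens sl2_y (Polynomial.monom 1 p)) ^^ k) 1 = yv p ^ k"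
  by (induction k) simp_all

lemma psi_pow: "psi n ((left_mult A ^^ k) v) = (verma_act n A ^^ k) (psi n v)"
  by (induction k) (simp_all add: psi_left_mult)

text \<open>Through \<open>sigma\<close> the tensor kernel pulls back to an ideal of C[y]. It
  contains \<open>demazure_ideal\<close> by \<open>demazure_ideal_least\<close>. It is not larger,
  since the explicit operators on C[y] modulo \<open>demazure_ideal\<close> satisfy all defining
  relations, so that \<open>psi\<close> maps the kernel into it.\<close>

lemma demazure_presentation:
  assumes "l > 0"
  obtains \<pi> where "presentation (verma_act s) sum_mset UNIV (demazure l s) \<pi> (demazure_ideal l s)"
proof -
  obtain \<pi> where pi: "presentation left_mult tdeg UNIV (demazure l s) \<pi> (tensor_kernel l s)"
    using demazure_tensor_presentation by blast
  let ?J = "tensor_kernel l s"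
  note K = tensor_kernel[where l = l and s = s]
  have one: "(1 :: complex poly) = Polynomial.monom 1 0" by (simp add: monom_0 one_pCons)
  interpret H: highest_weight_kernel ?J s
  proof
    show "letter BX p (mon []) \<in> ?J" for p
    proof -
      have "left_mult (tens sl2_x (Polynomial.monom 1 p)) (mon []) \<in> weyl_tensors s"
        unfolding weyl_tensors_def by blast
      then show ?thesis using K(3) by auto
    qed
    show "letter BH p (mon []) - smul (if p = 0 then of_nat s else 0) (mon []) \<in> ?J" for p
      using K(3) unfolding weyl_tensors_def by blast
  qed (use K in auto)
  have kernel: "sigma u \<in> ?J \<longleftrightarrow> u \<in> demazure_ideal l s" for u
  proof
    assume "u \<in> demazure_ideal l s"
    moreover have "demazure_ideal l s \<subseteq> {u. sigma u \<in> ?J}"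
    proof (rule demazure_ideal_least[OF H.submod_sigma _ \<open>l > 0\<close>])
      have "(letter BY 0 ^^ (s + 1)) (mon []) = (left_mult (tens sl2_y 1) ^^ (s + 1)) (mon [])"
        unfolding one left_mult_xyh[abs_def] by simp
      then have "(letter BY 0 ^^ (s + 1)) (mon []) \<in> ?J"
        using K(3) unfolding weyl_tensors_def by auto
      then show "yv 0 ^ (s + 1) \<in> {u. sigma u \<in> ?J}"
        by (intro CollectI H.sigma_y_pow_mem)
      fix p a assume "max 0 (int s - int l * int p) \<le> int a"
      then have "(left_mult (tens sl2_y (Polynomial.monom 1 p)) ^^ (a + 1)) (mon []) \<in> dem_tensors l s"
        unfolding dem_tensors_def by blast
      moreover have "left_mult (tens sl2_y (Polynomial.monom 1 p)) = letter BY p"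
        by (rule ext) simp
      ultimately have "(letter BY p ^^ (a + 1)) (mon []) \<in> ?J" using K(3) by auto
      then show "yv p ^ (a + 1) \<in> {u. sigma u \<in> ?J}"
        by (intro CollectI H.sigma_y_pow_mem)
    qed
    ultimately show "sigma u \<in> ?J" by blast
  next
    note D = demazure_ideal_submod[of s l] and DI = submod_ideal[OF demazure_ideal_submod[of s l]]
    have "?J \<subseteq> {w. psi s w \<in> demazure_ideal l s}"
    proof (rule tensor_kernel_least)
      show "pm.subspace {w. psi s w \<in> demazure_ideal l s}"
        by (auto simp: pm.subspace_def psi_ops ideal_ops[OF DI])
      show "stable left_mult {w. psi s w \<in> demazure_ideal l s}"
        using stable_verma_act[OF D] by (simp add: stable_def psi_left_mult)
      have "bracket_relations \<subseteq> {w. psi s w \<in> demazure_ideal l s}"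
        by (auto simp: bracket_relations_def psi_ops psi_left_mult verma_act_bracket ideal_ops[OF DI])
      moreover have "weyl_tensors s \<subseteq> {w. psi s w \<in> demazure_ideal l s}"
      proof -
        have "verma_act s (tens sl2_x f) 1 = 0" for f
          by (simp add: verma_act_def current_apply_def tens_def poly_apply_def)
        moreover have "yv 0 ^ (s + 1) \<in> demazure_ideal l s"
          by (rule demazure_ideal_mem_pow) simp
        then have "(verma_act s (tens sl2_y 1) ^^ (s + 1)) 1 \<in> demazure_ideal l s"
          unfolding one verma_act_y_pow .
        moreover have "psi s (letter BH p (mon []) - smul (if p = 0 then of_nat s else 0) (mon [])) = 0" for p
          by (simp add: psi_ops psi_letter ybop_def hop_1 smul_of_nat)
        ultimately show ?thesis
          unfolding weyl_tensors_def using ideal_ops(1)[OF DI]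
          by (intro Un_least subsetI) (auto simp only: mem_Collect_eq singleton_iff psi_left_mult
              psi_pow psi_mon word_act.simps)
      qed
      moreover have "dem_tensors l s \<subseteq> {w. psi s w \<in> demazure_ideal l s}"
        using demazure_ideal_mem_pow[of s l]
        by (auto simp: dem_tensors_def psi_pow verma_act_y_pow simp del: funpow.simps power_Suc)
      ultimately show "bracket_relations \<union> weyl_tensors s \<union> dem_tensors l s \<subseteq> {w. psi s w \<in> demazure_ideal l s}"
        by blast
    qed
    moreover assume "sigma u \<in> ?J"
    ultimately have "psi s (sigma u) \<in> demazure_ideal l s" by blast
    then show "u \<in> demazure_ideal l s" by (simp add: psi_sigma)
  qed
  interpret P: presentation left_mult tdeg UNIV "demazure l s" \<pi> ?J by (rule pi)
  \<comment> \<open>Hence C[y] already maps onto the module; both maps preserve the degree in t, so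
    the graded pieces agree too.\<close>
  have eq: "\<pi> v = \<pi> (sigma (psi s v))" for v
    using P.p_eq[of v "sigma (psi s v)"] H.sigma_psi by simp
  have sigma_graded_piece: "sigma u \<in> graded_piece tdeg r" if "u \<in> graded_piece sum_mset r" for u r
  proof (cases "r < 0")
    case True
    with that have "u = 0" by (simp add: graded_piece_neg)
    then show ?thesis by (simp add: sigma_ops pm.subspace_0[OF graded_piece_subspace])
  next
    case False
    then obtain d where r: "r = int d" by (metis nat_0_le not_less)
    have "sigma (mon M) \<in> homog tdeg (sum_mset M + 0)" for M
      by (simp add: sigma_mon sum_mset_sum_list[symmetric] image_mset.compositionality comp_def)
    from plinear_homog[OF plinear_sigma this] that show ?thesis by (simp add: r graded_piece_homog)
  qed
  have psi_graded_piece: "psi s v \<in> graded_piece sum_mset r" if "v \<in> graded_piece tdeg r" for v r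
  proof (cases "r < 0")
    case True
    with that have "v = 0" by (simp add: graded_piece_neg)
    then show ?thesis by (simp add: psi_ops pm.subspace_0[OF graded_piece_subspace])
  next
    case False
    then obtain d where r: "r = int d" by (metis nat_0_le not_less)
    have "word_act s w \<in> homog sum_mset (tdeg w + 0)" for w
    proof (induction w)
      case Nil
      show ?case using homog_mon[of "{#} :: nat multiset" sum_mset 0] by simp
    next
      case (Cons x w)
      then show ?case
        by (cases "fst x") (auto simp: ybop_def add.commute[of "snd x"] intro: xop_homog hop_homog yv_mult_homog)
    qed
    then have "psi s (mon w) \<in> homog sum_mset (tdeg w + 0)" for w by simp
    from plinear_homog[OF plinear_psi this] that show ?thesis by (simp add: r graded_piece_homog)
  qed
  have "presentation (verma_act s) sum_mset UNIV (demazure l s) (\<lambda>u. \<pi> (sigma u)) (demazure_ideal l s)"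
  proof
    show "carrier (demazure l s) = (\<lambda>u. \<pi> (sigma u)) ` UNIV"
      unfolding P.carrier using eq by blast
    fix u v
    show "\<pi> (sigma u) \<oplus>\<^bsub>demazure l s\<^esub> \<pi> (sigma v) = \<pi> (sigma (u + v))"
      by (simp add: P.p_add sigma_ops)
    show "\<pi> (sigma u) = \<pi> (sigma v) \<longleftrightarrow> u - v \<in> demazure_ideal l s"
      by (simp add: P.p_eq kernel flip: sigma_ops(4))
    show "c \<odot>\<^bsub>demazure l s\<^esub> \<pi> (sigma u) = \<pi> (sigma (smul c u))" for c
      by (simp add: P.p_smul sigma_ops)
    show "act (demazure l s) A (\<pi> (sigma u)) = \<pi> (sigma (verma_act s A u))" if "A \<in> sl2t" for A
    proof -
      have "left_mult A (sigma u) - sigma (verma_act s A u) \<in> ?J"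
        using pm.subspace_neg[OF K(1) H.sigma_verma_act[of A u]] by simp
      then show ?thesis using that by (simp add: P.p_act P.p_eq)
    qed
  next
    show "grade (demazure l s) r = (\<lambda>u. \<pi> (sigma u)) ` (UNIV \<inter> graded_piece sum_mset r)" for r
      unfolding P.p_grade using eq sigma_graded_piece psi_graded_piece by (auto simp: image_iff) metis+
  qed (use action_verma_act submod_subspace[OF demazure_ideal_submod] stable_verma_act[OF demazure_ideal_submod] in
      \<open>auto simp: P.p_zero sigma_ops stable_def\<close>)
  then show ?thesis by (rule that)
qed

section \<open>Flags of Demazure modules\<close>

lemma submod_presentation_factor:
  assumes V: "presentation (verma_act s) sum_mset UNIV V \<pi> I"
    and sub: "I \<subseteq> A" "A \<subseteq> B" "submod s A" "submod s B"
  shows "presentation (verma_act s) sum_mset B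
      (quotient_module (restrict_module V (\<pi> ` B)) (\<pi> ` A))
      (\<lambda>u. \<pi> ` A +>\<^bsub>restrict_module V (\<pi> ` B)\<^esub> \<pi> u) A"
proof -
  interpret V: presentation "verma_act s" sum_mset UNIV V \<pi> I by (rule V)
  interpret R: presentation "verma_act s" sum_mset B "restrict_module V (\<pi> ` B)" \<pi> I
    using sub by (intro V.restrict_presentation submod_subspace[of s] stable_verma_act) auto
  show ?thesis
    using sub by (intro R.quotient_presentation submod_subspace[of s] stable_verma_act) auto
qed

text \<open>As \<open>B\<close> is generated by \<open>q\<close> modulo \<open>A\<close>,
  multiplication by \<open>q\<close> induces an isomorphism from C[y] modulo \<open>C\<close> onto
  the factor. It raises the degree in t by \<open>d\<close>, whence the shift.\<close>

lemma factor_iso: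
  assumes V: "presentation (verma_act s) sum_mset UNIV V \<pi> I"
    and sub: "I \<subseteq> A" "A \<subseteq> B" "submod s A" "submod s B"
    and D: "presentation (verma_act r) sum_mset UNIV D \<pi>' C"
    and B: "B = {u + p * q | u p. u \<in> A}" and q: "q \<in> homog sum_mset d"
    and hw: "highest_weight_mod s r A q" and C: "{p. p * q \<in> A} = C" and grA: "tgraded sum_mset A"
  shows "graded_iso (quotient_module (restrict_module V (\<pi> ` B)) (\<pi> ` A)) (shift (int d) D)"
proof -
  let ?Q = "quotient_module (restrict_module V (\<pi> ` B)) (\<pi> ` A)"
  define k where "k u = \<pi> ` A +>\<^bsub>restrict_module V (\<pi> ` B)\<^esub> \<pi> u" for u
  interpret Q: presentation "verma_act s" sum_mset B ?Q k A
    using submod_presentation_factor[OF V sub] unfolding k_def[abs_def] .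
  interpret D: presentation "verma_act r" sum_mset UNIV D \<pi>' C by (rule D)
  note IA = submod_ideal[OF sub(3)]
  have pqB: "p * q \<in> B" for p
  proof -
    have "p * q = 0 + p * q" by simp
    then show ?thesis unfolding B using ideal_ops(1)[OF IA] by blast
  qed
  have kq_eq: "k (u * q) = k (u' * q) \<longleftrightarrow> \<pi>' u = \<pi>' u'" for u u'
    using Q.p_eq[OF pqB pqB, of u u'] D.p_eq[of u u'] C by (auto simp: left_diff_distrib)
  have kB: "\<exists>p. k w = k (p * q)" if w: "w \<in> B" for w
  proof -
    obtain u p where "w = u + p * q" "u \<in> A" using w B by blast
    then have "w - p * q \<in> A" by simp
    then show ?thesis using Q.p_eq[OF w pqB] by blast
  qed
  \<comment> \<open>The inverse of multiplication by \<open>q\<close>; \<open>kq_eq\<close> makes it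
    independent of the choice.\<close>
  define \<phi> where "\<phi> x = \<pi>' (SOME u. k (u * q) = x)" for x
  have phi: "\<phi> (k (u * q)) = \<pi>' u" for u
  proof -
    have "k ((SOME u'. k (u' * q) = k (u * q)) * q) = k (u * q)" by (rule someI) (rule refl)
    then show ?thesis unfolding \<phi>_def kq_eq .
  qed
  have carr: "carrier ?Q = range (\<lambda>u. k (u * q))"
    unfolding Q.carrier using kB pqB by blast
  have act: "k (verma_act s A' (u * q)) = k (verma_act r A' u * q)" if "A' \<in> sl2t" for A' u
  proof -
    have poly_apply: "poly_apply f T (u * q) - poly_apply f T' u * q \<in> A"
      if "\<And>i. T i (u * q) - T' i u * q \<in> A" for f T T'
    proof -
      have eq: "poly_apply f T (u * q) - poly_apply f T' u * q =
        (\<Sum>i\<le>Polynomial.degree f. smul (Polynomial.coeff f i) (T i (u * q) - T' i u * q))"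
        by (simp add: poly_apply_def sum_distrib_right sum_subtractf pm.scale_right_diff_distrib)
      show ?thesis unfolding eq by (intro ideal_ops(5)[OF IA] ideal_ops(6)[OF IA] that)
    qed
    have eq: "verma_act s A' (u * q) - verma_act r A' u * q =
        (poly_apply (A' $ 1 $ 2) (xop s) (u * q) - poly_apply (A' $ 1 $ 2) (xop r) u * q) +
        (poly_apply (A' $ 2 $ 1) (\<lambda>p u. yv p * u) (u * q) - poly_apply (A' $ 2 $ 1) (\<lambda>p u. yv p * u) u * q) +
        (poly_apply (A' $ 1 $ 1) (hop s) (u * q) - poly_apply (A' $ 1 $ 1) (hop r) u * q)"
      by (simp add: verma_act_def current_apply_def algebra_simps)
    have "verma_act s A' (u * q) - verma_act r A' u * q \<in> A"
      unfolding eq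
      by (intro ideal_ops(2)[OF IA] poly_apply highest_weight_mod_mult[OF IA hw])
        (simp add: mult.assoc ideal_ops(1)[OF IA])
    then show ?thesis using Q.p_eq[OF Q.L_B[OF that pqB] pqB] by blast
  qed
  show ?thesis
    unfolding graded_iso_def
  proof (intro exI[of _ \<phi>] conjI ballI allI)
    show "bij_betw \<phi> (carrier ?Q) (carrier (shift (int d) D))"
      unfolding bij_betw_def
    proof
      show "inj_on \<phi> (carrier ?Q)"
      proof (rule inj_onI)
        fix x y assume "x \<in> carrier ?Q" "y \<in> carrier ?Q" "\<phi> x = \<phi> y"
        then obtain u u' where "x = k (u * q)" "y = k (u' * q)" "\<phi> x = \<phi> y" by (auto simp: carr)
        then show "x = y" unfolding kq_eq[symmetric] by (simp add: phi kq_eq)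
      qed
      show "\<phi> ` carrier ?Q = carrier (shift (int d) D)"
        unfolding carr by (simp add: image_image phi shift_def D.carrier)
    qed
  next
    fix v w assume "v \<in> carrier ?Q" "w \<in> carrier ?Q"
    then obtain u u' where "v = k (u * q)" "w = k (u' * q)" by (auto simp: carr)
    then show "\<phi> (v \<oplus>\<^bsub>?Q\<^esub> w) = \<phi> v \<oplus>\<^bsub>shift (int d) D\<^esub> \<phi> w"
      using phi[of "u + u'"] by (simp add: Q.p_add pqB phi D.p_add shift_def distrib_right)
  next
    fix c v assume "v \<in> carrier ?Q"
    then obtain u where "v = k (u * q)" by (auto simp: carr)
    then show "\<phi> (c \<odot>\<^bsub>?Q\<^esub> v) = c \<odot>\<^bsub>shift (int d) D\<^esub> \<phi> v"
      using phi[of "smul c u"] by (simp add: Q.p_smul pqB phi D.p_smul shift_def)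
  next
    fix A' v assume A': "A' \<in> sl2t" and "v \<in> carrier ?Q"
    then obtain u where "v = k (u * q)" by (auto simp: carr)
    then show "\<phi> (act ?Q A' v) = act (shift (int d) D) A' (\<phi> v)"
      using A' by (simp add: Q.p_act pqB act phi D.p_act shift_def)
  next
    fix e :: int
    have "\<phi> ` grade ?Q e = \<pi>' ` graded_piece sum_mset (e - int d)"
    proof (intro subset_antisym subsetI)
      fix x assume "x \<in> \<phi> ` grade ?Q e"
      then obtain w where w: "w \<in> B" "w \<in> graded_piece sum_mset e" "x = \<phi> (k w)" by (auto simp: Q.p_grade)
      have "\<exists>p \<in> graded_piece sum_mset (e - int d). w - p * q \<in> A"
      proof (cases "e < 0")
        case True
        with w have "w = 0" by (simp add: graded_piece_neg)
        then have "w - 0 * q \<in> A" using ideal_ops(1)[OF IA] by simp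
        then show ?thesis using pm.subspace_0[OF graded_piece_subspace] by blast
      next
        case False
        then obtain e' where e: "e = int e'" by (metis nat_0_le not_less)
        obtain u p where up: "w = u + p * q" "u \<in> A" using w(1) B by blast
        have "w = component sum_mset e' w" using w(2) by (simp add: e graded_piece_homog component_of_homog)
        also have "\<dots> = component sum_mset e' u + component sum_mset e' (p * q)" by (simp add: up(1) component_add)
        finally have w': "w - component sum_mset e' (p * q) = component sum_mset e' u" by simp
        define p' where "p' = (if d \<le> e' then component sum_mset (e' - d) p else 0)"
        have "component sum_mset e' (p * q) = p' * q"
          using component_mult_homog[OF _ q, of e' p] by (simp add: p'_def)
        moreover have "p' \<in> graded_piece sum_mset (e - int d)"
          using component_homog[of sum_mset "e' - d" p] pm.subspace_0[OF graded_piece_subspace, of sum_mset "e - int d"]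
          by (auto simp: p'_def e of_nat_diff simp flip: graded_piece_homog)
        moreover have "component sum_mset e' u \<in> A" using grA up(2) by (simp add: tgraded_def)
        ultimately show ?thesis using w' by (intro bexI[of _ p']) auto
      qed
      then obtain p where p: "p \<in> graded_piece sum_mset (e - int d)" "w - p * q \<in> A" by blast
      then have "k w = k (p * q)" using Q.p_eq[OF w(1) pqB] by blast
      with w p show "x \<in> \<pi>' ` graded_piece sum_mset (e - int d)" by (simp add: phi)
    next
      fix x assume "x \<in> \<pi>' ` graded_piece sum_mset (e - int d)"
      then obtain p where p: "p \<in> graded_piece sum_mset (e - int d)" "x = \<pi>' p" by blast
      have "p * q \<in> graded_piece sum_mset e"
      proof (cases "e - int d < 0")
        case True
        with p have "p = 0" by (simp add: graded_piece_neg)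
        then show ?thesis by (simp add: pm.subspace_0[OF graded_piece_subspace])
      next
        case False
        then obtain f where f: "e - int d = int f" by (metis nat_0_le not_less)
        then have "p * q \<in> homog sum_mset (f + d)"
          using p q by (intro homog_mult) (simp_all add: graded_piece_homog)
        moreover have "e = int (f + d)" using f by simp
        ultimately show ?thesis by (simp only: graded_piece_homog)
      qed
      then have "k (p * q) \<in> grade ?Q e" using pqB by (auto simp: Q.p_grade)
      with p phi show "x \<in> \<phi> ` grade ?Q e" by (metis image_eqI)
    qed
    then show "\<phi> ` grade ?Q e = grade (shift (int d) D) e"
      by (simp add: shift_def D.p_grade)
  qed
qed

text \<open>The inductive flag unrolled into sequences. Gradedness travels upwards: adjoining
  multiples of a homogeneous \<open>q\<close> to a graded ideal leaves it graded.\<close>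

lemma ideal_flag_chain:
  assumes "ideal_flag t_homogeneous n A rs" "tgraded sum_mset A"
  shows "\<exists>Bs qs. Bs 0 = UNIV \<and> Bs (length rs) = A \<and>
    (\<forall>j\<le>length rs. submod n (Bs j) \<and> tgraded sum_mset (Bs j) \<and> A \<subseteq> Bs j) \<and>
    (\<forall>j<length rs. Bs (Suc j) \<subseteq> Bs j \<and> Bs j = {u + p * qs j | u p. u \<in> Bs (Suc j)} \<and> qs j \<in> t_homogeneous \<and>
      highest_weight_mod n (rs ! j) (Bs (Suc j)) (qs j) \<and> {p. p * qs j \<in> Bs (Suc j)} = demazure_ideal 3 (rs ! j))"
  using assms
proof (induction rule: ideal_flag.induct)
  case ideal_flag_base
  show ?case
    by (intro exI[of _ "\<lambda>_. UNIV"]) (auto simp: submod_def is_ideal_def tgraded_UNIV)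
next
  case (ideal_flag_step B rs A q e r)
  obtain d where d: "q \<in> homog sum_mset d" using ideal_flag_step.hyps(4) by (auto simp: t_homogeneous_def)
  have AB: "A \<subseteq> B"
  proof
    fix u assume "u \<in> A"
    moreover have "u = u + 0 * q" by simp
    ultimately show "u \<in> B" unfolding ideal_flag_step.hyps(3) by blast
  qed
  have "tgraded sum_mset B"
    unfolding tgraded_def
  proof (intro ballI allI)
    fix w i assume "w \<in> B"
    then obtain u p where w: "w = u + p * q" "u \<in> A" unfolding ideal_flag_step.hyps(3) by blast
    then have "component sum_mset i w = component sum_mset i u + (if d \<le> i then component sum_mset (i - d) p else 0) * q"
      using component_mult_homog[OF _ d, of i p] by (simp add: component_add)
    moreover have "component sum_mset i u \<in> A" using w ideal_flag_step.prems by (simp add: tgraded_def)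
    ultimately show "component sum_mset i w \<in> B" unfolding ideal_flag_step.hyps(3) by blast
  qed
  then obtain Bs qs where IH: "Bs 0 = UNIV" "Bs (length rs) = B"
    "\<And>j. j \<le> length rs \<Longrightarrow> submod n (Bs j) \<and> tgraded sum_mset (Bs j) \<and> B \<subseteq> Bs j"
    "\<And>j. j < length rs \<Longrightarrow> Bs (Suc j) \<subseteq> Bs j \<and> Bs j = {u + p * qs j | u p. u \<in> Bs (Suc j)} \<and> qs j \<in> t_homogeneous \<and>
      highest_weight_mod n (rs ! j) (Bs (Suc j)) (qs j) \<and> {p. p * qs j \<in> Bs (Suc j)} = demazure_ideal 3 (rs ! j)"
    using ideal_flag_step.IH by blast
  define Bs' where "Bs' = Bs(Suc (length rs) := A)"
  define qs' where "qs' = qs(length rs := q)"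
  have 0: "Bs' 0 = UNIV" "Bs' (length (rs @ [r])) = A" by (simp_all add: Bs'_def IH(1))
  have 1: "submod n (Bs' j) \<and> tgraded sum_mset (Bs' j) \<and> A \<subseteq> Bs' j" if "j \<le> length (rs @ [r])" for j
  proof (cases "j = Suc (length rs)")
    case True
    then show ?thesis using ideal_flag_step by (simp add: Bs'_def)
  next
    case False
    then have "j \<le> length rs" using that by simp
    from IH(3)[OF this] False show ?thesis using AB by (auto simp: Bs'_def)
  qed
  have 2: "Bs' (Suc j) \<subseteq> Bs' j \<and> Bs' j = {u + p * qs' j | u p. u \<in> Bs' (Suc j)} \<and> qs' j \<in> t_homogeneous \<and>
      highest_weight_mod n ((rs @ [r]) ! j) (Bs' (Suc j)) (qs' j) \<and>
      {p. p * qs' j \<in> Bs' (Suc j)} = demazure_ideal 3 ((rs @ [r]) ! j)" if "j < length (rs @ [r])" for j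
  proof (cases "j = length rs")
    case True
    then show ?thesis using ideal_flag_step AB IH(2) by (simp add: Bs'_def qs'_def)
  next
    case False
    then have "j < length rs" using that by simp
    then have eqs: "Bs' (Suc j) = Bs (Suc j)" "Bs' j = Bs j" "qs' j = qs j" "(rs @ [r]) ! j = rs ! j"
      by (simp_all add: Bs'_def qs'_def nth_append)
    show ?thesis unfolding eqs by (rule IH(4)[OF \<open>j < length rs\<close>])
  qed
  show ?case using 0 1 2 by blast
qed

lemma flag_weights_nonempty: "flag_weights a b c \<noteq> []"
  by (induction a b c rule: flag_weights.induct) auto

lemma demazure_flag_exists: "\<exists>k F \<rho> \<sigma>. demazure_flag 3 (demazure 2 s) k F \<rho> \<sigma>"
proof -
  obtain \<pi> where pi: "presentation (verma_act s) sum_mset UNIV (demazure 2 s) \<pi> (demazure_ideal 2 s)"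
    using demazure_presentation[of 2 s] by auto
  interpret V: presentation "verma_act s" sum_mset UNIV "demazure 2 s" \<pi> "demazure_ideal 2 s" by (rule pi)
  define rs where "rs = flag_weights 0 (s div 2) (s mod 2)"
  \<comment> \<open>A flag with last index \<open>k\<close> has \<open>k + 1\<close> factors, so the
    list of weights has to be non-empty.\<close>
  define k where "k = length rs - 1"
  have k: "length rs = Suc k" using flag_weights_nonempty[of 0 "s div 2" "s mod 2"] by (simp add: k_def rs_def)
  obtain Bs qs where chain: "Bs 0 = UNIV \<and> Bs (Suc k) = demazure_ideal 2 s \<and>
    (\<forall>j\<le>Suc k. submod s (Bs j) \<and> tgraded sum_mset (Bs j) \<and> demazure_ideal 2 s \<subseteq> Bs j) \<and>
    (\<forall>j<Suc k. Bs (Suc j) \<subseteq> Bs j \<and> Bs j = {u + p * qs j | u p. u \<in> Bs (Suc j)} \<and> qs j \<in> t_homogeneous \<and>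
      highest_weight_mod s (rs ! j) (Bs (Suc j)) (qs j) \<and> {p. p * qs j \<in> Bs (Suc j)} = demazure_ideal 3 (rs ! j))"
    using ideal_flag_chain[OF ideal_flag_demazure_ideal_2[of s] tgraded_demazure_ideal] unfolding rs_def[symmetric] k
    by (elim exE) (rule that)
  have Bs: "Bs 0 = UNIV" "Bs (Suc k) = demazure_ideal 2 s"
    "\<And>j. j \<le> Suc k \<Longrightarrow> submod s (Bs j) \<and> tgraded sum_mset (Bs j) \<and> demazure_ideal 2 s \<subseteq> Bs j"
    "\<And>j. j < Suc k \<Longrightarrow> Bs (Suc j) \<subseteq> Bs j \<and> Bs j = {u + p * qs j | u p. u \<in> Bs (Suc j)} \<and> qs j \<in> t_homogeneous \<and>
      highest_weight_mod s (rs ! j) (Bs (Suc j)) (qs j) \<and> {p. p * qs j \<in> Bs (Suc j)} = demazure_ideal 3 (rs ! j)"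
    using chain by blast+
  have "\<exists>d. qs j \<in> homog sum_mset d" if "j < Suc k" for j
    using Bs(4)[OF that] unfolding t_homogeneous_def by blast
  then obtain \<sigma> where \<sigma>: "\<And>j. j < Suc k \<Longrightarrow> qs j \<in> homog sum_mset (\<sigma> j)" by metis
  have "demazure_flag 3 (demazure 2 s) k (\<lambda>j. \<pi> ` Bs j) (\<lambda>j. rs ! j) \<sigma>"
    unfolding demazure_flag_def
  proof (intro conjI allI impI)
    show "\<pi> ` Bs 0 = carrier (demazure 2 s)" by (simp add: Bs V.carrier)
    have "\<pi> u = \<zero>\<^bsub>demazure 2 s\<^esub>" if "u \<in> demazure_ideal 2 s" for u using that V.p_eq_zero[of u] by simp
    moreover have "\<pi> 0 = \<zero>\<^bsub>demazure 2 s\<^esub>" by (simp add: V.p_zero)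
    moreover have "0 \<in> demazure_ideal 2 s" by (rule V.N_closed(1))
    ultimately have "\<pi> ` demazure_ideal 2 s = {\<zero>\<^bsub>demazure 2 s\<^esub>}" by force
    then show "\<pi> ` Bs (k + 1) = {\<zero>\<^bsub>demazure 2 s\<^esub>}" by (simp add: Bs(2))
  next
    fix j assume "j \<le> k + 1"
    then have j: "submod s (Bs j)" "tgraded sum_mset (Bs j)" "demazure_ideal 2 s \<subseteq> Bs j" using Bs(3)[of j] by auto
    interpret R: presentation "verma_act s" sum_mset "Bs j" "restrict_module (demazure 2 s) (\<pi> ` Bs j)" \<pi> "demazure_ideal 2 s"
      using j by (intro V.restrict_presentation submod_subspace[of s] stable_verma_act) auto
    have "graded_module (restrict_module (demazure 2 s) (\<pi> ` Bs j))"
      by (rule R.graded_module)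
        (simp_all add: verma_act_bracket R.N_closed verma_act_graded_piece j(2) tgraded_demazure_ideal)
    then show "graded_submodule (\<pi> ` Bs j) (demazure 2 s)"
      by (auto simp: graded_submodule_def V.carrier)
  next
    fix j assume "j \<le> k"
    then have j: "j < Suc k" by simp
    show "\<pi> ` Bs (j + 1) \<subseteq> \<pi> ` Bs j" using Bs(4)[OF j] by auto
    obtain \<pi>' where D: "presentation (verma_act (rs ! j)) sum_mset UNIV (demazure 3 (rs ! j)) \<pi>' (demazure_ideal 3 (rs ! j))"
      using demazure_presentation[of 3 "rs ! j"] by auto
    show "graded_iso (quotient_module (restrict_module (demazure 2 s) (\<pi> ` Bs j)) (\<pi> ` Bs (j + 1)))
        (shift (int (\<sigma> j)) (demazure 3 (rs ! j)))"
    proof -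
      have b: "Bs (Suc j) \<subseteq> Bs j" "Bs j = {u + p * qs j | u p. u \<in> Bs (Suc j)}"
        "highest_weight_mod s (rs ! j) (Bs (Suc j)) (qs j)" "{p. p * qs j \<in> Bs (Suc j)} = demazure_ideal 3 (rs ! j)"
        using Bs(4)[OF j] by blast+
      have c: "submod s (Bs j)" "submod s (Bs (Suc j))" "tgraded sum_mset (Bs (Suc j))" "demazure_ideal 2 s \<subseteq> Bs (Suc j)"
        using Bs(3)[of j] Bs(3)[of "Suc j"] j by simp_all
      show ?thesis
        using factor_iso[OF pi c(4) b(1) c(2) c(1) D b(2) \<sigma>[OF j] b(3,4) c(3)] by simp
    qed
  qed
  then show ?thesis by blast
qed

text \<open>Preimages in C[y] turn an arbitrary flag of modules into one of ideals. Only the action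
  is carried over, so the generators come without a degree in t and \<open>G\<close> is
  \<open>UNIV\<close>.\<close>

lemma demazure_flag_ideal_flag:
  assumes flag: "demazure_flag 3 (demazure 2 s) k F \<rho> \<sigma>"
  shows "ideal_flag UNIV s (demazure_ideal 2 s) (map \<rho> [0..<k + 1])"
proof -
  obtain \<pi> where pi: "presentation (verma_act s) sum_mset UNIV (demazure 2 s) \<pi> (demazure_ideal 2 s)"
    using demazure_presentation[of 2 s] by auto
  let ?V = "demazure 2 s"
  interpret V: presentation "verma_act s" sum_mset UNIV ?V \<pi> "demazure_ideal 2 s" by (rule pi)
  define Bs where "Bs j = {u. \<pi> u \<in> F j}" for j
  have F0: "F 0 = carrier ?V" and Fk: "F (k + 1) = {\<zero>\<^bsub>?V\<^esub>}"
    and sub: "\<And>j. j \<le> k + 1 \<Longrightarrow> graded_submodule (F j) ?V"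
    and step: "\<And>j. j \<le> k \<Longrightarrow> F (j + 1) \<subseteq> F j \<and>
        graded_iso (quotient_module (restrict_module ?V (F j)) (F (j + 1))) (shift (int (\<sigma> j)) (demazure 3 (\<rho> j)))"
    using flag by (auto simp: demazure_flag_def)
  have F_image: "F j = \<pi> ` Bs j" if "j \<le> k + 1" for j
    using sub[OF that] by (auto simp: graded_submodule_def V.carrier Bs_def)
  have Bs_sub: "submod s (Bs j) \<and> demazure_ideal 2 s \<subseteq> Bs j" if j: "j \<le> k + 1" for j
  proof -
    interpret R: graded_module "restrict_module ?V (F j)"
      using sub[OF j] by (simp add: graded_submodule_def)
    have add: "x \<oplus>\<^bsub>?V\<^esub> y \<in> F j" if "x \<in> F j" "y \<in> F j" for x y
      using R.M.a_closed[of x y] that by (simp add: restrict_module_def)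
    have smul: "c \<odot>\<^bsub>?V\<^esub> x \<in> F j" if "x \<in> F j" for c x
      using R.smult_closed[of c x] that by (simp add: restrict_module_def ring_of_type_algebra_def)
    have act: "act ?V A x \<in> F j" if "A \<in> sl2t" "x \<in> F j" for A x
      using R.act_closed[of A x] that by (simp add: restrict_module_def)
    have zero: "\<zero>\<^bsub>?V\<^esub> \<in> F j"
      using R.M.zero_closed by (simp add: restrict_module_def)
    have "submod s (Bs j)"
    proof (rule submod_of_stable)
      show "pm.subspace (Bs j)"
        using add smul zero by (auto simp: pm.subspace_def Bs_def V.p_zero simp flip: V.p_add V.p_smul)
      show "stable (verma_act s) (Bs j)"
        using act by (auto simp: stable_def Bs_def simp flip: V.p_act)
    qed
    moreover have "demazure_ideal 2 s \<subseteq> Bs j"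
    proof
      fix u assume "u \<in> demazure_ideal 2 s"
      then have "\<pi> u = \<zero>\<^bsub>?V\<^esub>" using V.p_eq_zero[of u] by simp
      then show "u \<in> Bs j" using zero by (simp add: Bs_def)
    qed
    ultimately show ?thesis by blast
  qed
  have "ideal_flag UNIV s (Bs j) (map \<rho> [0..<j])" if "j \<le> k + 1" for j
    using that
  proof (induction j)
    case 0
    have "Bs 0 = UNIV" by (auto simp: Bs_def F0 V.carrier)
    then show ?case by (simp add: ideal_flag_base)
  next
    case (Suc j)
    then have j: "j \<le> k" "j \<le> k + 1" "Suc j \<le> k + 1" by auto
    let ?r = "\<rho> j" and ?A = "Bs (Suc j)" and ?B = "Bs j"
    let ?Q = "quotient_module (restrict_module ?V (\<pi> ` ?B)) (\<pi> ` ?A)"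
    have A: "submod s ?A" "demazure_ideal 2 s \<subseteq> ?A" and B: "submod s ?B" and AB: "?A \<subseteq> ?B"
      using Bs_sub[OF j(3)] Bs_sub[OF j(2)] step[OF j(1)] by (auto simp: Bs_def)
    note IA = submod_ideal[OF A(1)]
    define \<kappa> where "\<kappa> u = \<pi> ` ?A +>\<^bsub>restrict_module ?V (\<pi> ` ?B)\<^esub> \<pi> u" for u
    interpret Q: presentation "verma_act s" sum_mset ?B ?Q \<kappa> ?A
      using submod_presentation_factor[OF pi A(2) AB A(1) B] unfolding \<kappa>_def[abs_def] .
    obtain \<pi>' where D: "presentation (verma_act ?r) sum_mset UNIV (demazure 3 ?r) \<pi>' (demazure_ideal 3 ?r)"
      using demazure_presentation[of 3 ?r] by auto
    interpret D: presentation "verma_act ?r" sum_mset UNIV "demazure 3 ?r" \<pi>' "demazure_ideal 3 ?r" by (rule D)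
    have "graded_iso ?Q (shift (int (\<sigma> j)) (demazure 3 ?r))"
      using step[OF j(1)] F_image[OF j(2)] F_image[OF j(3)] by simp
    then obtain \<phi> where bij: "bij_betw \<phi> (carrier ?Q) (carrier (demazure 3 ?r))"
      and phi_add: "\<And>v w. v \<in> carrier ?Q \<Longrightarrow> w \<in> carrier ?Q \<Longrightarrow> \<phi> (v \<oplus>\<^bsub>?Q\<^esub> w) = \<phi> v \<oplus>\<^bsub>demazure 3 ?r\<^esub> \<phi> w"
      and phi_smul: "\<And>c v. v \<in> carrier ?Q \<Longrightarrow> \<phi> (c \<odot>\<^bsub>?Q\<^esub> v) = c \<odot>\<^bsub>demazure 3 ?r\<^esub> \<phi> v"
      and phi_act: "\<And>A v. A \<in> sl2t \<Longrightarrow> v \<in> carrier ?Q \<Longrightarrow> \<phi> (act ?Q A v) = act (demazure 3 ?r) A (\<phi> v)"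
      unfolding graded_iso_def shift_def by auto
    have kc: "\<kappa> u \<in> carrier ?Q" if "u \<in> ?B" for u using that by (simp add: Q.carrier)
    have inj: "\<kappa> u = \<kappa> v" if "\<phi> (\<kappa> u) = \<phi> (\<kappa> v)" "u \<in> ?B" "v \<in> ?B" for u v
      using bij that kc by (auto simp: bij_betw_def inj_on_def)
    have "\<pi>' 1 \<in> \<phi> ` carrier ?Q" using bij by (simp add: bij_betw_def D.carrier)
    \<comment> \<open>A preimage of the Demazure generator. It may have components of several sizes;
      modulo \<open>?A\<close> only the one of the right weight matters, and this becomes
      \<open>q\<close> below.\<close>
    then obtain q0 where q0: "q0 \<in> ?B" "\<phi> (\<kappa> q0) = \<pi>' 1" by (auto simp: Q.carrier)
    have pB: "p * q0 \<in> ?B" for p by (rule ideal_mult[OF submod_ideal[OF B] q0(1)])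
    have ev: "\<phi> (\<kappa> (p * q0)) = \<pi>' p" for p
    proof (induction p rule: ypoly_induct)
      case one
      then show ?case by (simp add: q0)
    next
      case (var i p)
      have "\<kappa> (yv i * p * q0) = act ?Q (tens sl2_y (Polynomial.monom 1 i)) (\<kappa> (p * q0))"
        by (simp add: Q.p_act pB mult.assoc)
      then show ?case by (simp add: phi_act kc pB var D.p_act)
    next
      case (add p p')
      have "\<kappa> ((p + p') * q0) = \<kappa> (p * q0) \<oplus>\<^bsub>?Q\<^esub> \<kappa> (p' * q0)"
        by (simp add: Q.p_add pB distrib_right)
      then show ?case by (simp add: phi_add kc pB add D.p_add)
    next
      case (smul c p)
      have "\<kappa> (smul c p * q0) = c \<odot>\<^bsub>?Q\<^esub> \<kappa> (p * q0)" by (simp add: Q.p_smul pB)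
      then show ?case by (simp add: phi_smul kc pB smul D.p_smul)
    qed
    have mem: "u - p * q0 \<in> ?A \<longleftrightarrow> \<phi> (\<kappa> u) = \<pi>' p" if "u \<in> ?B" for u p
      using Q.p_eq[OF that pB, of p] inj[OF _ that pB, of p] ev[of p] by auto
    have colon0: "{p. p * q0 \<in> ?A} = demazure_ideal 3 ?r"
    proof (intro Set.set_eqI)
      fix p
      have "p * q0 \<in> ?A \<longleftrightarrow> \<pi>' p = \<pi>' 0" using mem[OF pB, of p 0] by (simp add: ev)
      also have "\<dots> \<longleftrightarrow> p \<in> demazure_ideal 3 ?r" using D.p_eq[of p 0] by simp
      finally show "p \<in> {p. p * q0 \<in> ?A} \<longleftrightarrow> p \<in> demazure_ideal 3 ?r" by simp
    qed
    have gen0: "\<exists>p. u - p * q0 \<in> ?A" if "u \<in> ?B" for u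
    proof -
      have "\<phi> (\<kappa> u) \<in> carrier (demazure 3 ?r)" using bij kc[OF that] by (auto simp: bij_betw_def)
      then obtain p where "\<phi> (\<kappa> u) = \<pi>' p" by (auto simp: D.carrier)
      then show ?thesis using mem[OF that] by blast
    qed
    have hw0: "highest_weight_mod s ?r ?A q0"
      unfolding highest_weight_mod_def
    proof (intro allI conjI)
      fix i
      have B': "hop s i q0 \<in> ?B" "xop s i q0 \<in> ?B" using B q0(1) by (auto simp: submod_def)
      have "\<phi> (\<kappa> (hop s i q0)) = act (demazure 3 ?r) (tens sl2_h (Polynomial.monom 1 i)) (\<phi> (\<kappa> q0))"
        using phi_act[of "tens sl2_h (Polynomial.monom 1 i)" "\<kappa> q0"] kc[OF q0(1)] by (simp add: Q.p_act q0(1))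
      then have "\<phi> (\<kappa> (hop s i q0)) = \<pi>' (hop ?r i 1)" by (simp add: q0(2) D.p_act)
      then have "hop s i q0 - hop ?r i 1 * q0 \<in> ?A" using mem[OF B'(1)] by blast
      then show "hop s i q0 - (if i = 0 then of_nat ?r * q0 else 0) \<in> ?A"
        by (simp add: hop_1 split: if_splits)
      have "\<phi> (\<kappa> (xop s i q0)) = act (demazure 3 ?r) (tens sl2_x (Polynomial.monom 1 i)) (\<phi> (\<kappa> q0))"
        using phi_act[of "tens sl2_x (Polynomial.monom 1 i)" "\<kappa> q0"] kc[OF q0(1)] by (simp add: Q.p_act q0(1))
      then have "\<phi> (\<kappa> (xop s i q0)) = \<pi>' (xop ?r i 1)" by (simp add: q0(2) D.p_act)
      then have "xop s i q0 - xop ?r i 1 * q0 \<in> ?A" using mem[OF B'(2)] by blast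
      then show "xop s i q0 \<in> ?A" by simp
    qed
    \<comment> \<open>On size \<open>R\<close> the operator h has eigenvalue \<open>s - 2 R\<close>,
      but modulo \<open>?A\<close> it acts on \<open>q0\<close> by \<open>\<rho> j\<close>.\<close>
    have off_weight: "component size R q0 \<in> ?A" if "s \<noteq> ?r + 2 * R" for R
    proof -
      have "hop s 0 q0 - of_nat ?r * q0 \<in> ?A" using hw0[unfolded highest_weight_mod_def, rule_format, of 0] by simp
      then have "component size R (hop s 0 q0 - of_nat ?r * q0) \<in> ?A" by (rule submod_component_size[OF A(1)])
      moreover have "component size R (hop s 0 u) = hop s 0 (component size R u)" for u
      proof -
        have "plinear (\<lambda>u. component size R (hop s 0 u))" "plinear (\<lambda>u. hop s 0 (component size R u))"
          by (rule plinearI; simp add: component_add component_smul)+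
        then show ?thesis
        proof (rule plinear_eqI)
          fix M :: "nat multiset"
          have h: "mon M \<in> homog size (size M)" by simp
          have "hop s 0 (mon M) = smul (of_nat s - of_nat (2 * size M)) (mon M)"
            by (simp only: hop_0_homog[OF h] pm.scale_left_diff_distrib smul_of_nat)
          then show "component size R (hop s 0 (mon M)) = hop s 0 (component size R (mon M))"
            by (simp add: component_smul)
        qed
      qed
      ultimately have "hop s 0 (component size R q0) - of_nat ?r * component size R q0 \<in> ?A"
        by (simp add: component_diff plinear_of_nat[OF plinear_component])
      then have "of_nat s * component size R q0 - of_nat (2 * R) * component size R q0 - of_nat ?r * component size R q0 \<in> ?A"
        by (simp only: hop_0_homog[OF component_homog])
      then have *: "smul (of_nat s - of_nat (2 * R) - of_nat ?r) (component size R q0) \<in> ?A"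
        by (simp only: pm.scale_left_diff_distrib smul_of_nat)
      have "(of_nat s - of_nat (2 * R) - of_nat ?r :: complex) \<noteq> 0"
      proof
        assume "(of_nat s - of_nat (2 * R) - of_nat ?r :: complex) = 0"
        then have "(of_nat s :: complex) = of_nat (?r + 2 * R)" by (simp add: algebra_simps)
        then show False using that by (simp only: of_nat_eq_iff)
      qed
      with ideal_ops(6)[OF IA *, of "inverse (of_nat s - of_nat (2 * R) - of_nat ?r)"]
      show ?thesis by simp
    qed
    have sum_q0: "q0 = (\<Sum>R\<in>size ` Poly_Mapping.keys q0. component size R q0)"
      by (rule sym, rule component_sum_eq) auto
    \<comment> \<open>Otherwise all components of \<open>q0\<close> lie in \<open>?A\<close> and the
      factor is zero, whereas a Demazure module is not.\<close>
    have "\<exists>e. s = ?r + 2 * e"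
    proof (rule ccontr)
      assume "\<nexists>e. s = ?r + 2 * e"
      then have "q0 \<in> ?A" using off_weight by (subst sum_q0) (auto intro!: ideal_ops(5)[OF IA])
      then have "1 \<in> demazure_ideal 3 ?r" unfolding colon0[symmetric] by simp
      then show False by (simp add: one_notin_demazure_ideal)
    qed
    then obtain e where e: "s = ?r + 2 * e" by blast
    define q where "q = component size e q0"
    have q0q: "q0 - q \<in> ?A"
    proof -
      let ?S = "insert e (size ` Poly_Mapping.keys q0)"
      have "q0 = (\<Sum>R\<in>?S. component size R q0)"
        by (rule sym, rule component_sum_eq) auto
      also have "\<dots> = q + (\<Sum>R\<in>?S - {e}. component size R q0)"
        unfolding q_def by (rule sum.remove) auto
      finally have "q0 - q = (\<Sum>R\<in>?S - {e}. component size R q0)" by (simp add: algebra_simps)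
      also have "\<dots> \<in> ?A" using e off_weight by (intro ideal_ops(5)[OF IA]) auto
      finally show ?thesis .
    qed
    have pq: "p * q0 - p * q \<in> ?A" for p
      using ideal_mult[OF IA q0q, of p] by (simp add: right_diff_distrib)
    have "ideal_flag UNIV s ?A (map \<rho> [0..<j] @ [?r])"
    proof (rule ideal_flag_step)
      show "ideal_flag UNIV s ?B (map \<rho> [0..<j])" using Suc.IH j by simp
      show "submod s ?A" by (rule A)
      show "q \<in> homog size e" unfolding q_def by (rule component_homog)
      show "s = ?r + 2 * e" by (rule e)
      show "?B = {u + p * q | u p. u \<in> ?A}"
      proof (intro subset_antisym subsetI)
        fix w assume "w \<in> ?B"
        then obtain p where "w - p * q0 \<in> ?A" using gen0 by blast
        then have "(w - p * q0) + (p * q0 - p * q) \<in> ?A" by (rule ideal_ops(2)[OF IA _ pq])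
        then have "w - p * q \<in> ?A" by simp
        moreover have "w = (w - p * q) + p * q" by simp
        ultimately show "w \<in> {u + p * q | u p. u \<in> ?A}" by blast
      next
        fix w assume "w \<in> {u + p * q | u p. u \<in> ?A}"
        then obtain u p where w: "w = u + p * q" "u \<in> ?A" by blast
        have "w = u + (p * q0 - (p * q0 - p * q))" by (simp add: w)
        also have "\<dots> \<in> ?B"
        proof (rule ideal_ops(2)[OF submod_ideal[OF B] _ ideal_ops(3)[OF submod_ideal[OF B] pB]])
          show "u \<in> ?B" "p * q0 - p * q \<in> ?B" using w(2) AB pq by blast+
        qed
        finally show "w \<in> ?B" .
      qed
      show "highest_weight_mod s ?r ?A q"
        unfolding highest_weight_mod_def
      proof (intro allI conjI)
        fix i :: nat
        let ?c = "if i = 0 then of_nat ?r else 0 :: ypoly"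
        have c: "(if i = 0 then of_nat ?r * w else 0) = ?c * w" for w by simp
        have "hop s i q - ?c * q = (hop s i q0 - ?c * q0) - (hop s i (q0 - q) - ?c * (q0 - q))"
          by (simp add: algebra_simps)
        also have "\<dots> \<in> ?A"
        proof (rule ideal_ops(3)[OF IA _ ideal_ops(3)[OF IA]])
          show "hop s i q0 - ?c * q0 \<in> ?A" using hw0[unfolded highest_weight_mod_def, rule_format, of i] unfolding c by blast
          show "hop s i (q0 - q) \<in> ?A" using A(1) q0q unfolding submod_def by blast
          show "?c * (q0 - q) \<in> ?A" by (rule ideal_mult[OF IA q0q])
        qed
        finally show "hop s i q - (if i = 0 then of_nat ?r * q else 0) \<in> ?A" unfolding c .
        have "xop s i q = xop s i q0 - xop s i (q0 - q)" by simp
        also have "\<dots> \<in> ?A"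
          using A(1) q0q hw0 by (intro ideal_ops(3)[OF IA]) (unfold submod_def highest_weight_mod_def, blast+)
        finally show "xop s i q \<in> ?A" .
      qed
      show "{p. p * q \<in> ?A} = demazure_ideal 3 ?r"
        unfolding colon0[symmetric] using ideal_cong[OF IA pq] by blast
    qed simp
    then show ?case by simp
  qed
  from this[of "k + 1"] have "ideal_flag UNIV s (Bs (k + 1)) (map \<rho> [0..<k + 1])" by simp
  moreover have "Bs (k + 1) = demazure_ideal 2 s"
    unfolding Bs_def Fk using V.p_eq_zero by auto
  ultimately show ?thesis by simp
qed

lemma count_list_map_upt: "count_list (map \<rho> [0..<n]) r = card {j. j < n \<and> \<rho> j = r}"
proof (induction n)
  case (Suc n)
  have "{j. j < Suc n \<and> \<rho> j = r} = {j. j < n \<and> \<rho> j = r} \<union> (if \<rho> n = r then {n} else {})"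
    by (auto simp: less_Suc_eq)
  with Suc show ?case by (auto simp: card_insert_if)
qed simp

lemma demazure_multiplicity:
  "has_multiplicity 3 (demazure 2 s) r (count_list (flag_weights 0 (s div 2) (s mod 2)) r)"
  unfolding has_multiplicity_def
proof (intro conjI allI impI)
  show "\<exists>k F \<rho> \<sigma>. demazure_flag 3 (demazure 2 s) k F \<rho> \<sigma>" by (rule demazure_flag_exists)
  fix k F \<rho> \<sigma> assume "demazure_flag 3 (demazure 2 s) k F \<rho> \<sigma>"
  then have "ideal_flag UNIV s (demazure_ideal 2 s) (map \<rho> [0..<k + 1])" by (rule demazure_flag_ideal_flag)
  from ideal_flag_unique[OF this ideal_flag_demazure_ideal_2, of r]
  show "card {j. j \<le> k \<and> \<rho> j = r} = count_list (flag_weights 0 (s div 2) (s mod 2)) r"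
    unfolding count_list_map_upt by (simp add: less_Suc_eq_le)
qed

section \<open>Generating functions of the multiplicities\<close>

text \<open>The recursion never inspects \<open>a\<close>, which enters only through the final
  \<open>3 * a\<close>. This removes the first argument from the recurrences below.\<close>

lemma flag_weights_shift: "c \<le> 1 \<Longrightarrow> flag_weights (a + a') b c = map (\<lambda>r. r + 3 * a') (flag_weights a b c)"
  by (induction a b c rule: flag_weights.induct) (simp_all flip: add_Suc)

lemma count_flag_weights_Suc:
  assumes "c \<le> 1"
  shows "count_list (flag_weights (Suc 0) b c) r = (if 3 \<le> r then count_list (flag_weights 0 b c) (r - 3) else 0)"
proof -
  have "count_list (map (\<lambda>r. r + 3) xs) r = (if 3 \<le> r then count_list xs (r - 3) else 0)" for xs
    by (induction xs) auto
  then show ?thesis using flag_weights_shift[OF assms, of 0 1 b] by simp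
qed

definition gf0 :: "nat \<Rightarrow> rat fps" where
  "gf0 r = Abs_fps (\<lambda>b. of_nat (count_list (flag_weights 0 b 0) r))"

text \<open>The factor \<open>fps_X\<close> places the entry for \<open>s = 2 b + 1\<close> at the
  exponent \<open>b + 1\<close>, the ceiling of \<open>s / 2\<close>.\<close>

definition gf1 :: "nat \<Rightarrow> rat fps" where
  "gf1 r = fps_X * Abs_fps (\<lambda>b. of_nat (count_list (flag_weights 0 b 1) r))"

text \<open>The lists for \<open>b = 0\<close> and \<open>b = 1\<close> give the initial terms. For
  \<open>b + 2\<close> the recursion refers back by two steps, hence \<open>1 - u^2\<close>, and to
  a list with one more part 3, hence \<open>r - 3\<close>.\<close>

lemma gf0_rec:
  "(1 - fps_X\<^sup>2) * gf0 r = (if r = 0 then 1 else 0) + (if r = 2 then fps_X else 0) +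
     (if 3 \<le> r then fps_X * gf1 (r - 3) else 0)"
proof (rule fps_ext)
  fix b
  consider "b = 0" | "b = 1" | b' where "b = Suc (Suc b')" by (metis One_nat_def not0_implies_Suc)
  then show "fps_nth ((1 - fps_X\<^sup>2) * gf0 r) b = fps_nth ((if r = 0 then 1 else 0) +
      (if r = 2 then fps_X else 0) + (if 3 \<le> r then fps_X * gf1 (r - 3) else 0)) b"
    by cases (auto simp: gf0_def gf1_def left_diff_distrib fps_X_power_mult_nth count_flag_weights_Suc
        fps_X_nth fps_one_nth)
qed

lemma gf1_rec:
  "(1 - fps_X) * gf1 r = (if r = 1 then fps_X else 0) + (if 3 \<le> r then fps_X\<^sup>2 * gf0 (r - 3) else 0)"
proof (rule fps_ext)
  fix b
  consider "b = 0" | "b = 1" | b' where "b = Suc (Suc b')" by (metis One_nat_def not0_implies_Suc)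
  then show "fps_nth ((1 - fps_X) * gf1 r) b = fps_nth ((if r = 1 then fps_X else 0) +
      (if 3 \<le> r then fps_X\<^sup>2 * gf0 (r - 3) else 0)) b"
    by cases (auto simp: gf0_def gf1_def left_diff_distrib fps_X_power_mult_nth count_flag_weights_Suc
        fps_X_nth fps_one_nth)
qed

text \<open>Inserting one recurrence into the other lowers \<open>r\<close> by 6 at the cost of the
  factor \<open>u^3 / ((1 - u)(1 - u^2))\<close>. The six series \<open>series_P\<close> are the
  values at \<open>r < 6\<close>.\<close>

lemma gf_closed:
  assumes "r1 < 6"
  shows "(if even r1 then gf0 else gf1) (6 * r0 + r1) =
    fps_X ^ (3 * r0) * series_P r1 / ((1 - fps_X) ^ r0 * (1 - fps_X\<^sup>2) ^ r0)"
proof -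
  define A where "A = inverse (1 - fps_X :: rat fps)"
  define B where "B = inverse (1 - fps_X\<^sup>2 :: rat fps)"
  have A: "A * (1 - fps_X) = 1" unfolding A_def by (rule inverse_mult_eq_1) simp
  have B: "B * (1 - fps_X\<^sup>2) = 1" unfolding B_def by (rule inverse_mult_eq_1) simp
  have g0: "gf0 r = B * ((if r = 0 then 1 else 0) + (if r = 2 then fps_X else 0) +
     (if 3 \<le> r then fps_X * gf1 (r - 3) else 0))" for r
    unfolding gf0_rec[symmetric] using B by (simp flip: mult.assoc)
  have g1: "gf1 r = A * ((if r = 1 then fps_X else 0) + (if 3 \<le> r then fps_X\<^sup>2 * gf0 (r - 3) else 0))" for r
    unfolding gf1_rec[symmetric] using A by (simp flip: mult.assoc)
  have s0: "gf0 (6 + r) = fps_X ^ 3 * A * B * gf0 r" for r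
    using g0[of "6 + r"] g1[of "3 + r"] by (simp add: power3_eq_cube power2_eq_square algebra_simps)
  have s1: "gf1 (6 + r) = fps_X ^ 3 * A * B * gf1 r" for r
    using g1[of "6 + r"] g0[of "3 + r"] by (simp add: power3_eq_cube power2_eq_square algebra_simps)
  have it: "(if even r1 then gf0 else gf1) (6 * r0 + r1) =
      (fps_X ^ 3 * A * B) ^ r0 * (if even r1 then gf0 else gf1) r1"
  proof (induction r0)
    case (Suc r0)
    have "6 * Suc r0 + r1 = 6 + (6 * r0 + r1)" by simp
    with Suc show ?case
      by (cases "even r1") (simp_all only: s0 s1 if_True if_False power_Suc mult.assoc)
  qed simp
  have div: "f / (1 - fps_X) = A * f" "f / (1 - fps_X\<^sup>2) = B * f" for f :: "rat fps"
    unfolding A_def B_def by (simp_all add: fps_divide_unit mult.commute)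
  have inv: "inverse ((1 - fps_X) * (1 - fps_X\<^sup>2) :: rat fps) = A * B"
    unfolding A_def B_def by (rule fps_inverse_mult)
  have div2: "f / ((1 - fps_X) * (1 - fps_X\<^sup>2)) = A * B * f" for f :: "rat fps"
    by (subst fps_divide_unit) (simp_all add: inv mult.commute)
  have sP: "series_P 0 = 1 / (1 - fps_X\<^sup>2)" "series_P 1 = fps_X / (1 - fps_X)"
    "series_P 2 = fps_X / (1 - fps_X\<^sup>2)"
    "series_P 3 = fps_X\<^sup>2 / ((1 - fps_X) * (1 - fps_X\<^sup>2))"
    "series_P 4 = fps_X\<^sup>2 / ((1 - fps_X) * (1 - fps_X\<^sup>2))"
    "series_P 5 = fps_X ^ 3 / ((1 - fps_X) * (1 - fps_X\<^sup>2))"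
    by (simp_all add: series_P_def Let_def)
  have v012: "gf0 0 = B" "gf1 1 = A * fps_X" "gf0 2 = B * fps_X"
    using g0[of 0] g1[of 1] g0[of 2] by simp_all
  have v345: "gf1 3 = A * (fps_X\<^sup>2 * B)" "gf0 4 = B * (fps_X * (A * fps_X))"
    "gf1 5 = A * (fps_X\<^sup>2 * (B * fps_X))"
    using g1[of 3] g0[of 4] g1[of 5] v012 by simp_all
  have P: "(if even r1 then gf0 else gf1) r1 = series_P r1"
  proof -
    have "gf0 0 = series_P 0" "gf1 1 = series_P 1" "gf0 2 = series_P 2"
      "gf1 3 = series_P 3" "gf0 4 = series_P 4" "gf1 5 = series_P 5"
      unfolding sP div div2 v012 v345 by (simp_all add: power2_eq_square power3_eq_cube mult_ac)
    moreover have "r1 \<in> {0, 1, 2, 3, 4, 5}" using assms by auto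
    ultimately show ?thesis by (elim insertE emptyE) simp_all
  qed
  have "inverse ((1 - fps_X) ^ r0 * (1 - fps_X\<^sup>2) ^ r0 :: rat fps) = A ^ r0 * B ^ r0"
    unfolding A_def B_def by (simp add: fps_inverse_mult fps_inverse_power)
  then have "fps_X ^ (3 * r0) * series_P r1 / ((1 - fps_X) ^ r0 * (1 - fps_X\<^sup>2) ^ r0) =
      fps_X ^ (3 * r0) * series_P r1 * (A ^ r0 * B ^ r0)"
    by (subst fps_divide_unit) (simp_all add: fps_power_zeroth)
  then show ?thesis
    unfolding it P power_mult power_mult_distrib by (simp add: mult_ac)
qed

theorem proposition3p9:
  fixes s :: nat
  shows "(\<exists>k F \<rho> \<sigma>. demazure_flag 3 (demazure 2 s) k F \<rho> \<sigma>) \<and>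
    (\<forall>r r0 r1 :: nat. r = 6 * r0 + r1 \<and> r1 < 6 \<longrightarrow>
      (\<exists>m. has_multiplicity 3 (demazure 2 s) r m \<and>
        (of_nat m :: rat) =
          (if s mod 2 = r mod 2
           then fps_nth (fps_X ^ (3 * r0) * series_P r1 / ((1 - fps_X) ^ r0 * (1 - fps_X\<^sup>2) ^ r0))
             (nat \<lceil>real s / 2\<rceil>)
           else 0)))"
proof (intro conjI allI impI)
  show "\<exists>k F \<rho> \<sigma>. demazure_flag 3 (demazure 2 s) k F \<rho> \<sigma>" by (rule demazure_flag_exists)
  fix r r0 r1 :: nat assume r: "r = 6 * r0 + r1 \<and> r1 < 6"
  define m where "m = count_list (flag_weights 0 (s div 2) (s mod 2)) r"
  have par: "r mod 2 = r1 mod 2" using r by presburger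
  have "(of_nat m :: rat) = (if s mod 2 = r mod 2
      then fps_nth (fps_X ^ (3 * r0) * series_P r1 / ((1 - fps_X) ^ r0 * (1 - fps_X\<^sup>2) ^ r0))
        (nat \<lceil>real s / 2\<rceil>) else 0)"
  proof (cases "s mod 2 = r mod 2")
    case False
    have "r \<notin> set (flag_weights 0 (s div 2) (s mod 2))"
    proof
      assume "r \<in> set (flag_weights 0 (s div 2) (s mod 2))"
      then obtain e where "s = r + 2 * e" using ideal_flag_weights[OF ideal_flag_demazure_ideal_2] by blast
      then show False using False by simp
    qed
    then have "m = 0" by (simp add: m_def count_list_0_iff)
    with False show ?thesis by simp
  next
    case True
    have "of_nat m = fps_nth ((if even r1 then gf0 else gf1) (6 * r0 + r1)) (nat \<lceil>real s / 2\<rceil>)"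
    proof (cases "even s")
      case T: True
      then obtain b where s: "s = 2 * b" by blast
      have "even r1" using T True par by presburger
      then show ?thesis using r by (simp add: gf0_def m_def s)
    next
      case F: False
      then obtain b where s: "s = 2 * b + 1" by (rule oddE)
      have "odd r1" using F True par by presburger
      moreover have "\<lceil>real s / 2\<rceil> = int b + 1"
        by (rule ceiling_unique) (simp_all add: s)
      then have "nat \<lceil>real s / 2\<rceil> = Suc b" by simp
      ultimately show ?thesis using r by (simp add: gf1_def m_def s)
    qed
    also have "\<dots> = fps_nth (fps_X ^ (3 * r0) * series_P r1 / ((1 - fps_X) ^ r0 * (1 - fps_X\<^sup>2) ^ r0))
        (nat \<lceil>real s / 2\<rceil>)"
      using r by (subst gf_closed) simp_all
    finally show ?thesis using True by simp
  qed
  then show "\<exists>m. has_multiplicity 3 (demazure 2 s) r m \<and> (of_nat m :: rat) = (if s mod 2 = r mod 2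
      then fps_nth (fps_X ^ (3 * r0) * series_P r1 / ((1 - fps_X) ^ r0 * (1 - fps_X\<^sup>2) ^ r0))
        (nat \<lceil>real s / 2\<rceil>) else 0)"
    using demazure_multiplicity[of s r] unfolding m_def by blast
qed

end
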